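(* In the setting described in the context, the quantum BRST differential $$\boldsymbol D=\boldsymbol\delta+2\boldsymbol\partial$$ is a linear combination of two super-commuting differentials $\boldsymbol\delta$ and $\boldsymbol\partial$; that is, $\boldsymbol D=\boldsymbol\delta+2\boldsymbol\partial$ with $\boldsymbol\delta^2=0$, $\boldsymbol\partial^2=0$ and $\boldsymbol\delta\boldsymbol\partial+\boldsymbol\partial\boldsymbol\delta=0$.
   Context: $\mathbb K=\mathbb R$ or $\mathbb C$. $M$ is a symplectic manifold with a Hamiltonian action of a connected Lie group with Lie algebra $\mathfrak g$ and moment map $J:M\to\mathfrak g^*$; $e_1,\dots,e_\ell$ is a basis of $\mathfrak g$ with structure constants $f_{ab}^c$. $\star$ is a star product on $M$: an associative $\mathbb K[[\nu]]$-bilinear product $f\star g=fg+\sum_{i\ge1}\nu^i\mu_i(f,g)$ on $\mathcal C^\infty(M)[[\nu]]$ with unit $1$, $\mu_i$ bidifferential operators, $\mu_1(f,g)-\mu_1(g,f)=\{f,g\}$. $\boldsymbol J=J+\sum_{i\ge1}\nu^iJ_i$ is a quantum moment map: with $\boldsymbol J_a=\boldsymbol J(e_a)\in\mathcal C^\infty(M)[[\nu]]$, $\boldsymbol J_a\star\boldsymbol J_b-\boldsymbol J_b\star\boldsymbol J_a=\nu\sum_cf_{ab}^c\boldsymbol J_c$. $\mathscr A=\mathcal C^\infty(M)\otimes\wedge(\mathfrak g^*\oplus\mathfrak g)$ is the supercommutative algebra generated over $\mathcal C^\infty(M)$ by odd ghosts $\xi^a$ (degree $1$, dual basis of $\mathfrak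 g^*$) and antighosts $\xi_a$ (degree $-1$, basis of $\mathfrak g$); $\frac{\partial}{\partial\xi^a},\frac{\partial}{\partial\xi_a}$ are left derivations. Product on $\mathscr A[[\nu]]$: $(fv)*(gw)=(f\star g)(v\cdot w)$ with $v\cdot w=\mu\big(\exp(-2\nu\sum_a\frac{\partial}{\partial\xi_a}\otimes\frac{\partial}{\partial\xi^a})(v\otimes w)\big)$, where $\mu$ is the supercommutative product and $\otimes$ the graded tensor product. Put $\boldsymbol\theta=-\frac14\sum f_{ab}^c\xi^a\xi^b\xi_c+\sum_a\boldsymbol J_a\xi^a+\frac\nu2\sum_{a,b}f_{ab}^b\xi^a$ and $\boldsymbol D=\frac1\nu[\boldsymbol\theta,\cdot]_*$ (graded commutator). For $f\in\mathcal C^\infty(M)$, $v\in\wedge(\mathfrak g^*\oplus\mathfrak g)$, extended $\mathbb K[[\nu]]$-linearly: $$\boldsymbol\delta(fv)=-\tfrac12\sum f_{ab}^cf\xi^a\xi^b\frac{\partial v}{\partial\xi^c}+\sum f_{ab}^cf\xi^a\xi_c\frac{\partial v}{\partial\xi_b}+\sum_a\tfrac1\nu[\boldsymbol J_a,f]_\star\,\xi^av,$$ $$\boldsymbol\partial(fv)=\sum_af\star\boldsymbol J_a\frac{\partial v}{\partial\xi_a}+\frac\nu2\sum_{a,b}f_{ab}^bf\frac{\partial v}{\partial\xi_a}+\frac\nu2\sum f_{ab}^cf\,\xi_c\frac{\partial^2v}{\partial\xi_a\partial\xi_b}.$$ *)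

theory Defs
  imports
    "HOL-Analysis.Analysis"
    "HOL-Algebra.Group_Action"
    "HOL-Library.Function_Algebras"
    "HOL-Computational_Algebra.Formal_Power_Series"
begin

section \<open>Smooth manifolds\<close>

text \<open>
  A manifold is a whole type (Hausdorff and second countable by its type classes) together with a
  smooth atlas. Charts take values in a finite-dimensional real normed space; the class
  \<^class>\<open>euclidean_space\<close> would exclude dimension zero.
\<close>

primrec Ck_on :: "nat \<Rightarrow> 'e::real_normed_vector set \<Rightarrow> ('e \<Rightarrow> 'f::real_normed_vector) \<Rightarrow> bool" where
  "Ck_on 0 S f = continuous_on S f"
| "Ck_on (Suc n) S f \<longleftrightarrow>
     (\<forall>x\<in>S. f differentiable (at x)) \<and>
     (\<forall>v. Ck_on n S (\<lambda>x. frechet_derivative f (at x) v))"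

definition smooth_on :: "'e::real_normed_vector set \<Rightarrow> ('e \<Rightarrow> 'f::real_normed_vector) \<Rightarrow> bool" where
  "smooth_on S f \<longleftrightarrow> (\<forall>n. Ck_on n S f)"

type_synonym ('m, 'e) atlas = "('m set \<times> ('m \<Rightarrow> 'e)) set"

definition smooth_atlas ::
    "('m::{t2_space,second_countable_topology}, 'e::real_normed_vector) atlas \<Rightarrow> bool" where
  "smooth_atlas A \<longleftrightarrow>
     (\<exists>B::'e set. finite B \<and> span B = UNIV) \<and>
     (\<Union>(U, \<phi>)\<in>A. U) = UNIV \<and>
     (\<forall>(U, \<phi>)\<in>A. open U \<and> open (\<phi> ` U) \<and> homeomorphism U (\<phi> ` U) \<phi> (inv_into U \<phi>)) \<and>
     (\<forall>(U, \<phi>)\<in>A. \<forall>(V, \<psi>)\<in>A. smooth_on (\<phi> ` (U \<inter> V)) (\<psi> \<circ> inv_into U \<phi>))"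

definition cinf :: "('m, 'e::real_normed_vector) atlas \<Rightarrow> ('m \<Rightarrow> 'f::real_normed_vector) set" where
  "cinf A = {f. \<forall>(U, \<phi>)\<in>A. smooth_on (\<phi> ` U) (f \<circ> inv_into U \<phi>)}"

definition smooth_map ::
    "('m::topological_space, 'e::real_normed_vector) atlas \<Rightarrow>
     ('n::topological_space, 'f::real_normed_vector) atlas \<Rightarrow> ('m \<Rightarrow> 'n) \<Rightarrow> bool" where
  "smooth_map A B F \<longleftrightarrow>
     continuous_on UNIV F \<and>
     (\<forall>(U, \<phi>)\<in>A. \<forall>(V, \<psi>)\<in>B. smooth_on (\<phi> ` (U \<inter> F -` V)) (\<psi> \<circ> F \<circ> inv_into U \<phi>))"

definition prod_atlas :: "('m, 'e) atlas \<Rightarrow> ('n, 'f) atlas \<Rightarrow> ('m \<times> 'n, 'e \<times> 'f) atlas" where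
  "prod_atlas A B = (\<lambda>((U, \<phi>), (V, \<psi>)). (U \<times> V, map_prod \<phi> \<psi>)) ` (A \<times> B)"


section \<open>Tangent vectors, vector fields, symplectic forms\<close>

text \<open>Tangent vectors are point derivations of the smooth real functions; the value 0 elsewhere
  makes equality of tangent vectors coincide with equality of functions.\<close>

type_synonym 'm tvec = "('m \<Rightarrow> real) \<Rightarrow> real"
type_synonym 'm vfield = "('m \<Rightarrow> real) \<Rightarrow> ('m \<Rightarrow> real)"

definition tangent_space :: "('m, 'e::real_normed_vector) atlas \<Rightarrow> 'm \<Rightarrow> 'm tvec set" where
  "tangent_space A p = {v.
     (\<forall>f\<in>cinf A. \<forall>g\<in>cinf A. v (\<lambda>q. f q + g q) = v f + v g) \<and>
     (\<forall>f\<in>cinf A. \<forall>r. v (\<lambda>q. r * f q) = r * v f) \<and>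
     (\<forall>f\<in>cinf A. \<forall>g\<in>cinf A. v (\<lambda>q. f q * g q) = v f * g p + f p * v g) \<and>
     (\<forall>f. f \<notin> cinf A \<longrightarrow> v f = 0)}"

definition vf_at :: "'m vfield \<Rightarrow> 'm \<Rightarrow> 'm tvec" where
  "vf_at X p = (\<lambda>f. X f p)"

definition vector_fields :: "('m, 'e::real_normed_vector) atlas \<Rightarrow> 'm vfield set" where
  "vector_fields A = {X. (\<forall>p. vf_at X p \<in> tangent_space A p) \<and> (\<forall>f\<in>cinf A. X f \<in> cinf A)}"

definition lie_bracket :: "'m vfield \<Rightarrow> 'm vfield \<Rightarrow> 'm vfield" where
  "lie_bracket X Y = (\<lambda>f p. X (Y f) p - Y (X f) p)"

type_synonym 'm two_form = "'m \<Rightarrow> 'm tvec \<Rightarrow> 'm tvec \<Rightarrow> real"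

definition eval_form :: "'m two_form \<Rightarrow> 'm vfield \<Rightarrow> 'm vfield \<Rightarrow> 'm \<Rightarrow> real" where
  "eval_form \<omega> X Y = (\<lambda>p. \<omega> p (vf_at X p) (vf_at Y p))"

definition differential_two_form :: "('m, 'e::real_normed_vector) atlas \<Rightarrow> 'm two_form \<Rightarrow> bool" where
  "differential_two_form A \<omega> \<longleftrightarrow>
     (\<forall>p. \<forall>u\<in>tangent_space A p. \<forall>v\<in>tangent_space A p. \<forall>w\<in>tangent_space A p. \<forall>r.
        \<omega> p (\<lambda>f. u f + v f) w = \<omega> p u w + \<omega> p v w \<and>
        \<omega> p w (\<lambda>f. u f + v f) = \<omega> p w u + \<omega> p w v \<and>
        \<omega> p (\<lambda>f. r * u f) w = r * \<omega> p u w \<and>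
        \<omega> p w (\<lambda>f. r * u f) = r * \<omega> p w u \<and>
        \<omega> p u u = 0) \<and>
     (\<forall>X\<in>vector_fields A. \<forall>Y\<in>vector_fields A. eval_form \<omega> X Y \<in> cinf A)"

definition closed_two_form :: "('m, 'e::real_normed_vector) atlas \<Rightarrow> 'm two_form \<Rightarrow> bool" where
  "closed_two_form A \<omega> \<longleftrightarrow>
     (\<forall>X\<in>vector_fields A. \<forall>Y\<in>vector_fields A. \<forall>Z\<in>vector_fields A. \<forall>p.
        X (eval_form \<omega> Y Z) p - Y (eval_form \<omega> X Z) p + Z (eval_form \<omega> X Y) p
        - eval_form \<omega> (lie_bracket X Y) Z p
        + eval_form \<omega> (lie_bracket X Z) Y p
        - eval_form \<omega> (lie_bracket Y Z) X p = 0)"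

definition symplectic_manifold ::
    "('m::{t2_space,second_countable_topology}, 'e::real_normed_vector) atlas \<Rightarrow>
     'm two_form \<Rightarrow> bool" where
  "symplectic_manifold A \<omega> \<longleftrightarrow>
     smooth_atlas A \<and> differential_two_form A \<omega> \<and> closed_two_form A \<omega> \<and>
     (\<forall>p. \<forall>v\<in>tangent_space A p. (\<forall>w\<in>tangent_space A p. \<omega> p v w = 0) \<longrightarrow> v = (\<lambda>f. 0))"

text \<open>Sign conventions: \<open>\<omega>(X\<^sub>h, \<cdot>) = dh\<close> and \<open>{h, k} = \<omega>(X\<^sub>h, X\<^sub>k)\<close>,
  so that \<open>{q, p} = 1\<close> for \<open>\<omega> = dq \<and> dp\<close>.\<close>

definition hamiltonian_vector ::
    "('m, 'e::real_normed_vector) atlas \<Rightarrow> 'm two_form \<Rightarrow> ('m \<Rightarrow> real) \<Rightarrow> 'm \<Rightarrow> 'm tvec" where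
  "hamiltonian_vector A \<omega> h p =
     (THE v. v \<in> tangent_space A p \<and> (\<forall>w\<in>tangent_space A p. \<omega> p v w = w h))"

definition poisson ::
    "('m, 'e::real_normed_vector) atlas \<Rightarrow> 'm two_form \<Rightarrow>
     ('m \<Rightarrow> real) \<Rightarrow> ('m \<Rightarrow> real) \<Rightarrow> ('m \<Rightarrow> real)" where
  "poisson A \<omega> h k =
     (\<lambda>p. \<omega> p (hamiltonian_vector A \<omega> h p) (hamiltonian_vector A \<omega> k p))"


section \<open>Lie groups and Hamiltonian actions\<close>

definition lie_group ::
    "('g::{t2_space,second_countable_topology}, 'd::real_normed_vector) atlas \<Rightarrow>
     'g monoid \<Rightarrow> bool" where
  "lie_group A G \<longleftrightarrow>
     smooth_atlas A \<and> group G \<and> carrier G = UNIV \<and>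
     smooth_map (prod_atlas A A) A (\<lambda>(g, h). g \<otimes>\<^bsub>G\<^esub> h) \<and>
     smooth_map A A (\<lambda>g. inv\<^bsub>G\<^esub> g)"

text \<open>The Lie algebra consists of the left-invariant vector fields, with \<^const>\<open>lie_bracket\<close>.\<close>

definition lie_algebra ::
    "('g, 'd::real_normed_vector) atlas \<Rightarrow> 'g monoid \<Rightarrow> 'g vfield set" where
  "lie_algebra A G = {X \<in> vector_fields A.
     \<forall>g. \<forall>f\<in>cinf A. X (\<lambda>h. f (g \<otimes>\<^bsub>G\<^esub> h)) = (\<lambda>h. X f (g \<otimes>\<^bsub>G\<^esub> h))}"

definition lie_algebra_basis ::
    "('g, 'd::real_normed_vector) atlas \<Rightarrow> 'g monoid \<Rightarrow> nat \<Rightarrow> (nat \<Rightarrow> 'g vfield) \<Rightarrow> bool" where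
  "lie_algebra_basis A G l e \<longleftrightarrow>
     (\<forall>a<l. e a \<in> lie_algebra A G) \<and>
     (\<forall>X\<in>lie_algebra A G. \<exists>!c. (\<forall>a\<ge>l. c a = 0) \<and> X = (\<lambda>\<phi> g. \<Sum>a<l. c a * e a \<phi> g))"

definition structure_constants ::
    "nat \<Rightarrow> (nat \<Rightarrow> 'g vfield) \<Rightarrow> (nat \<Rightarrow> nat \<Rightarrow> nat \<Rightarrow> real) \<Rightarrow> bool" where
  "structure_constants l e f \<longleftrightarrow>
     (\<forall>a<l. \<forall>b<l. lie_bracket (e a) (e b) = (\<lambda>\<phi> g. \<Sum>c<l. f a b c * e c \<phi> g))"

text \<open>Push-forward of a left-invariant vector field along \<open>h \<mapsto> g h g\<inverse>\<close>.\<close>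

definition adjoint :: "'g monoid \<Rightarrow> 'g \<Rightarrow> 'g vfield \<Rightarrow> 'g vfield" where
  "adjoint G g X =
     (\<lambda>f h. X (\<lambda>k. f (g \<otimes>\<^bsub>G\<^esub> k \<otimes>\<^bsub>G\<^esub> inv\<^bsub>G\<^esub> g)) (inv\<^bsub>G\<^esub> g \<otimes>\<^bsub>G\<^esub> h \<otimes>\<^bsub>G\<^esub> g))"

text \<open>The fundamental vector field at \<open>p\<close> is the image of \<open>X\<^sub>e\<close> under the differential of
  the orbit map \<open>g \<mapsto> g p\<close>, i.e. the velocity of \<open>exp (t X) p\<close> at \<open>t = 0\<close>.\<close>

definition fundamental ::
    "('m, 'e::real_normed_vector) atlas \<Rightarrow> 'g monoid \<Rightarrow> ('g \<Rightarrow> 'm \<Rightarrow> 'm) \<Rightarrow>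
     'g vfield \<Rightarrow> 'm \<Rightarrow> 'm tvec" where
  "fundamental A G act X p = (\<lambda>f. if f \<in> cinf A then X (\<lambda>g. f (act g p)) \<one>\<^bsub>G\<^esub> else 0)"

definition smooth_action ::
    "('g::topological_space, 'd::real_normed_vector) atlas \<Rightarrow> 'g monoid \<Rightarrow>
     ('m::topological_space, 'e::real_normed_vector) atlas \<Rightarrow> ('g \<Rightarrow> 'm \<Rightarrow> 'm) \<Rightarrow> bool" where
  "smooth_action AG G A act \<longleftrightarrow>
     group_action G UNIV act \<and> smooth_map (prod_atlas AG A) A (\<lambda>(g, p). act g p)"

definition moment_map ::
    "('g::topological_space, 'd::real_normed_vector) atlas \<Rightarrow> 'g monoid \<Rightarrow>
     ('m::topological_space, 'e::real_normed_vector) atlas \<Rightarrow> 'm two_form \<Rightarrow>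
     ('g \<Rightarrow> 'm \<Rightarrow> 'm) \<Rightarrow> ('m \<Rightarrow> 'g vfield \<Rightarrow> real) \<Rightarrow> bool" where
  "moment_map AG G A \<omega> act J \<longleftrightarrow>
     (\<forall>p. \<forall>X\<in>lie_algebra AG G. \<forall>Y\<in>lie_algebra AG G. \<forall>r.
        J p (\<lambda>\<phi> g. X \<phi> g + Y \<phi> g) = J p X + J p Y \<and>
        J p (\<lambda>\<phi> g. r * X \<phi> g) = r * J p X) \<and>
     (\<forall>X\<in>lie_algebra AG G. (\<lambda>p. J p X) \<in> cinf A) \<and>
     (\<forall>X\<in>lie_algebra AG G. \<forall>p. \<forall>w\<in>tangent_space A p.
        \<omega> p (fundamental A G act X p) w = w (\<lambda>q. J q X)) \<and>
     (\<forall>g p. \<forall>X\<in>lie_algebra AG G. J (act g p) X = J p (adjoint G (inv\<^bsub>G\<^esub> g) X))"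


section \<open>Star products and quantum moment maps\<close>

text \<open>
  The scalar field \<open>\<bbbK>\<close> is a type of class \<^class>\<open>real_normed_field\<close>; by the Gelfand--Mazur theorem
  these are, up to isomorphism, exactly the real and the complex numbers. Formal power series
  \<open>\<C>\<^sup>\<infinity>(M)[[\<nu>]]\<close> are elements of \<^typ>\<open>('m \<Rightarrow> 'k) fps\<close> with smooth coefficients; \<open>\<nu>\<close> is
  \<^const>\<open>fps_X\<close>, and the ring operations of this type are built from pointwise multiplication.
\<close>

definition cinf_fps ::
    "('m, 'e::real_normed_vector) atlas \<Rightarrow> ('m \<Rightarrow> 'k::real_normed_field) fps set" where
  "cinf_fps A = {F. \<forall>n. fps_nth F n \<in> cinf A}"

definition real_const :: "real \<Rightarrow> ('m \<Rightarrow> 'k::real_normed_field) fps" where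
  "real_const r = fps_const (\<lambda>_. of_real r)"

definition scalar_series :: "'k::real_normed_field fps \<Rightarrow> ('m \<Rightarrow> 'k) fps" where
  "scalar_series c = Abs_fps (\<lambda>n _. fps_nth c n)"

text \<open>Division by \<open>\<nu>\<close>; an unspecified value for series that are not multiples of \<open>\<nu>\<close>.\<close>

definition nu_div :: "('m \<Rightarrow> 'k::real_normed_field) fps \<Rightarrow> ('m \<Rightarrow> 'k) fps" where
  "nu_div F = (THE H. fps_X * H = F)"

primrec iterated_deriv ::
    "'e::real_normed_vector list \<Rightarrow> ('e \<Rightarrow> 'k::real_normed_field) \<Rightarrow> 'e \<Rightarrow> 'k" where
  "iterated_deriv [] f = f"
| "iterated_deriv (v # vs) f = (\<lambda>x. frechet_derivative (iterated_deriv vs f) (at x) v)"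

text \<open>Lists of vectors play the role of multi-indices.\<close>

definition bidifferential_operator ::
    "('m::topological_space, 'e::real_normed_vector) atlas \<Rightarrow>
     (('m \<Rightarrow> 'k::real_normed_field) \<Rightarrow> ('m \<Rightarrow> 'k) \<Rightarrow> ('m \<Rightarrow> 'k)) \<Rightarrow> bool" where
  "bidifferential_operator A B \<longleftrightarrow>
     (\<forall>f\<in>cinf A. \<forall>g\<in>cinf A. B f g \<in> cinf A) \<and>
     (\<forall>f\<in>cinf A. \<forall>g\<in>cinf A. \<forall>h\<in>cinf A. \<forall>r.
        B (\<lambda>p. f p + g p) h = (\<lambda>p. B f h p + B g h p) \<and>
        B h (\<lambda>p. f p + g p) = (\<lambda>p. B h f p + B h g p) \<and>
        B (\<lambda>p. r * f p) h = (\<lambda>p. r * B f h p) \<and>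
        B h (\<lambda>p. r * f p) = (\<lambda>p. r * B h f p)) \<and>
     (\<forall>(U, \<phi>)\<in>A. \<forall>p\<in>U. \<exists>V (I :: ('e list \<times> 'e list) set) (c :: 'e list \<Rightarrow> 'e list \<Rightarrow> 'e \<Rightarrow> 'k).
        open V \<and> p \<in> V \<and> V \<subseteq> U \<and> finite I \<and>
        (\<forall>(\<alpha>, \<beta>)\<in>I. smooth_on (\<phi> ` V) (c \<alpha> \<beta>)) \<and>
        (\<forall>f\<in>cinf A. \<forall>g\<in>cinf A. \<forall>x\<in>\<phi> ` V.
           B f g (inv_into U \<phi> x) =
           (\<Sum>(\<alpha>, \<beta>)\<in>I. c \<alpha> \<beta> x * iterated_deriv \<alpha> (f \<circ> inv_into U \<phi>) x
                                  * iterated_deriv \<beta> (g \<circ> inv_into U \<phi>) x)))"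

text \<open>The \<open>\<bbbK>[[\<nu>]]\<close>-bilinear extension of \<open>f \<star> g = \<Sum>i. \<nu>\<^sup>i \<mu>\<^sub>i(f, g)\<close>.\<close>

definition star ::
    "(nat \<Rightarrow> ('m \<Rightarrow> 'k) \<Rightarrow> ('m \<Rightarrow> 'k) \<Rightarrow> ('m \<Rightarrow> 'k)) \<Rightarrow>
     ('m \<Rightarrow> 'k::real_normed_field) fps \<Rightarrow> ('m \<Rightarrow> 'k) fps \<Rightarrow> ('m \<Rightarrow> 'k) fps" where
  "star \<mu> F H = Abs_fps (\<lambda>n. \<Sum>i\<le>n. \<Sum>j\<le>n - i. \<mu> i (fps_nth F j) (fps_nth H (n - i - j)))"

text \<open>The condition on \<open>\<mu>\<^sub>1\<close> is stated on real-valued functions; this determines the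
  \<open>\<bbbK>\<close>-bilinear extension of the Poisson bracket.\<close>

definition star_product ::
    "('m::topological_space, 'e::real_normed_vector) atlas \<Rightarrow> 'm two_form \<Rightarrow>
     (nat \<Rightarrow> ('m \<Rightarrow> 'k::real_normed_field) \<Rightarrow> ('m \<Rightarrow> 'k) \<Rightarrow> ('m \<Rightarrow> 'k)) \<Rightarrow> bool" where
  "star_product A \<omega> \<mu> \<longleftrightarrow>
     (\<forall>f\<in>cinf A. \<forall>g\<in>cinf A. \<mu> 0 f g = (\<lambda>p. f p * g p)) \<and>
     (\<forall>i\<ge>1. bidifferential_operator A (\<mu> i)) \<and>
     (\<forall>F\<in>cinf_fps A. \<forall>H\<in>cinf_fps A. star \<mu> F H \<in> cinf_fps A) \<and>
     (\<forall>F\<in>cinf_fps A. \<forall>H\<in>cinf_fps A. \<forall>K\<in>cinf_fps A.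
        star \<mu> (star \<mu> F H) K = star \<mu> F (star \<mu> H K)) \<and>
     (\<forall>F\<in>cinf_fps A. star \<mu> 1 F = F \<and> star \<mu> F 1 = F) \<and>
     (\<forall>f\<in>cinf A. \<forall>g\<in>cinf A. \<forall>p.
        \<mu> 1 (\<lambda>q. of_real (f q)) (\<lambda>q. of_real (g q)) p
        - \<mu> 1 (\<lambda>q. of_real (g q)) (\<lambda>q. of_real (f q)) p = of_real (poisson A \<omega> f g p))"

definition star_commutator ::
    "(nat \<Rightarrow> ('m \<Rightarrow> 'k) \<Rightarrow> ('m \<Rightarrow> 'k) \<Rightarrow> ('m \<Rightarrow> 'k)) \<Rightarrow>
     ('m \<Rightarrow> 'k::real_normed_field) fps \<Rightarrow> ('m \<Rightarrow> 'k) fps \<Rightarrow> ('m \<Rightarrow> 'k) fps" where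
  "star_commutator \<mu> F H = star \<mu> F H - star \<mu> H F"

definition quantum_moment_map ::
    "('g, 'd::real_normed_vector) atlas \<Rightarrow> 'g monoid \<Rightarrow> nat \<Rightarrow> (nat \<Rightarrow> 'g vfield) \<Rightarrow>
     (nat \<Rightarrow> nat \<Rightarrow> nat \<Rightarrow> real) \<Rightarrow> ('m, 'e::real_normed_vector) atlas \<Rightarrow>
     (nat \<Rightarrow> ('m \<Rightarrow> 'k) \<Rightarrow> ('m \<Rightarrow> 'k) \<Rightarrow> ('m \<Rightarrow> 'k)) \<Rightarrow> ('m \<Rightarrow> 'g vfield \<Rightarrow> real) \<Rightarrow>
     ('g vfield \<Rightarrow> ('m \<Rightarrow> 'k::real_normed_field) fps) \<Rightarrow> bool" where
  "quantum_moment_map AG G l e f A \<mu> J \<J> \<longleftrightarrow>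
     (\<forall>X\<in>lie_algebra AG G. \<J> X \<in> cinf_fps A \<and> fps_nth (\<J> X) 0 = (\<lambda>p. of_real (J p X))) \<and>
     (\<forall>X\<in>lie_algebra AG G. \<forall>Y\<in>lie_algebra AG G. \<forall>r.
        \<J> (\<lambda>\<phi> g. X \<phi> g + Y \<phi> g) = \<J> X + \<J> Y \<and>
        \<J> (\<lambda>\<phi> g. r * X \<phi> g) = real_const r * \<J> X) \<and>
     (\<forall>a<l. \<forall>b<l. star_commutator \<mu> (\<J> (e a)) (\<J> (e b)) =
        fps_X * (\<Sum>c<l. real_const (f a b c) * \<J> (e c)))"


section \<open>The ghost algebra\<close>

text \<open>
  Elements of a Grassmann algebra are written in the basis of the monomials \<open>e\<^sub>S\<close>, the products of
  the odd generators with index in \<open>S\<close> in increasing order: \<open>x\<close> stands for \<open>\<Sum>S. x S e\<^sub>S\<close>. For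
  \<open>\<and>(\<gg>\<^sup>* \<oplus> \<gg>)\<close> with \<open>dim \<gg> = l\<close> the generators are \<open>0, \<dots>, 2 l - 1\<close>, where \<open>\<xi>\<^sup>a\<close> and
  \<open>\<xi>\<^sub>a\<close> (\<open>a < l\<close>) have the indices below.
\<close>

type_synonym 'c grassmann = "nat set \<Rightarrow> 'c"

definition ghost :: "nat \<Rightarrow> nat" where
  "ghost a = 2 * a"

definition antighost :: "nat \<Rightarrow> nat" where
  "antighost a = 2 * a + 1"

definition monomial :: "nat set \<Rightarrow> 'c::comm_ring_1 grassmann" where
  "monomial S = (\<lambda>T. if T = S then 1 else 0)"

definition generator :: "nat \<Rightarrow> 'c::comm_ring_1 grassmann" where
  "generator i = monomial {i}"

text \<open>\<open>e\<^sub>S e\<^sub>T = shuffle_sign S T e\<^bsub>S \<union> T\<^esub>\<close> for disjoint \<open>S\<close> and \<open>T\<close>.\<close>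

definition shuffle_sign :: "nat set \<Rightarrow> nat set \<Rightarrow> 'c::comm_ring_1" where
  "shuffle_sign S T = (- 1) ^ card {(s, t). s \<in> S \<and> t \<in> T \<and> t < s}"

definition tensor_mult :: "'c::comm_ring_1 grassmann grassmann \<Rightarrow> 'c grassmann" where
  "tensor_mult t = (\<lambda>U. \<Sum>S\<in>Pow U. shuffle_sign S (U - S) * t S (U - S))"

definition wedge :: "'c::comm_ring_1 grassmann \<Rightarrow> 'c grassmann \<Rightarrow> 'c grassmann" where
  "wedge x y = tensor_mult (\<lambda>S T. x S * y T)"

definition left_deriv :: "nat \<Rightarrow> 'c::comm_ring_1 grassmann \<Rightarrow> 'c grassmann" where
  "left_deriv i x =
     (\<lambda>U. if i \<in> U then 0 else (- 1) ^ card {s\<in>U. s < i} * x (insert i U))"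

text \<open>The operator \<open>\<partial>\<^sub>i \<otimes> \<partial>\<^sub>j\<close> on the graded tensor square: it maps \<open>v \<otimes> w\<close> to
  \<open>(-1)\<^bsup>|v|\<^esup> \<partial>\<^sub>i v \<otimes> \<partial>\<^sub>j w\<close>.\<close>

definition tensor_deriv ::
    "nat \<Rightarrow> nat \<Rightarrow> 'c::comm_ring_1 grassmann grassmann \<Rightarrow> 'c grassmann grassmann" where
  "tensor_deriv i j t =
     (\<lambda>S T. left_deriv i (\<lambda>R. (- 1) ^ card R * left_deriv j (t R) T) S)"

definition contraction ::
    "nat \<Rightarrow> 'c::comm_ring_1 grassmann grassmann \<Rightarrow> 'c grassmann grassmann" where
  "contraction l t = (\<lambda>S T. \<Sum>a<l. tensor_deriv (antighost a) (ghost a) t S T)"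

text \<open>\<open>v \<cdot> w\<close> for \<open>v, w \<in> \<and>(\<gg>\<^sup>* \<oplus> \<gg>)\<close>; the coefficient of \<open>\<nu>\<^sup>n\<close> comes from the \<open>n\<close>-th
  term of the exponential series.\<close>

definition clifford ::
    "nat \<Rightarrow> 'k::real_normed_field grassmann \<Rightarrow> 'k grassmann \<Rightarrow> 'k fps grassmann" where
  "clifford l v w = (\<lambda>U. Abs_fps (\<lambda>n.
     (- 2) ^ n / fact n * tensor_mult ((contraction l ^^ n) (\<lambda>S T. v S * w T)) U))"

text \<open>\<open>\<A>[[\<nu>]]\<close>.\<close>

definition ghost_algebra ::
    "('m, 'e::real_normed_vector) atlas \<Rightarrow> nat \<Rightarrow>
     ('m \<Rightarrow> 'k::real_normed_field) fps grassmann set" where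
  "ghost_algebra A l =
     {x. (\<forall>S. x S \<in> cinf_fps A) \<and> (\<forall>S. \<not> S \<subseteq> {..<2 * l} \<longrightarrow> x S = 0)}"

definition ghost_mult ::
    "(nat \<Rightarrow> ('m \<Rightarrow> 'k) \<Rightarrow> ('m \<Rightarrow> 'k) \<Rightarrow> ('m \<Rightarrow> 'k)) \<Rightarrow> nat \<Rightarrow>
     ('m \<Rightarrow> 'k::real_normed_field) fps grassmann \<Rightarrow> ('m \<Rightarrow> 'k) fps grassmann \<Rightarrow>
     ('m \<Rightarrow> 'k) fps grassmann" where
  "ghost_mult \<mu> l x y = (\<lambda>U. \<Sum>S\<in>Pow {..<2 * l}. \<Sum>T\<in>Pow {..<2 * l}.
     scalar_series (clifford l (monomial S) (monomial T) U) * star \<mu> (x S) (y T))"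

definition parity_part :: "nat \<Rightarrow> 'c::zero grassmann \<Rightarrow> 'c grassmann" where
  "parity_part i x = (\<lambda>S. if card S mod 2 = i then x S else 0)"

definition graded_commutator ::
    "(nat \<Rightarrow> ('m \<Rightarrow> 'k) \<Rightarrow> ('m \<Rightarrow> 'k) \<Rightarrow> ('m \<Rightarrow> 'k)) \<Rightarrow> nat \<Rightarrow>
     ('m \<Rightarrow> 'k::real_normed_field) fps grassmann \<Rightarrow> ('m \<Rightarrow> 'k) fps grassmann \<Rightarrow>
     ('m \<Rightarrow> 'k) fps grassmann" where
  "graded_commutator \<mu> l x y = (\<lambda>U. \<Sum>i<2. \<Sum>j<2.
     ghost_mult \<mu> l (parity_part i x) (parity_part j y) U
     - (- 1) ^ (i * j) * ghost_mult \<mu> l (parity_part j y) (parity_part i x) U)"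


section \<open>The BRST operators\<close>

definition brst_charge ::
    "nat \<Rightarrow> (nat \<Rightarrow> nat \<Rightarrow> nat \<Rightarrow> real) \<Rightarrow> (nat \<Rightarrow> ('m \<Rightarrow> 'k::real_normed_field) fps) \<Rightarrow>
     ('m \<Rightarrow> 'k) fps grassmann" where
  "brst_charge l f J = (\<lambda>S.
     - real_const (1/4) * (\<Sum>a<l. \<Sum>b<l. \<Sum>c<l. real_const (f a b c) *
         wedge (generator (ghost a)) (wedge (generator (ghost b)) (generator (antighost c))) S)
     + (\<Sum>a<l. J a * generator (ghost a) S)
     + fps_X * real_const (1/2) *
         (\<Sum>a<l. \<Sum>b<l. real_const (f a b b) * generator (ghost a) S))"

definition brst_D ::
    "(nat \<Rightarrow> ('m \<Rightarrow> 'k) \<Rightarrow> ('m \<Rightarrow> 'k) \<Rightarrow> ('m \<Rightarrow> 'k)) \<Rightarrow> nat \<Rightarrow>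
     (nat \<Rightarrow> nat \<Rightarrow> nat \<Rightarrow> real) \<Rightarrow> (nat \<Rightarrow> ('m \<Rightarrow> 'k::real_normed_field) fps) \<Rightarrow>
     ('m \<Rightarrow> 'k) fps grassmann \<Rightarrow> ('m \<Rightarrow> 'k) fps grassmann" where
  "brst_D \<mu> l f J x = (\<lambda>S. nu_div (graded_commutator \<mu> l (brst_charge l f J) x S))"

definition brst_delta ::
    "(nat \<Rightarrow> ('m \<Rightarrow> 'k) \<Rightarrow> ('m \<Rightarrow> 'k) \<Rightarrow> ('m \<Rightarrow> 'k)) \<Rightarrow> nat \<Rightarrow>
     (nat \<Rightarrow> nat \<Rightarrow> nat \<Rightarrow> real) \<Rightarrow> (nat \<Rightarrow> ('m \<Rightarrow> 'k::real_normed_field) fps) \<Rightarrow>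
     ('m \<Rightarrow> 'k) fps grassmann \<Rightarrow> ('m \<Rightarrow> 'k) fps grassmann" where
  "brst_delta \<mu> l f J x = (\<lambda>S.
     - real_const (1/2) * (\<Sum>a<l. \<Sum>b<l. \<Sum>c<l. real_const (f a b c) *
         wedge (generator (ghost a)) (wedge (generator (ghost b)) (left_deriv (ghost c) x)) S)
     + (\<Sum>a<l. \<Sum>b<l. \<Sum>c<l. real_const (f a b c) *
         wedge (generator (ghost a)) (wedge (generator (antighost c)) (left_deriv (antighost b) x)) S)
     + (\<Sum>a<l. wedge (generator (ghost a)) (\<lambda>T. nu_div (star_commutator \<mu> (J a) (x T))) S))"

definition brst_partial ::
    "(nat \<Rightarrow> ('m \<Rightarrow> 'k) \<Rightarrow> ('m \<Rightarrow> 'k) \<Rightarrow> ('m \<Rightarrow> 'k)) \<Rightarrow> nat \<Rightarrow>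
     (nat \<Rightarrow> nat \<Rightarrow> nat \<Rightarrow> real) \<Rightarrow> (nat \<Rightarrow> ('m \<Rightarrow> 'k::real_normed_field) fps) \<Rightarrow>
     ('m \<Rightarrow> 'k) fps grassmann \<Rightarrow> ('m \<Rightarrow> 'k) fps grassmann" where
  "brst_partial \<mu> l f J x = (\<lambda>S.
     (\<Sum>a<l. left_deriv (antighost a) (\<lambda>T. star \<mu> (x T) (J a)) S)
     + fps_X * real_const (1/2) *
         (\<Sum>a<l. \<Sum>b<l. real_const (f a b b) * left_deriv (antighost a) x S)
     + fps_X * real_const (1/2) * (\<Sum>a<l. \<Sum>b<l. \<Sum>c<l. real_const (f a b c) *
         wedge (generator (antighost c))
           (left_deriv (antighost a) (left_deriv (antighost b) x)) S))"

end

theory Submission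
  imports Defs
begin

text \<open>Everything takes place in the algebra of operators on \<open>\<A>[[\<nu>]]\<close> generated by multiplications and
  derivations along the ghosts and antighosts, which satisfy the canonical anticommutation
  relations, and by the coefficientwise operators \<open>\<rho>\<^sub>a = [J\<^sub>a, \<cdot>]\<^sub>\<star> / \<nu>\<close> and \<open>R\<^sub>a = \<cdot> \<star> J\<^sub>a\<close>. The quantum
  moment map condition and associativity of \<open>\<star>\<close> give (summing over \<open>c\<close>)
  \<open>[\<rho>\<^sub>a, \<rho>\<^sub>b] = f\<^sub>a\<^sub>b\<^sup>c \<rho>\<^sub>c\<close>, \<open>[R\<^sub>a, R\<^sub>b] = - \<nu> f\<^sub>a\<^sub>b\<^sup>c R\<^sub>c\<close>, \<open>[\<rho>\<^sub>a, R\<^sub>b] = f\<^sub>a\<^sub>b\<^sup>c R\<^sub>c\<close>; besides these, the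
  identities for \<open>\<delta>\<close> and \<open>\<partial>\<close> use only the anticommutation relations and the Lie algebra axioms for \<open>f\<close>.

  Both squares are instances of one statement (\<open>ce_differential_square\<close>): if \<open>X\<^sub>a, P\<^sub>a\<close> are fermions and
  the \<open>T\<^sub>a\<close> commute with them and satisfy \<open>[T\<^sub>a, T\<^sub>b] = N f\<^sub>a\<^sub>b\<^sup>c T\<^sub>c\<close> with \<open>N\<close> central, then
  \<open>X\<^sub>a T\<^sub>a - N/2 f\<^sub>a\<^sub>b\<^sup>c X\<^sub>a X\<^sub>b P\<^sub>c\<close> has square zero. For \<open>\<delta>\<close> the fermions are \<open>\<xi>\<^sup>a, \<partial>/\<partial>\<xi>\<^sup>a\<close>, and \<open>T\<^sub>a\<close> is \<open>\<rho>\<^sub>a\<close>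
  plus the adjoint action on the antighosts. For \<open>- \<partial>\<close> the roles are reversed: \<open>X\<^sub>a = \<partial>/\<partial>\<xi>\<^sub>a\<close>,
  \<open>P\<^sub>a = \<xi>\<^sub>a\<close>, \<open>N = \<nu>\<close>. Bringing \<open>\<nu>/2 f\<^sub>a\<^sub>b\<^sup>c \<xi>\<^sub>c \<partial>\<^sup>2/\<partial>\<xi>\<^sub>a\<partial>\<xi>\<^sub>b\<close> into the order \<open>X X P\<close> produces a multiple of
  \<open>tr ad\<^sub>a \<partial>/\<partial>\<xi>\<^sub>a\<close>, which together with the explicit trace term of \<open>\<partial>\<close> shifts \<open>R\<^sub>a\<close> by \<open>- \<nu>/2 tr ad\<^sub>a\<close>; the shift
  preserves the commutation relations since \<open>tr ad\<close> vanishes on commutators. The two differentials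
  anticommute because \<open>\<partial>\<close> contains no ghost operators and commutes with each \<open>T\<^sub>a\<close> of \<open>\<delta>\<close>: the
  linear part by \<open>[\<rho>\<^sub>a, R\<^sub>b] = f\<^sub>a\<^sub>b\<^sup>c R\<^sub>c\<close>, the cubic part by the formula \<open>L\<^sub>a = K P\<^sub>a + P\<^sub>a K\<close> and \<open>K\<^sup>2 = 0\<close>.

  For \<open>D = \<delta> + 2 \<partial>\<close> the charge has terms with one and with three generators, at most one of them an
  antighost. The contraction series for a Clifford product with such a term on the left therefore
  stops after one contraction, with the term on the right after two (\<open>clifford_cubic_left\<close>,
  \<open>clifford_cubic_right\<close>). In the graded commutator the uncontracted parts of the cubic and the trace
  terms cancel, that of \<open>J\<^sub>a \<xi>\<^sup>a\<close> leaves \<open>\<nu> \<xi>\<^sup>a \<rho>\<^sub>a\<close>, and the contracted parts are the remaining terms of \<open>\<delta>\<close>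
  and \<open>2 \<partial>\<close>.

  The star product is bilinear and associative on smooth series only. Precomposing its coefficients
  with a linear projection onto the smooth functions gives a product with these properties on all
  series that agrees with \<open>\<star>\<close> on the smooth ones, so that the operators above are total additive
  maps and form a type of class \<^class>\<open>real_algebra_1\<close>.\<close>

section \<open>Chevalley--Eilenberg differentials in an algebra with fermions\<close>

lemma eq_uminus_self_imp_zero:
  fixes x :: "'r::real_vector"
  assumes "x = - x"
  shows "x = 0"
proof -
  have "2 *\<^sub>R x = 0"
    using assms by (metis add.right_inverse scaleR_2)
  then show ?thesis by simp
qed

lemma sum_cyclic3:
  "(\<Sum>a<l. \<Sum>b<l. \<Sum>c<l. h a b c) = (\<Sum>a<l. \<Sum>b<l. \<Sum>c<l. h b c a)"
  for h :: "nat \<Rightarrow> nat \<Rightarrow> nat \<Rightarrow> 'r::comm_monoid_add"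
proof -
  have "(\<Sum>a<l. \<Sum>b<l. \<Sum>c<l. h b c a) = (\<Sum>b<l. \<Sum>a<l. \<Sum>c<l. h b c a)"
    by (rule sum.swap)
  also have "\<dots> = (\<Sum>b<l. \<Sum>c<l. \<Sum>a<l. h b c a)"
    by (rule sum.cong[OF refl], rule sum.swap)
  finally show ?thesis by simp
qed

locale lie_constants =
  fixes l :: nat and f :: "nat \<Rightarrow> nat \<Rightarrow> nat \<Rightarrow> real"
  assumes antisym: "\<lbrakk>a < l; b < l; c < l\<rbrakk> \<Longrightarrow> f a b c = - f b a c"
    and jacobi: "\<lbrakk>a < l; b < l; c < l; d < l\<rbrakk> \<Longrightarrow>
      (\<Sum>m<l. f a b m * f m c d + f b c m * f m a d + f c a m * f m b d) = 0"
begin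

text \<open>The Jacobi identity read as \<open>[ad a, ad b] = ad [a, b]\<close> in coordinates.\<close>

lemma adjoint_rep:
  assumes "a < l" "b < l" "d < l" "g < l"
  shows "(\<Sum>m<l. f b d m * f a m g - f a d m * f b m g) = (\<Sum>m<l. f a b m * f m d g)"
proof -
  have "(\<Sum>m<l. f b d m * f a m g - f a d m * f b m g)
      = (\<Sum>m<l. f a b m * f m d g
          - (f a b m * f m d g + f b d m * f m a g + f d a m * f m b g))"
  proof (rule sum.cong[OF refl])
    fix m assume "m \<in> {..<l}"
    then have "f a m g = - f m a g" "f b m g = - f m b g" "f d a m = - f a d m"
      using assms by (auto intro: antisym)
    then show "f b d m * f a m g - f a d m * f b m g = f a b m * f m d g
          - (f a b m * f m d g + f b d m * f m a g + f d a m * f m b g)"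
      by simp
  qed
  also have "\<dots> = (\<Sum>m<l. f a b m * f m d g)"
    unfolding sum_subtractf jacobi[OF assms] by simp
  finally show ?thesis .
qed

text \<open>A trace of a commutator: in \<open>adjoint_rep\<close> with the two free indices equal, the left-hand side is
  antisymmetric under exchange of the summation indices.\<close>

lemma trace_bracket:
  assumes "a < l" "b < l"
  shows "(\<Sum>c<l. f a b c * (\<Sum>d<l. f c d d)) = 0"
proof -
  have "(\<Sum>c<l. f a b c * (\<Sum>d<l. f c d d)) = (\<Sum>d<l. \<Sum>c<l. f a b c * f c d d)"
    unfolding sum_distrib_left by (rule sum.swap)
  also have "\<dots> = (\<Sum>d<l. \<Sum>c<l. f b d c * f a c d - f a d c * f b c d)"
    by (rule sum.cong[OF refl]) (simp add: adjoint_rep[OF assms])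
  also have "\<dots> = (\<Sum>d<l. \<Sum>c<l. f b d c * f a c d) - (\<Sum>d<l. \<Sum>c<l. f a d c * f b c d)"
    by (simp add: sum_subtractf)
  also have "(\<Sum>d<l. \<Sum>c<l. f a d c * f b c d) = (\<Sum>d<l. \<Sum>c<l. f b d c * f a c d)"
    by (subst sum.swap) (simp add: mult.commute)
  finally show ?thesis by simp
qed

end

locale fermions =
  fixes X P :: "nat \<Rightarrow> 'r::real_algebra_1"
  assumes XX: "X a * X b = - (X b * X a)"
    and PP: "P a * P b = - (P b * P a)"
    and PX: "P a * X b = (if a = b then 1 else 0) - X b * P a"
begin

text \<open>The relations are symmetric under exchange of creation and annihilation operators. This is what
  allows antighost derivations to play the role of the odd generators.\<close>

lemma swapped: "fermions P X"
proof
  fix a b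
  show "P a * P b = - (P b * P a)" by (rule PP)
  show "X a * X b = - (X b * X a)" by (rule XX)
  show "X a * P b = (if a = b then 1 else 0) - P b * X a"
    unfolding PX[of b a] by (simp add: eq_commute[of a b])
qed

lemma XXX_cyclic: "X a * X b * X c = X b * X c * X a"
proof -
  have "X a * X b * X c = - (X b * (X a * X c))"
    by (subst XX) (simp add: mult.assoc)
  also have "\<dots> = X b * X c * X a"
    by (subst XX) (simp add: mult.assoc)
  finally show ?thesis .
qed

text \<open>Contracting with \<open>X\<^sub>a X\<^sub>b\<close> sees only the antisymmetric part, so a quadratic expression in operators \<open>T\<^sub>a\<close>
  reduces to their commutators.\<close>

lemma antisymmetrise:
  assumes "\<And>a b. \<lbrakk>a < l; b < l\<rbrakk> \<Longrightarrow> T a b - T b a = C a b"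
  shows "(\<Sum>a<l. \<Sum>b<l. X a * X b * T a b) = (1/2) *\<^sub>R (\<Sum>a<l. \<Sum>b<l. X a * X b * C a b)"
proof -
  let ?Z = "\<Sum>a<l. \<Sum>b<l. X a * X b * T a b"
  have "(\<Sum>a<l. \<Sum>b<l. X a * X b * C a b)
      = (\<Sum>a<l. \<Sum>b<l. X a * X b * T a b + X b * X a * T b a)"
  proof (intro sum.cong refl)
    fix a b assume "a \<in> {..<l}" "b \<in> {..<l}"
    then have "C a b = T a b - T b a" using assms by simp
    then have "X a * X b * C a b = X a * X b * T a b + - (X a * X b) * T b a"
      by (simp add: right_diff_distrib)
    then show "X a * X b * C a b = X a * X b * T a b + X b * X a * T b a"
      by (simp only: XX[of b a])
  qed
  also have "\<dots> = ?Z + (\<Sum>a<l. \<Sum>b<l. X b * X a * T b a)"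
    by (simp add: sum.distrib)
  also have "(\<Sum>a<l. \<Sum>b<l. X b * X a * T b a) = ?Z"
    by (rule sum.swap)
  also have "?Z + ?Z = 2 *\<^sub>R ?Z" by (simp only: scaleR_2)
  finally show ?thesis by simp
qed

end

locale lie_fermions = lie_constants l f + fermions X P
  for l f and X P :: "nat \<Rightarrow> 'r::real_algebra_1"
begin

text \<open>With the \<open>X\<^sub>a\<close> as basis of \<open>\<gg>\<^sup>*\<close>, the Chevalley--Eilenberg differential maps \<open>X\<^sub>d\<close> to
  \<open>- bracket_form d\<close>, and on the exterior algebra it is \<open>- ce_cubic\<close>.\<close>

definition bracket_form :: "nat \<Rightarrow> 'r" where
  "bracket_form d = (\<Sum>a<l. \<Sum>b<l. (f a b d / 2) *\<^sub>R (X a * X b))"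

definition ce_cubic :: 'r where
  "ce_cubic = (\<Sum>a<l. \<Sum>b<l. \<Sum>c<l. (f a b c / 2) *\<^sub>R (X a * X b * P c))"

lemma ce_cubic_alt: "ce_cubic = (\<Sum>c<l. bracket_form c * P c)"
proof -
  have "ce_cubic = (\<Sum>c<l. \<Sum>a<l. \<Sum>b<l. (f a b c / 2) *\<^sub>R (X a * X b * P c))"
    unfolding ce_cubic_def by (rule sum_cyclic3)
  then show ?thesis
    by (simp add: bracket_form_def sum_distrib_right)
qed

lemma bracket_form_commute: "bracket_form d * X e = X e * bracket_form d"
proof -
  have "X a * X b * X e = X e * (X a * X b)" for a b
    using XXX_cyclic[of e a b] by (simp add: mult.assoc)
  then show ?thesis
    unfolding bracket_form_def sum_distrib_left sum_distrib_right by simp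
qed

lemma bracket_forms_commute: "bracket_form d * bracket_form e = bracket_form e * bracket_form d"
proof -
  have "bracket_form d * (X a * X b) = X a * X b * bracket_form d" for a b
    by (metis bracket_form_commute mult.assoc)
  then have "bracket_form d * (\<Sum>a<l. \<Sum>b<l. r a b *\<^sub>R (X a * X b))
     = (\<Sum>a<l. \<Sum>b<l. r a b *\<^sub>R (X a * X b)) * bracket_form d" for r
    by (simp add: sum_distrib_left sum_distrib_right)
  then show ?thesis unfolding bracket_form_def[of e] by simp
qed

text \<open>\<open>ce_cubic\<close> acts as an odd derivation on polynomials in the \<open>X\<^sub>d\<close>.\<close>

lemma ce_cubic_X:
  assumes "d < l"
  shows "ce_cubic * X d = bracket_form d - X d * ce_cubic"
proof -
  have "ce_cubic * X d = (\<Sum>c<l. bracket_form c * (P c * X d))"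
    by (simp add: ce_cubic_alt sum_distrib_right mult.assoc)
  also have "\<dots> = (\<Sum>c<l. (if c = d then bracket_form c else 0) - X d * (bracket_form c * P c))"
    by (intro sum.cong refl) (simp add: PX right_diff_distrib mult.assoc[symmetric] bracket_form_commute)
  also have "\<dots> = bracket_form d - X d * ce_cubic"
    using assms by (simp add: sum_subtractf sum_distrib_left ce_cubic_alt)
  finally show ?thesis .
qed

text \<open>The square of the Chevalley--Eilenberg differential on generators. The coefficient of
  \<open>X\<^sub>a X\<^sub>d X\<^sub>e\<close> matters only up to cyclic permutation, and its cyclic sum is the Jacobi identity.\<close>

lemma bracket_form_cocycle:
  assumes "c < l"
  shows "(\<Sum>a<l. \<Sum>b<l. f a b c *\<^sub>R (X a * bracket_form b)) = 0"
proof -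
  \<comment> \<open>\<open>G a d e\<close> is the \<open>c\<close>-coordinate of the double bracket of \<open>d\<close>, \<open>e\<close>, \<open>a\<close>.\<close>
  define G where "G a d e = (\<Sum>m<l. f d e m * f m a c)" for a d e
  have fG: "(\<Sum>m<l. f a m c * f d e m) = - G a d e" if "a < l" for a d e
    unfolding G_def sum_negf[symmetric]
  proof (rule sum.cong[OF refl])
    fix m assume "m \<in> {..<l}"
    then have "f a m c = - f m a c" using that assms by (auto intro: antisym)
    then show "f a m c * f d e m = - (f d e m * f m a c)" by simp
  qed
  have cyc: "G a d e + G d e a + G e a d = 0" if "a < l" "d < l" "e < l" for a d e
    using jacobi[OF that(2,3,1) assms] by (simp add: G_def sum.distrib)
  let ?Z = "\<Sum>a<l. \<Sum>d<l. \<Sum>e<l. G a d e *\<^sub>R (X a * X d * X e)"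
  have Z1: "?Z = (\<Sum>a<l. \<Sum>d<l. \<Sum>e<l. G d e a *\<^sub>R (X a * X d * X e))"
    by (rule trans[OF sum_cyclic3]) (simp add: XXX_cyclic[symmetric])
  have Z2: "?Z = (\<Sum>a<l. \<Sum>d<l. \<Sum>e<l. G e a d *\<^sub>R (X a * X d * X e))"
    by (rule trans[OF Z1], rule trans[OF sum_cyclic3]) (simp add: XXX_cyclic[symmetric])
  have "?Z + ?Z + ?Z = (\<Sum>a<l. \<Sum>d<l. \<Sum>e<l. (G a d e + G d e a + G e a d) *\<^sub>R (X a * X d * X e))"
    unfolding scaleR_left_distrib sum.distrib Z1[symmetric] Z2[symmetric] ..
  also have "\<dots> = 0"
    by (intro sum.neutral ballI) (simp add: cyc)
  finally have "(1 + 1 + 1) *\<^sub>R ?Z = 0"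
    unfolding scaleR_left_distrib scaleR_one .
  then have Z0: "?Z = 0" by simp
  have "(\<Sum>a<l. \<Sum>b<l. f a b c *\<^sub>R (X a * bracket_form b))
     = (\<Sum>a<l. \<Sum>b<l. \<Sum>d<l. \<Sum>e<l. (f a b c * f d e b / 2) *\<^sub>R (X a * X d * X e))"
    unfolding bracket_form_def sum_distrib_left scaleR_sum_right by (simp add: mult.assoc)
  also have "\<dots> = (\<Sum>a<l. \<Sum>d<l. \<Sum>e<l. \<Sum>b<l. (f a b c * f d e b / 2) *\<^sub>R (X a * X d * X e))"
    by (rule sum.cong[OF refl], rule sum_cyclic3[symmetric])
  also have "\<dots> = (\<Sum>a<l. \<Sum>d<l. \<Sum>e<l. (- (1/2)) *\<^sub>R (G a d e *\<^sub>R (X a * X d * X e)))"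
  proof (rule sum.cong[OF refl], rule sum.cong[OF refl], rule sum.cong[OF refl])
    fix a d e assume "a \<in> {..<l}"
    then have "(\<Sum>b<l. f a b c * f d e b / 2) = - (1/2) * G a d e"
      by (simp add: fG sum_divide_distrib[symmetric])
    then show "(\<Sum>b<l. (f a b c * f d e b / 2) *\<^sub>R (X a * X d * X e))
        = (- (1/2)) *\<^sub>R (G a d e *\<^sub>R (X a * X d * X e))"
      by (simp only: scaleR_sum_left[symmetric] scaleR_scaleR)
  qed
  also have "\<dots> = (- (1/2)) *\<^sub>R ?Z"
    by (simp only: scaleR_sum_right)
  finally show ?thesis using Z0 by simp
qed

lemma ce_cubic_bracket_form:
  assumes "c < l"
  shows "ce_cubic * bracket_form c = bracket_form c * ce_cubic"
proof -
  have K: "ce_cubic * (X a * X b) = bracket_form a * X b - X a * bracket_form b + X a * X b * ce_cubic"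
    if "a < l" "b < l" for a b
  proof -
    have "ce_cubic * (X a * X b) = (ce_cubic * X a) * X b" by (simp add: mult.assoc)
    also have "\<dots> = bracket_form a * X b - X a * (ce_cubic * X b)"
      by (simp add: ce_cubic_X that algebra_simps)
    finally show ?thesis by (simp add: ce_cubic_X that algebra_simps)
  qed
  have "ce_cubic * bracket_form c = (\<Sum>a<l. \<Sum>b<l. (f a b c / 2) *\<^sub>R (ce_cubic * (X a * X b)))"
    by (simp add: bracket_form_def sum_distrib_left)
  also have "\<dots> = (\<Sum>a<l. \<Sum>b<l. (f a b c / 2) *\<^sub>R (X b * bracket_form a))
      - (\<Sum>a<l. \<Sum>b<l. (f a b c / 2) *\<^sub>R (X a * bracket_form b)) + bracket_form c * ce_cubic"
    by (simp add: K bracket_form_commute scaleR_diff_right scaleR_add_right sum.distrib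
        sum_subtractf bracket_form_def[of c] sum_distrib_right)
  also have "(\<Sum>a<l. \<Sum>b<l. (f a b c / 2) *\<^sub>R (X b * bracket_form a))
      = - (\<Sum>a<l. \<Sum>b<l. (f a b c / 2) *\<^sub>R (X a * bracket_form b))"
    unfolding sum_negf[symmetric]
  proof (subst sum.swap, intro sum.cong refl)
    fix a b assume "a \<in> {..<l}" "b \<in> {..<l}"
    then have "f b a c = - f a b c" using assms by (auto intro: antisym)
    then show "(f b a c / 2) *\<^sub>R (X a * bracket_form b) = - ((f a b c / 2) *\<^sub>R (X a * bracket_form b))"
      by simp
  qed
  also have "(\<Sum>a<l. \<Sum>b<l. (f a b c / 2) *\<^sub>R (X a * bracket_form b))
      = (1/2) *\<^sub>R (\<Sum>a<l. \<Sum>b<l. f a b c *\<^sub>R (X a * bracket_form b))"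
    by (simp add: scaleR_sum_right)
  also have "\<dots> = 0" using bracket_form_cocycle[OF assms] by simp
  finally show ?thesis by simp
qed

text \<open>Since \<open>ce_cubic\<close> commutes with each bracket form, its square is \<open>\<Sum> k\<^sub>c k\<^sub>g P\<^sub>g P\<^sub>c\<close>, with the bracket
  forms \<open>k\<close> commuting and the \<open>P\<close> anticommuting.\<close>

lemma ce_cubic_square: "ce_cubic * ce_cubic = 0"
proof -
  have "ce_cubic * ce_cubic = (\<Sum>c<l. bracket_form c * ce_cubic * P c)"
    by (subst (2) ce_cubic_alt)
      (simp add: sum_distrib_left mult.assoc[symmetric] ce_cubic_bracket_form)
  also have "\<dots> = (\<Sum>c<l. \<Sum>g<l. bracket_form c * bracket_form g * (P g * P c))"
    by (simp add: ce_cubic_alt sum_distrib_left sum_distrib_right mult.assoc)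
  finally have *: "ce_cubic * ce_cubic = (\<Sum>c<l. \<Sum>g<l. bracket_form c * bracket_form g * (P g * P c))" .
  also have "\<dots> = (\<Sum>c<l. \<Sum>g<l. bracket_form g * bracket_form c * (P c * P g))"
    by (rule sum.swap)
  also have "\<dots> = - (\<Sum>c<l. \<Sum>g<l. bracket_form c * bracket_form g * (P g * P c))"
  proof -
    have "bracket_form g * bracket_form c * (P c * P g)
        = - (bracket_form c * bracket_form g * (P g * P c))" for c g
      by (subst PP, subst bracket_forms_commute) simp
    then show ?thesis unfolding sum_negf[symmetric] by (intro sum.cong refl)
  qed
  also have "\<dots> = - (ce_cubic * ce_cubic)" by (simp add: *)
  finally show ?thesis by (rule eq_uminus_self_imp_zero)
qed

text \<open>With \<open>A = \<Sum> X\<^sub>a T\<^sub>a\<close> and \<open>K = ce_cubic\<close>, both \<open>A\<^sup>2\<close> (by the commutators of the \<open>T\<^sub>a\<close>) and \<open>N (K A + A K)\<close>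
  (by the derivation rule) equal \<open>N \<Sum> k\<^sub>c T\<^sub>c\<close>, and \<open>K\<^sup>2 = 0\<close>. The central element \<open>N\<close> is \<open>1\<close> for the
  cohomological and \<open>\<nu>\<close> for the homological differential.\<close>

lemma ce_differential_square:
  assumes TX: "\<And>a b. \<lbrakk>a < l; b < l\<rbrakk> \<Longrightarrow> T a * X b = X b * T a"
    and TP: "\<And>a b. \<lbrakk>a < l; b < l\<rbrakk> \<Longrightarrow> T a * P b = P b * T a"
    and TT: "\<And>a b. \<lbrakk>a < l; b < l\<rbrakk> \<Longrightarrow> T a * T b - T b * T a = N * (\<Sum>c<l. f a b c *\<^sub>R T c)"
    and NX: "\<And>a. a < l \<Longrightarrow> N * X a = X a * N"
    and NP: "\<And>a. a < l \<Longrightarrow> N * P a = P a * N"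
    and NT: "\<And>a. a < l \<Longrightarrow> N * T a = T a * N"
  shows "((\<Sum>a<l. X a * T a) - N * ce_cubic) * ((\<Sum>a<l. X a * T a) - N * ce_cubic) = 0"
proof -
  let ?A = "\<Sum>a<l. X a * T a"
  let ?B = "\<Sum>c<l. bracket_form c * T c"
  have commutes: "Z * bracket_form c = bracket_form c * Z" "Z * ce_cubic = ce_cubic * Z"
    if ZX: "\<And>a. a < l \<Longrightarrow> Z * X a = X a * Z" and ZP: "\<And>a. a < l \<Longrightarrow> Z * P a = P a * Z" for Z c
  proof -
    have "Z * (X a * X b) = X a * X b * Z" if "a < l" "b < l" for a b
      by (metis ZX that mult.assoc)
    then show *: "Z * bracket_form c = bracket_form c * Z" for c
      by (simp add: bracket_form_def sum_distrib_left sum_distrib_right)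
    have "Z * (bracket_form c * P c) = bracket_form c * P c * Z" if "c < l" for c
      by (metis ZP * that mult.assoc)
    then show "Z * ce_cubic = ce_cubic * Z"
      by (simp add: ce_cubic_alt sum_distrib_left sum_distrib_right)
  qed
  have KT: "T d * ce_cubic = ce_cubic * T d" if "d < l" for d
    using commutes(2)[of "T d"] TX TP that by blast
  have kN: "N * bracket_form c = bracket_form c * N" for c
    using commutes(1)[of N] NX NP by blast
  have KN: "N * ce_cubic = ce_cubic * N"
    using commutes(2)[of N] NX NP by blast
  have NA: "N * ?A = ?A * N"
    unfolding sum_distrib_left sum_distrib_right
  proof (rule sum.cong[OF refl])
    fix a assume "a \<in> {..<l}"
    then show "N * (X a * T a) = X a * T a * N"
      by (metis NX NT lessThan_iff mult.assoc)
  qed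
  have "?A * ?A = (\<Sum>a<l. \<Sum>b<l. X a * X b * (T a * T b))"
    unfolding sum_product
  proof (intro sum.cong refl)
    fix a b assume "a \<in> {..<l}" "b \<in> {..<l}"
    then have "X a * T a * (X b * T b) = X a * (T a * X b) * T b" by (simp add: mult.assoc)
    with \<open>a \<in> _\<close> \<open>b \<in> _\<close> show "X a * T a * (X b * T b) = X a * X b * (T a * T b)"
      by (simp add: TX mult.assoc)
  qed
  also have "\<dots> = (1/2) *\<^sub>R (\<Sum>a<l. \<Sum>b<l. X a * X b * (N * (\<Sum>c<l. f a b c *\<^sub>R T c)))"
    by (rule antisymmetrise) (rule TT)
  also have "\<dots> = (\<Sum>a<l. \<Sum>b<l. \<Sum>c<l. (f a b c / 2) *\<^sub>R (X a * X b) * (N * T c))"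
    by (simp add: sum_distrib_left scaleR_sum_right)
  also have "\<dots> = (\<Sum>c<l. bracket_form c * (N * T c))"
    by (rule trans[OF sum_cyclic3]) (simp add: bracket_form_def sum_distrib_right)
  also have "\<dots> = N * ?B"
    by (simp add: sum_distrib_left mult.assoc[symmetric] kN)
  finally have AA: "?A * ?A = N * ?B" .
  have "ce_cubic * ?A = (\<Sum>a<l. (ce_cubic * X a) * T a)"
    by (simp add: sum_distrib_left mult.assoc)
  also have "\<dots> = (\<Sum>a<l. bracket_form a * T a - X a * T a * ce_cubic)"
    by (intro sum.cong refl) (simp add: ce_cubic_X left_diff_distrib mult.assoc KT)
  also have "\<dots> = ?B - ?A * ce_cubic"
    by (simp add: sum_subtractf sum_distrib_right)
  finally have KA: "ce_cubic * ?A = ?B - ?A * ce_cubic" .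
  have "(?A - N * ce_cubic) * (?A - N * ce_cubic)
      = ?A * ?A - ?A * N * ce_cubic - N * (ce_cubic * ?A) + N * (ce_cubic * N) * ce_cubic"
    by (simp add: left_diff_distrib right_diff_distrib mult.assoc)
  also have "ce_cubic * N = N * ce_cubic" by (simp only: KN)
  also have "N * (N * ce_cubic) * ce_cubic = 0"
    by (simp add: mult.assoc ce_cubic_square)
  also have "?A * N = N * ?A" by (simp only: NA)
  finally show ?thesis
    by (simp add: AA KA right_diff_distrib mult.assoc)
qed

definition lie_derivative :: "nat \<Rightarrow> 'r" where
  "lie_derivative a = (\<Sum>b<l. \<Sum>c<l. f a b c *\<^sub>R (X b * P c))"

text \<open>\<open>P\<^sub>a\<close> is the interior product, so this is \<open>L\<^sub>a = [d, \<iota>\<^sub>a]\<close> up to sign. It makes the invariance of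
  \<open>ce_cubic\<close> and the commutators of Lie derivatives formal consequences of \<open>ce_cubic_square\<close>.\<close>

lemma cartan_formula:
  assumes "a < l"
  shows "ce_cubic * P a + P a * ce_cubic = lie_derivative a"
proof -
  have contract: "P a * bracket_form c = (\<Sum>b<l. f a b c *\<^sub>R X b) + bracket_form c * P a"
    if "c < l" for c
  proof -
    have PXX: "P a * (X d * X e)
        = (if a = d then X e else 0) - (if a = e then X d else 0) + X d * X e * P a" for d e
    proof -
      have "P a * (X d * X e) = (P a * X d) * X e" by (simp add: mult.assoc)
      also have "\<dots> = (if a = d then X e else 0) - X d * (P a * X e)"
        by (simp add: PX[of a d] left_diff_distrib mult.assoc)
      finally show ?thesis by (simp add: PX[of a e] right_diff_distrib mult.assoc)
    qed
    have "P a * bracket_form c = (\<Sum>d<l. \<Sum>e<l. (f d e c / 2) *\<^sub>R (P a * (X d * X e)))"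
      by (simp add: bracket_form_def sum_distrib_left)
    also have "\<dots> = (\<Sum>d<l. \<Sum>e<l. (f d e c / 2) *\<^sub>R (if a = d then X e else 0))
        - (\<Sum>d<l. \<Sum>e<l. (f d e c / 2) *\<^sub>R (if a = e then X d else 0)) + bracket_form c * P a"
      unfolding PXX by (simp add: scaleR_add_right scaleR_diff_right sum.distrib sum_subtractf
          bracket_form_def sum_distrib_right)
    also have "(\<Sum>d<l. \<Sum>e<l. (f d e c / 2) *\<^sub>R (if a = d then X e else 0))
        = (\<Sum>e<l. (f a e c / 2) *\<^sub>R X e)"
      using assms by (subst sum.swap) (simp add: if_distrib[of "scaleR _"] cong: if_cong)
    also have "(\<Sum>d<l. \<Sum>e<l. (f d e c / 2) *\<^sub>R (if a = e then X d else 0))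
        = (\<Sum>d<l. (f d a c / 2) *\<^sub>R X d)"
      using assms by (simp add: if_distrib[of "scaleR _"] cong: if_cong)
    also have "\<dots> = - (\<Sum>e<l. (f a e c / 2) *\<^sub>R X e)"
      unfolding sum_negf[symmetric]
    proof (rule sum.cong[OF refl])
      fix d assume "d \<in> {..<l}"
      then have "f d a c = - f a d c" using assms \<open>c < l\<close> by (auto intro: antisym)
      then show "(f d a c / 2) *\<^sub>R X d = - ((f a d c / 2) *\<^sub>R X d)" by simp
    qed
    finally show ?thesis
      by (simp add: sum.distrib[symmetric] scaleR_left_distrib[symmetric])
  qed
  have "ce_cubic * P a + P a * ce_cubic
      = (\<Sum>c<l. bracket_form c * (P c * P a) + (P a * bracket_form c) * P c)"
    by (simp add: ce_cubic_alt sum_distrib_left sum_distrib_right mult.assoc sum.distrib)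
  also have "\<dots> = (\<Sum>c<l. (\<Sum>b<l. f a b c *\<^sub>R X b) * P c)"
  proof (rule sum.cong[OF refl])
    fix c assume "c \<in> {..<l}"
    then show "bracket_form c * (P c * P a) + (P a * bracket_form c) * P c
        = (\<Sum>b<l. f a b c *\<^sub>R X b) * P c"
      by (simp add: contract PP[of c a] left_diff_distrib distrib_right mult.assoc)
  qed
  also have "\<dots> = lie_derivative a"
    unfolding lie_derivative_def by (subst sum.swap) (simp add: sum_distrib_right)
  finally show ?thesis .
qed

text \<open>\<open>[K P + P K, K] = 0\<close> for any \<open>K\<close> of square zero.\<close>

lemma lie_derivative_ce_cubic:
  assumes "a < l"
  shows "lie_derivative a * ce_cubic = ce_cubic * lie_derivative a"
proof -
  have "ce_cubic * (ce_cubic * z) = 0" for z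
    by (simp add: mult.assoc[symmetric] ce_cubic_square)
  then show ?thesis
    by (simp add: cartan_formula[OF assms, symmetric] distrib_left distrib_right mult.assoc
        ce_cubic_square)
qed

lemma lie_derivative_X:
  assumes "d < l"
  shows "lie_derivative a * X d = X d * lie_derivative a + (\<Sum>b<l. f a b d *\<^sub>R X b)"
proof -
  have XPX: "X b * P c * X d = (if c = d then X b else 0) + X d * (X b * P c)" for b c
    by (simp add: PX[of c d] right_diff_distrib mult.assoc) (simp add: mult.assoc[symmetric] XX[of b d])
  have "lie_derivative a * X d = (\<Sum>b<l. \<Sum>c<l. f a b c *\<^sub>R (X b * P c * X d))"
    by (simp add: lie_derivative_def sum_distrib_right)
  also have "\<dots> = (\<Sum>b<l. \<Sum>c<l. f a b c *\<^sub>R (if c = d then X b else 0)) + X d * lie_derivative a"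
    unfolding XPX by (simp add: scaleR_add_right sum.distrib lie_derivative_def sum_distrib_left)
  also have "(\<Sum>b<l. \<Sum>c<l. f a b c *\<^sub>R (if c = d then X b else 0)) = (\<Sum>b<l. f a b d *\<^sub>R X b)"
    using assms by (simp add: if_distrib[of "scaleR _"] cong: if_cong)
  finally show ?thesis by (simp add: add.commute)
qed

lemma lie_derivative_P:
  assumes "d < l"
  shows "lie_derivative a * P d = P d * lie_derivative a - (\<Sum>c<l. f a d c *\<^sub>R P c)"
proof -
  have XPP: "X b * P c * P d = P d * (X b * P c) - (if d = b then P c else 0)" for b c
  proof -
    have XP: "X b * P d = (if d = b then 1 else 0) - P d * X b" by (simp add: PX)
    have "X b * P c * P d = - ((X b * P d) * P c)" by (simp add: mult.assoc PP[of c d])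
    then show ?thesis by (simp add: XP left_diff_distrib mult.assoc)
  qed
  have "lie_derivative a * P d = (\<Sum>b<l. \<Sum>c<l. f a b c *\<^sub>R (X b * P c * P d))"
    by (simp add: lie_derivative_def sum_distrib_right)
  also have "\<dots> = P d * lie_derivative a - (\<Sum>b<l. \<Sum>c<l. f a b c *\<^sub>R (if d = b then P c else 0))"
    unfolding XPP by (simp add: scaleR_diff_right sum_subtractf lie_derivative_def sum_distrib_left)
  also have "(\<Sum>b<l. \<Sum>c<l. f a b c *\<^sub>R (if d = b then P c else 0)) = (\<Sum>c<l. f a d c *\<^sub>R P c)"
    using assms by (subst sum.swap) (simp add: if_distrib[of "scaleR _"] cong: if_cong)
  finally show ?thesis .
qed

lemma lie_derivative_commutator:
  assumes "a < l" "b < l"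
  shows "lie_derivative a * lie_derivative b - lie_derivative b * lie_derivative a
    = - (\<Sum>c<l. f a b c *\<^sub>R lie_derivative c)"
proof -
  let ?L = "lie_derivative a" and ?K = ce_cubic and ?V = "\<Sum>c<l. f a b c *\<^sub>R P c"
  have LP: "?L * P b = P b * ?L - ?V" using assms(2) by (rule lie_derivative_P)
  have LK: "?L * ?K = ?K * ?L" using assms(1) by (rule lie_derivative_ce_cubic)
  have "?L * (?K * P b) = ?K * P b * ?L - ?K * ?V"
  proof -
    have "?L * (?K * P b) = (?L * ?K) * P b" by (simp only: mult.assoc)
    also have "\<dots> = ?K * (?L * P b)" by (simp only: LK mult.assoc)
    finally show ?thesis by (simp add: LP right_diff_distrib mult.assoc)
  qed
  moreover have "?L * (P b * ?K) = P b * ?K * ?L - ?V * ?K"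
  proof -
    have "?L * (P b * ?K) = (?L * P b) * ?K" by (simp only: mult.assoc)
    also have "\<dots> = P b * (?L * ?K) - ?V * ?K" by (simp add: LP left_diff_distrib mult.assoc)
    finally show ?thesis by (simp add: LK mult.assoc)
  qed
  ultimately have "?L * lie_derivative b - lie_derivative b * ?L = - (?K * ?V + ?V * ?K)"
    by (simp add: cartan_formula[OF assms(2), symmetric] distrib_left distrib_right)
  also have "?K * ?V + ?V * ?K = (\<Sum>c<l. f a b c *\<^sub>R (?K * P c + P c * ?K))"
    by (simp add: sum_distrib_left sum_distrib_right scaleR_add_right sum.distrib)
  also have "\<dots> = (\<Sum>c<l. f a b c *\<^sub>R lie_derivative c)"
    by (simp add: cartan_formula)
  finally show ?thesis .
qed

end

section \<open>Two anticommuting differentials\<close>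

text \<open>The operators from which \<open>\<delta>\<close> and \<open>\<partial>\<close> are built: \<open>X, P\<close> are multiplication by and derivation along
  the ghosts, \<open>Y, Q\<close> those for the antighosts, \<open>S\<^sub>a = [J\<^sub>a, \<cdot>] / \<nu>\<close> and \<open>R\<^sub>a = \<cdot> \<star> J\<^sub>a\<close> act on the coefficients, and
  \<open>N\<close> is multiplication by \<open>\<nu>\<close>.\<close>

locale brst_operators = lie_fermions l f X P + antighosts: fermions Y Q
  for l f and X P Y Q :: "nat \<Rightarrow> 'r::real_algebra_1" +
  fixes S R :: "nat \<Rightarrow> 'r" and N :: 'r
  assumes XY: "X a * Y b = - (Y b * X a)" and XQ: "X a * Q b = - (Q b * X a)"
    and PY: "P a * Y b = - (Y b * P a)" and PQ: "P a * Q b = - (Q b * P a)"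
    and SX: "S a * X b = X b * S a" and SP: "S a * P b = P b * S a"
    and SY: "S a * Y b = Y b * S a" and SQ: "S a * Q b = Q b * S a"
    and RX: "R a * X b = X b * R a" and RP: "R a * P b = P b * R a"
    and RY: "R a * Y b = Y b * R a" and RQ: "R a * Q b = Q b * R a"
    and NX: "N * X a = X a * N" and NP: "N * P a = P a * N"
    and NY: "N * Y a = Y a * N" and NQ: "N * Q a = Q a * N"
    and NS: "N * S a = S a * N" and NR: "N * R a = R a * N"
    and SS: "\<lbrakk>a < l; b < l\<rbrakk> \<Longrightarrow> S a * S b - S b * S a = (\<Sum>c<l. f a b c *\<^sub>R S c)"
    and RR: "\<lbrakk>a < l; b < l\<rbrakk> \<Longrightarrow> R a * R b - R b * R a = - (N * (\<Sum>c<l. f a b c *\<^sub>R R c))"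
    and SR: "\<lbrakk>a < l; b < l\<rbrakk> \<Longrightarrow> S a * R b - R b * S a = (\<Sum>c<l. f a b c *\<^sub>R R c)"
begin

text \<open>The constructions for \<open>X, P\<close> are also needed with antighost derivations as odd generators.\<close>

sublocale dual: lie_fermions l f Q Y
  by (intro lie_fermions.intro lie_constants_axioms antighosts.swapped)

definition ad_trace :: "nat \<Rightarrow> real" where
  "ad_trace a = (\<Sum>b<l. f a b b)"

definition adjoint_action :: "nat \<Rightarrow> 'r" where
  "adjoint_action a = (\<Sum>b<l. \<Sum>c<l. f a b c *\<^sub>R (Y c * Q b))"

definition total_action :: "nat \<Rightarrow> 'r" where
  "total_action a = S a + adjoint_action a"

definition shifted_right :: "nat \<Rightarrow> 'r" where
  "shifted_right a = R a - (ad_trace a / 2) *\<^sub>R N"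

definition delta :: 'r where
  "delta = (\<Sum>a<l. X a * total_action a) - ce_cubic"

text \<open>This is \<open>\<partial>\<close> in the form of a Chevalley--Eilenberg differential, with the antighost derivations
  to the left; \<open>bd_expand\<close> gives the usual form. In \<open>shifted_right\<close> the sign of the trace is opposite to
  that in \<open>\<partial>\<close>, because reordering the cubic term contributes \<open>- \<nu> tr ad\<^sub>a Q\<^sub>a\<close>.\<close>

definition bd :: 'r where
  "bd = (\<Sum>a<l. Q a * shifted_right a) + N * dual.ce_cubic"

lemma ad_trace_derived: "\<lbrakk>a < l; b < l\<rbrakk> \<Longrightarrow> (\<Sum>c<l. f a b c * ad_trace c) = 0"
  using trace_bracket by (simp add: ad_trace_def)

text \<open>Reordering \<open>Y\<^sub>c Q\<^sub>b\<close> turns the adjoint action on antighosts into minus the Lie derivative of the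
  exchanged fermions; the constant is invisible in commutators.\<close>

lemma adjoint_action_dual: "a < l \<Longrightarrow> adjoint_action a = ad_trace a *\<^sub>R 1 - dual.lie_derivative a"
proof -
  have "adjoint_action a = (\<Sum>b<l. \<Sum>c<l. f a b c *\<^sub>R ((if c = b then 1 else 0) - Q b * Y c))"
    unfolding adjoint_action_def by (simp only: dual.PX)
  also have "\<dots> = (\<Sum>b<l. \<Sum>c<l. f a b c *\<^sub>R (if c = b then 1 else 0)) - dual.lie_derivative a"
    by (simp add: scaleR_diff_right sum_subtractf dual.lie_derivative_def)
  also have "(\<Sum>b<l. \<Sum>c<l. f a b c *\<^sub>R (if c = b then 1 else (0::'r))) = ad_trace a *\<^sub>R 1"
    by (simp add: if_distrib[of "scaleR _"] ad_trace_def scaleR_sum_left cong: if_cong)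
  finally show ?thesis .
qed

lemma adjoint_action_commutator:
  assumes "a < l" "b < l"
  shows "adjoint_action a * adjoint_action b - adjoint_action b * adjoint_action a
    = (\<Sum>c<l. f a b c *\<^sub>R adjoint_action c)"
proof -
  have "adjoint_action a * adjoint_action b - adjoint_action b * adjoint_action a
      = dual.lie_derivative a * dual.lie_derivative b - dual.lie_derivative b * dual.lie_derivative a"
    using assms by (simp add: adjoint_action_dual left_diff_distrib right_diff_distrib scaleR_diff_right mult.commute)
  also have "\<dots> = (\<Sum>c<l. (f a b c * ad_trace c) *\<^sub>R 1) - (\<Sum>c<l. f a b c *\<^sub>R dual.lie_derivative c)"
    using ad_trace_derived[OF assms] dual.lie_derivative_commutator[OF assms]
    by (simp add: scaleR_sum_left[symmetric])
  also have "\<dots> = (\<Sum>c<l. f a b c *\<^sub>R adjoint_action c)"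
    by (simp add: adjoint_action_dual scaleR_diff_right sum_subtractf)
  finally show ?thesis .
qed

lemma S_adjoint_action: "S a * adjoint_action b = adjoint_action b * S a"
proof -
  have "S a * (Y c * Q d) = Y c * Q d * S a" for c d
    by (metis SY SQ mult.assoc)
  then show ?thesis
    by (simp add: adjoint_action_def sum_distrib_left sum_distrib_right)
qed

lemma total_action_commutator:
  assumes "a < l" "b < l"
  shows "total_action a * total_action b - total_action b * total_action a
    = (\<Sum>c<l. f a b c *\<^sub>R total_action c)"
proof -
  have "total_action a * total_action b - total_action b * total_action a
     = (S a * S b - S b * S a)
       + (adjoint_action a * adjoint_action b - adjoint_action b * adjoint_action a)"
    by (simp add: total_action_def distrib_left distrib_right S_adjoint_action)
  then show ?thesis
    by (simp add: SS[OF assms] adjoint_action_commutator[OF assms] total_action_def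
        scaleR_add_right sum.distrib)
qed

lemma total_action_ghosts:
  "total_action a * X b = X b * total_action a" "total_action a * P b = P b * total_action a"
proof -
  have "Y c * Q d * X b = X b * (Y c * Q d)" for c d
  proof -
    have "X b * (Y c * Q d) = - (Y c * (X b * Q d))" by (simp add: mult.assoc[symmetric] XY)
    then show ?thesis by (simp add: XQ mult.assoc)
  qed
  moreover have "Y c * Q d * P b = P b * (Y c * Q d)" for c d
  proof -
    have "P b * (Y c * Q d) = - (Y c * (P b * Q d))" by (simp add: mult.assoc[symmetric] PY)
    then show ?thesis by (simp add: PQ mult.assoc)
  qed
  ultimately show "total_action a * X b = X b * total_action a"
    "total_action a * P b = P b * total_action a"
    by (simp_all add: total_action_def adjoint_action_def distrib_left distrib_right
        sum_distrib_left sum_distrib_right SX SP)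
qed

lemma delta_square: "delta * delta = 0"
  using ce_differential_square[of total_action 1] total_action_commutator total_action_ghosts
  by (simp add: delta_def)

lemma shifted_right_commutator:
  assumes "a < l" "b < l"
  shows "shifted_right a * shifted_right b - shifted_right b * shifted_right a
    = - (N * (\<Sum>c<l. f a b c *\<^sub>R shifted_right c))"
    "S a * shifted_right b - shifted_right b * S a = (\<Sum>c<l. f a b c *\<^sub>R shifted_right c)"
proof -
  have "(\<Sum>c<l. f a b c *\<^sub>R shifted_right c)
      = (\<Sum>c<l. f a b c *\<^sub>R R c) - ((\<Sum>c<l. f a b c * ad_trace c) / 2) *\<^sub>R N"
    by (simp add: shifted_right_def scaleR_diff_right sum_subtractf sum_divide_distrib scaleR_sum_left)
  then have sum: "(\<Sum>c<l. f a b c *\<^sub>R shifted_right c) = (\<Sum>c<l. f a b c *\<^sub>R R c)"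
    by (simp add: ad_trace_derived[OF assms])
  show "shifted_right a * shifted_right b - shifted_right b * shifted_right a
    = - (N * (\<Sum>c<l. f a b c *\<^sub>R shifted_right c))"
    unfolding sum RR[OF assms, symmetric]
    by (simp add: shifted_right_def left_diff_distrib right_diff_distrib scaleR_diff_right
        mult.commute[of "ad_trace a"] NR)
  show "S a * shifted_right b - shifted_right b * S a = (\<Sum>c<l. f a b c *\<^sub>R shifted_right c)"
    unfolding sum SR[OF assms, symmetric]
    by (simp add: shifted_right_def left_diff_distrib right_diff_distrib NS)
qed

lemma shifted_right_commutes:
  "shifted_right a * X b = X b * shifted_right a" "shifted_right a * P b = P b * shifted_right a"
  "shifted_right a * Y b = Y b * shifted_right a" "shifted_right a * Q b = Q b * shifted_right a"
  "N * shifted_right a = shifted_right a * N"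
  by (simp_all add: shifted_right_def left_diff_distrib right_diff_distrib RX RP RY RQ NX NP NY NQ NR)

lemma bd_square: "bd * bd = 0"
proof -
  \<comment> \<open>Right multiplications satisfy the commutation relations with the opposite sign.\<close>
  let ?T = "\<lambda>a. - shifted_right a"
  have "((\<Sum>a<l. Q a * ?T a) - N * dual.ce_cubic) * ((\<Sum>a<l. Q a * ?T a) - N * dual.ce_cubic) = 0"
  proof (rule dual.ce_differential_square)
    fix a b assume "a < l" "b < l"
    then show "?T a * ?T b - ?T b * ?T a = N * (\<Sum>c<l. f a b c *\<^sub>R ?T c)"
      using shifted_right_commutator(1) by (simp add: sum_negf)
  qed (simp_all add: shifted_right_commutes NQ NY)
  moreover have "(\<Sum>a<l. Q a * ?T a) - N * dual.ce_cubic = - bd"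
    by (simp add: bd_def sum_negf)
  ultimately show ?thesis by simp
qed

text \<open>Equivariance of \<open>\<partial>\<close>: on the linear part the two terms from \<open>[S\<^sub>a, R\<^sub>d]\<close> and from the action on \<open>Q\<^sub>d\<close>
  cancel; on the cubic part only the Lie derivative acts, which commutes with \<open>dual.ce_cubic\<close>.\<close>

lemma total_action_bd:
  assumes "a < l"
  shows "total_action a * bd = bd * total_action a"
proof -
  have AQ: "adjoint_action a * Q d = Q d * adjoint_action a - (\<Sum>b<l. f a b d *\<^sub>R Q b)" if "d < l" for d
    using assms that
    by (simp add: adjoint_action_dual left_diff_distrib right_diff_distrib dual.lie_derivative_X)
  have AR: "adjoint_action a * shifted_right d = shifted_right d * adjoint_action a" for d
  proof -
    have "shifted_right d * (Y c * Q b) = Y c * Q b * shifted_right d" for b c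
      by (metis shifted_right_commutes(3,4) mult.assoc)
    then show ?thesis by (simp add: adjoint_action_def sum_distrib_left sum_distrib_right)
  qed
  have "total_action a * (\<Sum>d<l. Q d * shifted_right d)
      = (\<Sum>d<l. (Q d * shifted_right d) * total_action a
          + Q d * (\<Sum>c<l. f a d c *\<^sub>R shifted_right c) - (\<Sum>b<l. f a b d *\<^sub>R Q b) * shifted_right d)"
    unfolding sum_distrib_left[of "total_action a"]
  proof (rule sum.cong[OF refl])
    fix d assume "d \<in> {..<l}"
    then have "d < l" by simp
    have "total_action a * (Q d * shifted_right d)
       = Q d * (S a * shifted_right d) + (adjoint_action a * Q d) * shifted_right d"
      by (simp add: total_action_def distrib_right mult.assoc[symmetric] SQ)
    also have "S a * shifted_right d = shifted_right d * S a + (\<Sum>c<l. f a d c *\<^sub>R shifted_right c)"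
      using shifted_right_commutator(2)[OF assms \<open>d < l\<close>] by (simp add: algebra_simps)
    finally show "total_action a * (Q d * shifted_right d)
       = (Q d * shifted_right d) * total_action a
          + Q d * (\<Sum>c<l. f a d c *\<^sub>R shifted_right c) - (\<Sum>b<l. f a b d *\<^sub>R Q b) * shifted_right d"
      by (simp add: AQ[OF \<open>d < l\<close>] total_action_def distrib_left left_diff_distrib mult.assoc AR)
  qed
  also have "\<dots> = (\<Sum>d<l. Q d * shifted_right d) * total_action a
      + (\<Sum>d<l. \<Sum>c<l. f a d c *\<^sub>R (Q d * shifted_right c))
      - (\<Sum>d<l. \<Sum>b<l. f a b d *\<^sub>R (Q b * shifted_right d))"
    by (simp add: sum.distrib sum_subtractf sum_distrib_left sum_distrib_right)
  also have "(\<Sum>d<l. \<Sum>b<l. f a b d *\<^sub>R (Q b * shifted_right d))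
      = (\<Sum>d<l. \<Sum>c<l. f a d c *\<^sub>R (Q d * shifted_right c))"
    by (rule sum.swap)
  finally have linear: "total_action a * (\<Sum>d<l. Q d * shifted_right d)
      = (\<Sum>d<l. Q d * shifted_right d) * total_action a"
    by simp
  have "S a * (Q b * Q c * Y d) = Q b * Q c * Y d * S a" for b c d
    by (metis SQ SY mult.assoc)
  then have "S a * dual.ce_cubic = dual.ce_cubic * S a"
    by (simp add: dual.ce_cubic_def sum_distrib_left sum_distrib_right)
  moreover have "adjoint_action a * dual.ce_cubic = dual.ce_cubic * adjoint_action a"
    using dual.lie_derivative_ce_cubic[OF assms]
    by (simp add: adjoint_action_dual[OF assms] left_diff_distrib right_diff_distrib)
  moreover have NT: "N * total_action a = total_action a * N"
  proof -
    have "N * (Y c * Q b) = Y c * Q b * N" for b c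
      by (metis NY NQ mult.assoc)
    then show ?thesis
      by (simp add: total_action_def adjoint_action_def distrib_left distrib_right NS
          sum_distrib_left sum_distrib_right)
  qed
  ultimately have "total_action a * dual.ce_cubic = dual.ce_cubic * total_action a"
    by (simp add: total_action_def distrib_left distrib_right)
  then have "total_action a * (N * dual.ce_cubic) = N * dual.ce_cubic * total_action a"
    by (metis NT mult.assoc)
  then show ?thesis
    by (simp add: bd_def distrib_left distrib_right linear)
qed

text \<open>Each term of \<open>\<partial>\<close> has an odd number of antighost operators and otherwise only coefficient operators,
  so \<open>\<partial>\<close> anticommutes with each ghost operator; and it commutes with the total action.\<close>

lemma delta_bd: "delta * bd + bd * delta = 0"
proof -
  have anti: "Z * bd = - (bd * Z)"
    if ZQ: "\<And>a. Z * Q a = - (Q a * Z)" and ZY: "\<And>a. Z * Y a = - (Y a * Z)"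
      and ZR: "\<And>a. Z * shifted_right a = shifted_right a * Z" and ZN: "Z * N = N * Z" for Z
  proof -
    have "Z * (Q a * shifted_right a) = - (Q a * shifted_right a * Z)" for a
      by (metis ZQ ZR mult.assoc mult_minus_left)
    moreover have "Z * (N * (Q a * Q b * Y c)) = - (N * (Q a * Q b * Y c) * Z)" for a b c
    proof -
      have "Z * (N * (Q a * Q b * Y c)) = N * ((Z * Q a) * Q b * Y c)"
        by (simp only: mult.assoc[symmetric] ZN)
      also have "\<dots> = - (N * (Q a * (Z * Q b) * Y c))" by (simp add: ZQ[of a] mult.assoc)
      also have "\<dots> = N * (Q a * Q b * (Z * Y c))" by (simp add: ZQ[of b] mult.assoc)
      finally show ?thesis by (simp add: ZY mult.assoc)
    qed
    ultimately show ?thesis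
      by (simp add: bd_def dual.ce_cubic_def distrib_left distrib_right sum_distrib_left
          sum_distrib_right sum_negf)
  qed
  have Xbd: "X a * bd = - (bd * X a)" for a
    by (rule anti) (simp_all add: XQ XY shifted_right_commutes NX)
  have Kbd: "ce_cubic * bd = - (bd * ce_cubic)"
  proof -
    have Pbd: "P a * bd = - (bd * P a)" for a
      by (rule anti) (simp_all add: PQ PY shifted_right_commutes NP)
    have "X a * X b * P c * bd = - (bd * (X a * X b * P c))" for a b c
    proof -
      have "X a * X b * P c * bd = - (X a * (X b * bd) * P c)" by (simp add: Pbd mult.assoc)
      also have "\<dots> = (X a * bd) * X b * P c" by (simp add: Xbd[of b] mult.assoc)
      finally show ?thesis by (simp add: Xbd[of a] mult.assoc)
    qed
    then show ?thesis
      by (simp add: ce_cubic_def sum_distrib_left sum_distrib_right sum_negf)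
  qed
  have "X a * total_action a * bd = - (bd * (X a * total_action a))" if "a < l" for a
  proof -
    have "X a * total_action a * bd = (X a * bd) * total_action a"
      by (simp add: mult.assoc total_action_bd[OF that])
    then show ?thesis by (simp add: Xbd mult.assoc)
  qed
  then have "(\<Sum>a<l. X a * total_action a) * bd = - (bd * (\<Sum>a<l. X a * total_action a))"
    by (simp add: sum_distrib_left sum_distrib_right sum_negf)
  then show ?thesis
    by (simp add: delta_def left_diff_distrib right_diff_distrib Kbd)
qed

lemma delta_expand:
  "delta = - (1/2) *\<^sub>R (\<Sum>a<l. \<Sum>b<l. \<Sum>c<l. f a b c *\<^sub>R (X a * X b * P c))
     + (\<Sum>a<l. \<Sum>b<l. \<Sum>c<l. f a b c *\<^sub>R (X a * Y c * Q b)) + (\<Sum>a<l. X a * S a)"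
proof -
  have "ce_cubic = (1/2) *\<^sub>R (\<Sum>a<l. \<Sum>b<l. \<Sum>c<l. f a b c *\<^sub>R (X a * X b * P c))"
    by (simp add: ce_cubic_def scaleR_sum_right)
  moreover have "(\<Sum>a<l. X a * total_action a)
      = (\<Sum>a<l. \<Sum>b<l. \<Sum>c<l. f a b c *\<^sub>R (X a * Y c * Q b)) + (\<Sum>a<l. X a * S a)"
    by (simp add: total_action_def adjoint_action_def distrib_left sum.distrib sum_distrib_left
        mult.assoc add.commute)
  ultimately show ?thesis by (simp add: delta_def)
qed

text \<open>Each \<open>Y\<^sub>c Q\<^sub>a Q\<^sub>b\<close> differs from \<open>Q\<^sub>a Q\<^sub>b Y\<^sub>c\<close> by two contractions, and antisymmetry of \<open>f\<close> identifies both
  with the trace: \<open>1/2 \<Sum> f\<^sub>a\<^sub>b\<^sup>c Y\<^sub>c Q\<^sub>a Q\<^sub>b = K - \<Sum> tr ad\<^sub>a Q\<^sub>a\<close>.\<close>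

lemma bd_expand:
  "bd = (\<Sum>a<l. Q a * R a) + (1/2) *\<^sub>R (N * (\<Sum>a<l. \<Sum>b<l. f a b b *\<^sub>R Q a))
     + (1/2) *\<^sub>R (N * (\<Sum>a<l. \<Sum>b<l. \<Sum>c<l. f a b c *\<^sub>R (Y c * Q a * Q b)))"
proof -
  let ?t = "\<Sum>a<l. ad_trace a *\<^sub>R Q a"
  have YQQ: "Y c * Q a * Q b = (if c = a then Q b else 0) - (if c = b then Q a else 0) + Q a * Q b * Y c"
    for a b c
  proof -
    have "Y c * Q a * Q b = (if c = a then Q b else 0) - Q a * (Y c * Q b)"
      by (simp add: dual.PX[of c a] left_diff_distrib mult.assoc)
    then show ?thesis by (simp add: dual.PX[of c b] right_diff_distrib mult.assoc)
  qed
  have "(\<Sum>a<l. \<Sum>b<l. \<Sum>c<l. f a b c *\<^sub>R (Y c * Q a * Q b))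
      = (\<Sum>a<l. \<Sum>b<l. f a b a *\<^sub>R Q b) - ?t + 2 *\<^sub>R dual.ce_cubic"
    unfolding YQQ
    by (simp add: scaleR_add_right scaleR_diff_right sum.distrib sum_subtractf dual.ce_cubic_def
        scaleR_sum_right scaleR_sum_left ad_trace_def if_distrib[of "scaleR _"] cong: if_cong)
  also have "(\<Sum>a<l. \<Sum>b<l. f a b a *\<^sub>R Q b) = - ?t"
  proof -
    have "(\<Sum>a<l. f a b a) = - ad_trace b" if "b < l" for b
      unfolding ad_trace_def sum_negf[symmetric]
      by (rule sum.cong[OF refl]) (use that in \<open>auto intro: antisym\<close>)
    then show ?thesis
      by (subst sum.swap) (simp add: scaleR_sum_left[symmetric] sum_negf)
  qed
  also have "- ?t - ?t + 2 *\<^sub>R dual.ce_cubic = 2 *\<^sub>R (dual.ce_cubic - ?t)"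
    by (simp add: scaleR_2)
  finally have M: "(1/2) *\<^sub>R (\<Sum>a<l. \<Sum>b<l. \<Sum>c<l. f a b c *\<^sub>R (Y c * Q a * Q b))
      = dual.ce_cubic - ?t"
    by simp
  let ?h = "(1/2) *\<^sub>R (N * ?t)"
  let ?M = "(1/2) *\<^sub>R (N * (\<Sum>a<l. \<Sum>b<l. \<Sum>c<l. f a b c *\<^sub>R (Y c * Q a * Q b)))"
  have "?M = N * dual.ce_cubic - N * ?t"
    using arg_cong[OF M, of "(*) N"] by (subst (asm) mult_scaleR_right) (simp only: right_diff_distrib)
  moreover have "N * ?t = ?h + ?h"
    by (simp add: scaleR_left_distrib[symmetric])
  ultimately have cubic: "N * dual.ce_cubic = ?h + ?h + ?M"
    by (simp only: eq_diff_eq add.commute)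
  have "bd = (\<Sum>a<l. Q a * R a) - ?h + N * dual.ce_cubic"
    by (simp add: bd_def shifted_right_def right_diff_distrib sum_subtractf scaleR_sum_right
        sum_distrib_left NQ)
  also have "\<dots> = (\<Sum>a<l. Q a * R a) + ?h + ?M"
    unfolding cubic by simp
  also have "?t = (\<Sum>a<l. \<Sum>b<l. f a b b *\<^sub>R Q a)"
    by (simp add: ad_trace_def scaleR_sum_left)
  finally show ?thesis .
qed

end

section \<open>Grassmann algebras: generators, derivations, wedge products\<close>

text \<open>The sign from moving the \<open>i\<close>-th generator past the generators of \<open>e\<^sub>U\<close> that precede it.\<close>

definition order_sign :: "nat \<Rightarrow> nat set \<Rightarrow> 'c::comm_ring_1" where
  "order_sign i U = (- 1) ^ card {s\<in>U. s < i}"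

text \<open>Left multiplication by the \<open>i\<close>-th generator in coordinates. Unlike \<^const>\<open>wedge\<close>, whose defining sum over
  \<open>Pow U\<close> is zero for infinite \<open>U\<close>, it satisfies the anticommutation relations on all functions.\<close>

definition gen_mult :: "nat \<Rightarrow> 'c::comm_ring_1 grassmann \<Rightarrow> 'c grassmann" where
  "gen_mult i x = (\<lambda>U. if i \<in> U then order_sign i U * x (U - {i}) else 0)"

lemma left_deriv_order_sign: "left_deriv i x = (\<lambda>U. if i \<in> U then 0 else order_sign i U * x (insert i U))"
  by (simp add: left_deriv_def order_sign_def fun_eq_iff)

lemma finite_below: "finite {s\<in>U. s < (i::nat)}"
  by (rule finite_subset[of _ "{..<i}"]) auto

lemma order_sign_insert:
  assumes "j \<notin> U"
  shows "order_sign i (insert j U) = (if j < i then - order_sign i U else order_sign i U)"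
proof (cases "j < i")
  case True
  then have "{s\<in>insert j U. s < i} = insert j {s\<in>U. s < i}" by auto
  moreover have "j \<notin> {s\<in>U. s < i}" using assms by simp
  ultimately show ?thesis
    using True finite_below[of U i] by (simp add: order_sign_def)
next
  case False
  then have "{s\<in>insert j U. s < i} = {s\<in>U. s < i}" by auto
  with False show ?thesis by (simp add: order_sign_def)
qed

lemma order_sign_delete:
  assumes "j \<in> U"
  shows "order_sign i (U - {j}) = (if j < i then - order_sign i U else order_sign i U)"
proof -
  have "order_sign i (insert j (U - {j}))
      = (if j < i then - order_sign i (U - {j}) else (order_sign i (U - {j}) :: 'a))"
    by (rule order_sign_insert) simp
  then show ?thesis using assms by (simp add: insert_absorb)
qed

lemma order_sign_split:
  assumes "S \<subseteq> U"
  shows "order_sign i U = order_sign i (U - S) * order_sign i S"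
proof -
  have "{s\<in>U. s < i} = {s\<in>U - S. s < i} \<union> {s\<in>S. s < i}" using assms by auto
  moreover have "{s\<in>U - S. s < i} \<inter> {s\<in>S. s < i} = {}" by auto
  ultimately show ?thesis
    using finite_below by (simp add: order_sign_def card_Un_disjoint power_add)
qed

lemma order_sign_square [simp]:
  "order_sign i U * order_sign i U = 1" "order_sign i U * (order_sign i U * z) = z"
proof -
  show *: "order_sign i U * order_sign i U = (1::'c::comm_ring_1)"
    by (simp add: order_sign_def power_add[symmetric])
  show "order_sign i U * (order_sign i U * z) = z"
    by (simp add: mult.assoc[symmetric] *)
qed

lemma gen_mult_anticommute: "gen_mult i (gen_mult j x) U = - gen_mult j (gen_mult i x) U"
  by (cases "i = j") (auto simp: gen_mult_def order_sign_delete Diff_insert[symmetric] insert_commute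
      mult.left_commute)

lemma left_deriv_anticommute: "left_deriv i (left_deriv j x) U = - left_deriv j (left_deriv i x) U"
  by (cases "i = j") (auto simp: left_deriv_order_sign order_sign_insert insert_commute
      mult.left_commute)

lemma left_deriv_gen_mult:
  "left_deriv i (gen_mult j x) U = (if i = j then x U else 0) - gen_mult j (left_deriv i x) U"
proof (cases "i = j")
  case True
  then show ?thesis
    by (auto simp: left_deriv_order_sign gen_mult_def order_sign_insert order_sign_delete insert_absorb)
next
  case False
  then have "insert i U - {j} = insert i (U - {j})" by auto
  with False show ?thesis
    by (auto simp: left_deriv_order_sign gen_mult_def order_sign_insert order_sign_delete mult.left_commute)
qed

text \<open>The parity automorphism, the source of all signs when an odd generator is moved past a vector.\<close>

definition involution :: "'c::comm_ring_1 grassmann \<Rightarrow> 'c grassmann" where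
  "involution x = (\<lambda>S. (- 1) ^ card S * x S)"

lemma involution_involution [simp]: "involution (involution x) = x"
  by (simp add: involution_def fun_eq_iff mult.assoc[symmetric] power_add[symmetric])

lemma involution_left_deriv:
  assumes "finite U"
  shows "involution (left_deriv i x) U = - left_deriv i (involution x) U"
  using assms by (cases "i \<in> U")
    (simp_all add: involution_def left_deriv_order_sign mult.left_commute[of "(- 1) ^ card U"])

lemma shuffle_sign_insert_left:
  assumes "finite S" "finite T" "i \<notin> S"
  shows "shuffle_sign (insert i S) T = order_sign i T * shuffle_sign S T"
proof -
  have "{(s, t). s \<in> insert i S \<and> t \<in> T \<and> t < s}
      = Pair i ` {t\<in>T. t < i} \<union> {(s, t). s \<in> S \<and> t \<in> T \<and> t < s}" by auto
  moreover have "finite {(s, t). s \<in> S \<and> t \<in> T \<and> t < s}"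
    by (rule finite_subset[of _ "S \<times> T"]) (use assms in auto)
  moreover have "Pair i ` {t\<in>T. t < i} \<inter> {(s, t). s \<in> S \<and> t \<in> T \<and> t < s} = {}"
    using assms by auto
  ultimately have "card {(s, t). s \<in> insert i S \<and> t \<in> T \<and> t < s}
      = card {t\<in>T. t < i} + card {(s, t). s \<in> S \<and> t \<in> T \<and> t < s}"
    using finite_below[of T i] by (simp add: card_Un_disjoint card_image inj_on_def)
  then show ?thesis by (simp add: shuffle_sign_def order_sign_def power_add)
qed

text \<open>The new generator moves past the elements of \<open>S\<close> above it: all of \<open>S\<close> except those counted in
  \<open>order_sign i S\<close>.\<close>

lemma shuffle_sign_insert_right:
  assumes "finite S" "finite T" "i \<notin> S" "i \<notin> T"
  shows "(shuffle_sign S (insert i T) :: 'c::comm_ring_1) = (- 1) ^ card S * order_sign i S * shuffle_sign S T"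
proof -
  have "{(s, t). s \<in> S \<and> t \<in> insert i T \<and> t < s}
      = (\<lambda>s. (s, i)) ` {s\<in>S. i < s} \<union> {(s, t). s \<in> S \<and> t \<in> T \<and> t < s}" by auto
  moreover have "finite {(s, t). s \<in> S \<and> t \<in> T \<and> t < s}"
    by (rule finite_subset[of _ "S \<times> T"]) (use assms in auto)
  moreover have "(\<lambda>s. (s, i)) ` {s\<in>S. i < s} \<inter> {(s, t). s \<in> S \<and> t \<in> T \<and> t < s} = {}"
    using assms by auto
  ultimately have 1: "card {(s, t). s \<in> S \<and> t \<in> insert i T \<and> t < s}
      = card {s\<in>S. i < s} + card {(s, t). s \<in> S \<and> t \<in> T \<and> t < s}"
    using assms(1) by (simp add: card_Un_disjoint card_image inj_on_def)
  have "S = {s\<in>S. i < s} \<union> {s\<in>S. s < i}" using assms(3) by (auto simp: neq_iff) (metis nat_neq_iff)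
  then have "card S = card {s\<in>S. i < s} + card {s\<in>S. s < i}"
    using assms(1) card_Un_disjoint[of "{s\<in>S. i < s}" "{s\<in>S. s < i}"] by fastforce
  then have "(- 1) ^ card S = (- 1) ^ card {s\<in>S. i < s} * (order_sign i S :: 'c)"
    by (simp add: order_sign_def power_add)
  then have "(- 1) ^ card S * order_sign i S = ((- 1) ^ card {s\<in>S. i < s} :: 'c)"
    by (simp add: mult.assoc)
  with 1 show ?thesis by (simp add: shuffle_sign_def power_add)
qed

lemma wedge_infinite: "infinite U \<Longrightarrow> wedge x y U = 0"
  by (simp add: wedge_def tensor_mult_def)

text \<open>Associativity of the wedge product when the first factor is a generator. The subsets of \<open>U\<close> with a
  nonzero contribution contain \<open>i\<close> and are reindexed by removing it.\<close>

lemma wedge_gen_mult_left: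
  fixes x y :: "'c::comm_ring_1 grassmann"
  shows "wedge (gen_mult i x) y U = gen_mult i (wedge x y) U"
proof -
  consider "infinite U" | "finite U" "i \<notin> U" | "finite U" "i \<in> U" by blast
  then show ?thesis
  proof cases
    assume "infinite U"
    then show ?thesis by (simp add: wedge_infinite gen_mult_def)
  next
    assume False: "i \<notin> U"
    then have "gen_mult i x S = 0" if "S \<subseteq> U" for S
      using that by (auto simp: gen_mult_def)
    with False show ?thesis by (simp add: wedge_def tensor_mult_def gen_mult_def)
  next
    assume assms: "finite U" and True: "i \<in> U"
    have fin: "finite S" if "S \<subseteq> U" for S using assms that finite_subset by blast
    have "wedge (gen_mult i x) y U
        = (\<Sum>S\<in>insert i ` Pow (U - {i}). shuffle_sign S (U - S) * (gen_mult i x S * y (U - S)))"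
      unfolding wedge_def tensor_mult_def
    proof (rule sum.mono_neutral_right)
      show "\<forall>S\<in>Pow U - insert i ` Pow (U - {i}). shuffle_sign S (U - S) * (gen_mult i x S * y (U - S)) = 0"
      proof
        fix S assume S: "S \<in> Pow U - insert i ` Pow (U - {i})"
        have "i \<notin> S"
        proof
          assume "i \<in> S"
          then have "S = insert i (S - {i})" "S - {i} \<in> Pow (U - {i})" using S by auto
          then show False using S by blast
        qed
        then show "shuffle_sign S (U - S) * (gen_mult i x S * y (U - S)) = 0"
          by (simp add: gen_mult_def)
      qed
    qed (use assms True in auto)
    also have "\<dots> = (\<Sum>S\<in>Pow (U - {i}). shuffle_sign (insert i S) (U - insert i S)
        * (gen_mult i x (insert i S) * y (U - insert i S)))"
      by (subst sum.reindex) (auto simp: inj_on_def)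
    also have "\<dots> = (\<Sum>S\<in>Pow (U - {i}). order_sign i U
        * (shuffle_sign S (U - {i} - S) * (x S * y (U - {i} - S))))"
    proof (rule sum.cong[OF refl])
      fix S assume "S \<in> Pow (U - {i})"
      then have S: "S \<subseteq> U" "i \<notin> S" by auto
      have "order_sign i U = order_sign i (U - S) * (order_sign i S :: 'c)"
        using S by (intro order_sign_split)
      moreover have "order_sign i (U - insert i S) = (order_sign i (U - S) :: 'c)"
        using order_sign_delete[of i "U - S" i, where 'a='c] S True
        by (simp add: Diff_insert[of U i S])
      moreover have "U - insert i S = U - {i} - S" by auto
      ultimately show "shuffle_sign (insert i S) (U - insert i S)
          * (gen_mult i x (insert i S) * y (U - insert i S))
        = order_sign i U * (shuffle_sign S (U - {i} - S) * (x S * y (U - {i} - S)))"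
        using S fin by (simp add: shuffle_sign_insert_left gen_mult_def order_sign_insert mult_ac)
    qed
    also have "\<dots> = gen_mult i (wedge x y) U"
      using True by (simp add: gen_mult_def wedge_def tensor_mult_def sum_distrib_left)
    finally show ?thesis .
  qed
qed

text \<open>Supercommutativity with a generator: it is pulled out to the left past \<open>x\<close>, which costs the
  parity of \<open>x\<close>.\<close>

lemma wedge_gen_mult_right:
  fixes x y :: "'c::comm_ring_1 grassmann"
  shows "wedge x (gen_mult i y) U = gen_mult i (wedge (involution x) y) U"
proof -
  consider "infinite U" | "finite U" "i \<notin> U" | "finite U" "i \<in> U" by blast
  then show ?thesis
  proof cases
    assume "infinite U"
    then show ?thesis by (simp add: wedge_infinite gen_mult_def)
  next
    assume False: "i \<notin> U"
    then have "gen_mult i y (U - S) = 0" for S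
      by (auto simp: gen_mult_def)
    with False show ?thesis by (simp add: wedge_def tensor_mult_def gen_mult_def)
  next
    assume assms: "finite U" and True: "i \<in> U"
    have fin: "finite S" if "S \<subseteq> U" for S using assms that finite_subset by blast
    have "wedge x (gen_mult i y) U
        = (\<Sum>S\<in>Pow (U - {i}). shuffle_sign S (U - S) * (x S * gen_mult i y (U - S)))"
      unfolding wedge_def tensor_mult_def
      by (rule sum.mono_neutral_right) (use assms in \<open>auto simp: gen_mult_def\<close>)
    also have "\<dots> = (\<Sum>S\<in>Pow (U - {i}). order_sign i U
        * (shuffle_sign S (U - {i} - S) * (involution x S * y (U - {i} - S))))"
    proof (rule sum.cong[OF refl])
      fix S assume "S \<in> Pow (U - {i})"
      then have S: "S \<subseteq> U" "i \<notin> S" by auto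
      have sgn: "order_sign i U = order_sign i (U - S) * (order_sign i S :: 'c)"
        using S by (intro order_sign_split)
      have U: "U - S = insert i (U - {i} - S)" using S True by auto
      have "shuffle_sign S (U - S) = (- 1) ^ card S * order_sign i S * (shuffle_sign S (U - {i} - S) :: 'c)"
        unfolding U using S fin assms by (intro shuffle_sign_insert_right) auto
      moreover have "U - S - {i} = U - {i} - S" by auto
      ultimately show "shuffle_sign S (U - S) * (x S * gen_mult i y (U - S))
        = order_sign i U * (shuffle_sign S (U - {i} - S) * (involution x S * y (U - {i} - S)))"
        using S True by (simp add: gen_mult_def involution_def sgn mult_ac)
    qed
    also have "\<dots> = gen_mult i (wedge (involution x) y) U"
      using True by (simp add: gen_mult_def wedge_def tensor_mult_def sum_distrib_left)
    finally show ?thesis .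
  qed
qed

lemma wedge_unit:
  assumes "finite U"
  shows "wedge (monomial {}) y U = y U" "wedge x (monomial {}) U = x U"
proof -
  have "wedge (monomial {}) y U = (\<Sum>S\<in>{{}}. shuffle_sign S (U - S) * (monomial {} S * y (U - S)))"
    unfolding wedge_def tensor_mult_def
    by (rule sum.mono_neutral_right) (use assms in \<open>auto simp: monomial_def\<close>)
  then show "wedge (monomial {}) y U = y U" by (simp add: shuffle_sign_def monomial_def)
  have "wedge x (monomial {}) U = (\<Sum>S\<in>{U}. shuffle_sign S (U - S) * (x S * monomial {} (U - S)))"
    unfolding wedge_def tensor_mult_def
    by (rule sum.mono_neutral_right) (use assms in \<open>auto simp: monomial_def\<close>)
  then show "wedge x (monomial {}) U = x U" by (simp add: shuffle_sign_def monomial_def)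
qed

lemma generator_gen_mult:
  "(generator i :: 'c::comm_ring_1 grassmann) = gen_mult i (monomial {})"
proof (rule ext)
  fix U :: "nat set"
  have below: "{s\<in>{i}. s < i} = {}" by auto
  have sign: "order_sign i {i} = (1 :: 'c)" unfolding order_sign_def below by simp
  have "U = {i}" if "i \<in> U" "U - {i} = {}" using that by auto
  then show "(generator i :: 'c grassmann) U = gen_mult i (monomial {}) U"
    by (cases "U = {i}") (auto simp: generator_def gen_mult_def monomial_def sign)
qed

section \<open>The Clifford product with one and with three generators\<close>

text \<open>Vectors of the Grassmann algebra vanish on infinite index sets. There \<^const>\<open>card\<close> is zero and gives no
  meaningful parity, so sign rules for \<open>involution\<close> hold as equations of functions only under
  this condition.\<close>

definition fin_supp :: "'c::zero grassmann \<Rightarrow> bool" where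
  "fin_supp x \<longleftrightarrow> (\<forall>U. infinite U \<longrightarrow> x U = 0)"

lemma fin_supp_gen_mult: "fin_supp x \<Longrightarrow> fin_supp (gen_mult i x)"
  and fin_supp_left_deriv: "fin_supp x \<Longrightarrow> fin_supp (left_deriv i x)"
  and fin_supp_involution: "fin_supp x \<Longrightarrow> fin_supp (involution x)"
  and fin_supp_monomial: "finite S \<Longrightarrow> fin_supp (monomial S)"
  by (auto simp: fin_supp_def gen_mult_def left_deriv_order_sign involution_def monomial_def)

lemma gen_mult_add: "gen_mult i (x + y) = gen_mult i x + gen_mult i y"
  and gen_mult_minus: "gen_mult i (- x) = - gen_mult i x"
  and gen_mult_zero: "gen_mult i 0 = 0"
  and left_deriv_add: "left_deriv i (x + y) = left_deriv i x + left_deriv i y"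
  and left_deriv_minus: "left_deriv i (- x) = - left_deriv i x"
  and left_deriv_zero: "left_deriv i 0 = 0"
  and involution_minus: "involution (- x) = - involution x"
  by (auto simp: fun_eq_iff gen_mult_def left_deriv_order_sign involution_def algebra_simps)

lemma left_deriv_unit: "left_deriv i (monomial {}) = 0"
  by (auto simp: fun_eq_iff left_deriv_order_sign monomial_def)

lemma involution_unit: "involution (monomial {}) = monomial {}"
  by (auto simp: fun_eq_iff involution_def monomial_def)

lemma involution_gen_mult_fin:
  assumes "fin_supp x"
  shows "involution (gen_mult i x) = - gen_mult i (involution x)"
proof
  fix U
  show "involution (gen_mult i x) U = (- gen_mult i (involution x)) U"
  proof (cases "finite U")
    case True
    have "(- 1) ^ card U = - ((- 1) ^ card (U - {i}) :: 'a)" if "i \<in> U"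
      using True that by (metis card_Suc_Diff1 power_Suc mult_minus1)
    then show ?thesis by (simp add: involution_def gen_mult_def mult.left_commute)
  next
    case False
    then have "infinite (U - {i})" by simp
    with assms show ?thesis by (simp add: involution_def gen_mult_def fin_supp_def)
  qed
qed

lemma involution_left_deriv_fin:
  assumes "fin_supp x"
  shows "involution (left_deriv i x) = - left_deriv i (involution x)"
proof
  fix U
  show "involution (left_deriv i x) U = (- left_deriv i (involution x)) U"
    using assms by (cases "finite U")
      (auto simp: involution_left_deriv fin_supp_def involution_def left_deriv_order_sign)
qed

text \<open>Contraction and multiplication are computed on elements \<open>v \<otimes> w\<close>.\<close>

definition pure_tensor :: "'c::comm_ring_1 grassmann \<Rightarrow> 'c grassmann \<Rightarrow> 'c grassmann grassmann" where
  "pure_tensor v w = (\<lambda>S T. v S * w T)"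

lemma pure_tensor_minus: "pure_tensor (- v) w = - pure_tensor v w"
    "pure_tensor v (- w) = - pure_tensor v w"
  and pure_tensor_zero: "pure_tensor 0 w = 0" "pure_tensor v 0 = 0"
  and pure_tensor_diff: "pure_tensor v (w - w') = pure_tensor v w - pure_tensor v w'"
  by (simp_all add: pure_tensor_def fun_eq_iff right_diff_distrib)

lemma sum_fun_apply: "(\<Sum>a\<in>I. F a) x = (\<Sum>a\<in>I. F a x)"
  by (induction I rule: infinite_finite_induct) simp_all

lemma tensor_mult_pure: "tensor_mult (pure_tensor v w) = wedge v w"
  by (simp add: wedge_def pure_tensor_def)

lemma tensor_mult_diff: "tensor_mult (s - t) = tensor_mult s - tensor_mult t"
  and tensor_mult_minus: "tensor_mult (- s) = - tensor_mult s"
  and tensor_mult_add: "tensor_mult (s + t) = tensor_mult s + tensor_mult t"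
  and tensor_mult_zero: "tensor_mult 0 = 0"
  by (simp_all add: tensor_mult_def fun_eq_iff right_diff_distrib sum_subtractf sum_negf
      distrib_left sum.distrib)

lemma contraction_pure:
  "contraction l (pure_tensor v w)
    = (\<Sum>a<l. pure_tensor (left_deriv (antighost a) (involution v)) (left_deriv (ghost a) w))"
proof -
  have "left_deriv j (\<lambda>T. v R * w T) T = v R * left_deriv j w T" for j R T
    by (simp add: left_deriv_order_sign mult.left_commute)
  then have "tensor_deriv i j (pure_tensor v w) = pure_tensor (left_deriv i (involution v)) (left_deriv j w)"
    for i j
    by (simp add: tensor_deriv_def pure_tensor_def involution_def left_deriv_order_sign fun_eq_iff mult_ac)
  then show ?thesis by (simp add: contraction_def fun_eq_iff sum_fun_apply)
qed

lemma contraction_linear: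
  "contraction l (\<lambda>S T. \<Sum>k\<in>I. c k * t k S T) = (\<lambda>S T. \<Sum>k\<in>I. c k * contraction l (t k) S T)"
proof -
  have "tensor_deriv i j (\<lambda>S T. \<Sum>k\<in>I. c k * t k S T) S T = (\<Sum>k\<in>I. c k * tensor_deriv i j (t k) S T)"
    for i j S T
    by (simp add: tensor_deriv_def left_deriv_order_sign sum_distrib_left mult_ac)
  then show ?thesis
    unfolding contraction_def fun_eq_iff sum_distrib_left by (simp only:) (intro allI, rule sum.swap)
qed

lemma tensor_deriv_zero: "tensor_deriv i j 0 = 0"
  and tensor_deriv_minus: "tensor_deriv i j (- t) = - tensor_deriv i j t"
  and tensor_deriv_diff: "tensor_deriv i j (s - t) = tensor_deriv i j s - tensor_deriv i j t"
  and tensor_deriv_add: "tensor_deriv i j (s + t) = tensor_deriv i j s + tensor_deriv i j t"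
  by (auto simp: tensor_deriv_def left_deriv_order_sign fun_eq_iff right_diff_distrib distrib_left)

lemma contraction_zero: "contraction l 0 = 0"
  and contraction_minus: "contraction l (- t) = - contraction l t"
  and contraction_diff: "contraction l (s - t) = contraction l s - contraction l t"
  and contraction_add: "contraction l (s + t) = contraction l s + contraction l t"
  by (simp_all add: contraction_def fun_eq_iff tensor_deriv_zero tensor_deriv_minus
      tensor_deriv_diff tensor_deriv_add sum_subtractf sum_negf sum.distrib)

lemma contraction_power_zero: "(contraction l ^^ n) 0 = 0"
proof (induction n)
  case (Suc n)
  then show ?case by (simp only: funpow.simps comp_apply contraction_zero)
qed simp

lemma sum_pure_delta:
  fixes w :: "nat \<Rightarrow> 'c::comm_ring_1 grassmann"
  assumes "a < l"
  shows "(\<Sum>e<l. pure_tensor (w e) (if e = a then x else 0)) = pure_tensor (w a) x"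
    "(\<Sum>e<l. pure_tensor (if e = a then x else 0) (w e)) = pure_tensor x (w a)"
  using assms by (simp_all add: if_distrib[of "pure_tensor _"] if_distrib[of "\<lambda>v. pure_tensor v _"]
      pure_tensor_zero cong: if_cong)

lemma ghost_antighost_neq [simp]: "ghost a \<noteq> antighost b" "antighost b \<noteq> ghost a"
  and ghost_inject [simp]: "ghost a = ghost b \<longleftrightarrow> a = b"
  and antighost_inject [simp]: "antighost a = antighost b \<longleftrightarrow> a = b"
  unfolding ghost_def antighost_def by presburger+

lemma left_deriv_gen_mult_fun:
  "left_deriv i (gen_mult j x) = (if i = j then x else 0) - gen_mult j (left_deriv i x)"
  by (auto simp: fun_eq_iff left_deriv_gen_mult)

text \<open>If the first contraction vanishes, only the constant term of the exponential series survives.\<close>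

lemma clifford_degree0:
  assumes "contraction l (pure_tensor v w) = 0"
  shows "clifford l v w U = fps_const (wedge v w U)"
proof (rule fps_ext)
  fix n
  show "fps_nth (clifford l v w U) n = fps_nth (fps_const (wedge v w U)) n"
    using assms
    by (cases n) (simp_all add: clifford_def pure_tensor_def[symmetric] funpow_Suc_right
        tensor_mult_pure contraction_power_zero tensor_mult_zero del: funpow.simps)
qed

text \<open>The coefficients are \<open>(- 2)\<^sup>1 / 1! = - 2\<close> and \<open>(- 2)\<^sup>2 / 2! = 2\<close>.\<close>

lemma clifford_degree2:
  assumes "contraction l (contraction l (contraction l (pure_tensor v w))) = 0"
  shows "clifford l v w U = fps_const (wedge v w U)
    - fps_X * fps_const (2 * tensor_mult (contraction l (pure_tensor v w)) U)
    + fps_X * (fps_X * fps_const (2 * tensor_mult (contraction l (contraction l (pure_tensor v w))) U))"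
    (is "_ = ?R")
proof (rule fps_ext)
  fix n
  have nth: "fps_nth (clifford l v w U) n
      = (- 2) ^ n / fact n * tensor_mult ((contraction l ^^ n) (pure_tensor v w)) U" for n
    by (simp add: clifford_def pure_tensor_def)
  consider "n = 0" | "n = 1" | "n = 2" | m where "n = Suc (Suc (Suc m))"
    by (metis One_nat_def Suc_1 not0_implies_Suc)
  then show "fps_nth (clifford l v w U) n = fps_nth ?R n"
  proof cases
    case (4 m)
    then have "(contraction l ^^ n) (pure_tensor v w) = 0"
      using assms by (simp add: funpow_Suc_right contraction_power_zero del: funpow.simps)
    then show ?thesis unfolding nth by (simp add: 4 tensor_mult_zero)
  qed (simp_all add: nth tensor_mult_pure numeral_2_eq_2 fact_numeral)
qed

definition cubic :: "nat \<Rightarrow> nat \<Rightarrow> nat \<Rightarrow> 'c::comm_ring_1 grassmann" where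
  "cubic a b c = gen_mult (ghost a) (gen_mult (ghost b) (gen_mult (antighost c) (monomial {})))"

lemmas fin_supp_rules = fin_supp_gen_mult fin_supp_left_deriv fin_supp_involution fin_supp_monomial

lemmas grassmann_simps = left_deriv_gen_mult_fun left_deriv_unit gen_mult_zero gen_mult_minus
  left_deriv_minus left_deriv_zero involution_minus involution_gen_mult_fin involution_left_deriv_fin
  involution_unit fin_supp_rules

lemma wedge_unit_fin:
  assumes "fin_supp x"
  shows "wedge (monomial {}) x = x" "wedge x (monomial {}) = x"
proof -
  have "wedge (monomial {}) x U = x U \<and> wedge x (monomial {}) U = x U" for U
    using assms by (cases "finite U") (simp_all add: wedge_unit wedge_infinite fin_supp_def)
  then show "wedge (monomial {}) x = x" "wedge x (monomial {}) = x" by blast+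
qed

lemma wedge_gen_mult:
  "wedge (gen_mult i x) y = gen_mult i (wedge x y)"
  "wedge x (gen_mult i y) = gen_mult i (wedge (involution x) y)"
  by (simp_all add: fun_eq_iff wedge_gen_mult_left wedge_gen_mult_right)

text \<open>A contraction differentiates the left factor along an antighost, and a ghost contains none.\<close>

lemma clifford_ghost_left:
  assumes "fin_supp w"
  shows "clifford l (generator (ghost a)) w U = fps_const (gen_mult (ghost a) w U)"
proof -
  have "contraction l (pure_tensor (generator (ghost a)) w) = 0"
    by (simp add: contraction_pure generator_gen_mult grassmann_simps pure_tensor_zero)
  then show ?thesis
    using assms by (simp add: clifford_degree0 generator_gen_mult wedge_gen_mult wedge_unit_fin)
qed

lemma clifford_ghost_right:
  assumes "fin_supp v" and a: "a < l"
  shows "clifford l v (generator (ghost a)) U = fps_const (gen_mult (ghost a) (involution v) U)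
    - fps_X * fps_const (2 * left_deriv (antighost a) (involution v) U)"
proof -
  have "left_deriv (ghost e) (generator (ghost a)) = (if e = a then monomial {} else (0 :: 'a grassmann))" for e
    by (simp add: generator_gen_mult grassmann_simps)
  then have 1: "contraction l (pure_tensor v (generator (ghost a)))
      = pure_tensor (left_deriv (antighost a) (involution v)) (monomial {})"
    using a by (simp add: contraction_pure sum_pure_delta)
  have 2: "contraction l (pure_tensor u (monomial {})) = 0" for u
    by (simp add: contraction_pure left_deriv_unit pure_tensor_zero)
  have "wedge v (generator (ghost a)) = gen_mult (ghost a) (involution v)"
    using assms(1) by (simp add: generator_gen_mult wedge_gen_mult wedge_unit_fin fin_supp_rules)
  then show ?thesis
    using assms(1) by (subst clifford_degree2)
      (simp_all add: 1 2 contraction_zero tensor_mult_pure tensor_mult_zero wedge_unit_fin fin_supp_rules)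
qed

text \<open>The only antighost of the left factor is contracted with the ghost \<open>c\<close> of \<open>w\<close>; the two signs from the
  parity of the cubic and from the coefficient \<open>- 2\<close> cancel.\<close>

lemma clifford_cubic_left:
  assumes "fin_supp w" and c: "c < l"
  shows "clifford l (cubic a b c) w U
    = fps_const (gen_mult (ghost a) (gen_mult (ghost b) (gen_mult (antighost c) w)) U)
      + fps_X * fps_const (2 * gen_mult (ghost a) (gen_mult (ghost b) (left_deriv (ghost c) w)) U)"
proof -
  let ?v = "gen_mult (ghost a) (gen_mult (ghost b) (monomial {})) :: 'a grassmann"
  have "left_deriv (antighost e) (involution (cubic a b c)) = (if e = c then - ?v else 0)" for e
    by (simp add: cubic_def grassmann_simps)
  then have 1: "contraction l (pure_tensor (cubic a b c) w) = - pure_tensor ?v (left_deriv (ghost c) w)"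
    using c by (simp add: contraction_pure sum_pure_delta pure_tensor_minus)
  have 2: "contraction l (pure_tensor ?v u) = 0" for u
    by (simp add: contraction_pure grassmann_simps pure_tensor_zero)
  have "wedge (cubic a b c) w = gen_mult (ghost a) (gen_mult (ghost b) (gen_mult (antighost c) w))"
    using assms(1) by (simp add: cubic_def wedge_gen_mult wedge_unit_fin)
  then show ?thesis
    using assms(1) by (subst clifford_degree2)
      (simp_all add: 1 2 contraction_minus contraction_zero tensor_mult_minus tensor_mult_pure
        tensor_mult_zero wedge_gen_mult wedge_unit_fin fin_supp_rules)
qed

text \<open>The two ghosts on the right are contracted, one at a time and then both, with antighosts of \<open>v\<close>. The
  two orders of contracting both give the same term, hence the coefficient \<open>4 = 2 \<cdot> 2\<close>.\<close>

lemma clifford_cubic_right: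
  assumes v: "fin_supp v" and abc: "a < l" "b < l" "c < l"
  shows "clifford l v (cubic a b c) U
    = fps_const (gen_mult (ghost a) (gen_mult (ghost b) (gen_mult (antighost c) (involution v))) U)
      - fps_X * fps_const (2 * (gen_mult (ghost b) (gen_mult (antighost c) (left_deriv (antighost a) (involution v))) U
          - gen_mult (ghost a) (gen_mult (antighost c) (left_deriv (antighost b) (involution v))) U))
      + fps_X * (fps_X * fps_const (4 * gen_mult (antighost c)
          (left_deriv (antighost a) (left_deriv (antighost b) (involution v))) U))"
proof -
  let ?d = "\<lambda>a. left_deriv (antighost a)" and ?v = "involution v"
  let ?A = "gen_mult (antighost c) (monomial {}) :: 'a grassmann"
  have "left_deriv (ghost e) (cubic a b c)
      = (if e = a then gen_mult (ghost b) ?A else 0) - (if e = b then gen_mult (ghost a) ?A else 0)" for e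
    by (simp add: cubic_def grassmann_simps)
  then have 1: "contraction l (pure_tensor v (cubic a b c))
     = pure_tensor (?d a ?v) (gen_mult (ghost b) ?A) - pure_tensor (?d b ?v) (gen_mult (ghost a) ?A)"
    using abc by (simp add: contraction_pure sum_pure_delta pure_tensor_diff sum_subtractf)
  have ghostA: "left_deriv (ghost e) (gen_mult (ghost i) ?A) = (if e = i then ?A else 0)" for e i
    by (simp add: grassmann_simps)
  have "contraction l (contraction l (pure_tensor v (cubic a b c)))
      = pure_tensor (?d a (?d b v)) ?A - pure_tensor (?d b (?d a v)) ?A"
    unfolding 1 contraction_diff
    using v abc by (simp add: contraction_pure ghostA sum_pure_delta grassmann_simps
        pure_tensor_minus sum_negf)
  moreover have "?d b (?d a v) = - ?d a (?d b v)"
    by (simp add: fun_eq_iff left_deriv_anticommute[of "antighost b"])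
  ultimately have 2: "contraction l (contraction l (pure_tensor v (cubic a b c)))
      = pure_tensor (?d a (?d b v)) ?A + pure_tensor (?d a (?d b v)) ?A"
    by (simp only: pure_tensor_minus diff_minus_eq_add)
  have 3: "contraction l (pure_tensor u ?A) = 0" for u
    by (simp add: contraction_pure grassmann_simps pure_tensor_zero)
  have w0: "wedge v (cubic a b c) = gen_mult (ghost a) (gen_mult (ghost b) (gen_mult (antighost c) ?v))"
    using v by (simp add: cubic_def wedge_gen_mult wedge_unit_fin fin_supp_rules)
  have w1: "wedge (?d i ?v) (gen_mult (ghost j) ?A)
      = gen_mult (ghost j) (gen_mult (antighost c) (?d i ?v))" for i j
    using v by (simp add: wedge_gen_mult wedge_unit_fin fin_supp_rules)
  have w2: "wedge (?d a (?d b v)) ?A = gen_mult (antighost c) (?d a (?d b ?v))"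
    using v by (simp add: wedge_gen_mult wedge_unit_fin grassmann_simps)
  have "clifford l v (cubic a b c) U = fps_const (wedge v (cubic a b c) U)
      - fps_X * fps_const (2 * tensor_mult (contraction l (pure_tensor v (cubic a b c))) U)
      + fps_X * (fps_X * fps_const (2 * tensor_mult (contraction l (contraction l (pure_tensor v (cubic a b c)))) U))"
    by (rule clifford_degree2) (simp only: 2 3 contraction_add add_0_right)
  then show ?thesis
    unfolding 2 unfolding 1 tensor_mult_add tensor_mult_diff tensor_mult_pure w0 w1 w2 by simp
qed

section \<open>A star product defined on all series\<close>

text \<open>Derivatives are taken in the ambient space, so openness of \<open>S\<close> is what makes them depend
  on the values in \<open>S\<close> only.\<close>

lemma Ck_on_cong:
  assumes "open S" "\<And>x. x \<in> S \<Longrightarrow> f x = g x" "Ck_on n S f"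
  shows "Ck_on n S g"
  using assms(2,3)
proof (induction n arbitrary: f g)
  case 0
  then show ?case using continuous_on_cong[of S S f g] by simp
next
  case (Suc n)
  have transfer: "(g has_derivative frechet_derivative f (at x)) (at x)" if "x \<in> S" for x
  proof (rule has_derivative_transform_within_open[OF _ assms(1) that Suc.prems(1)])
    show "(f has_derivative frechet_derivative f (at x)) (at x)"
      using Suc.prems(2) that by (simp add: frechet_derivative_works[symmetric])
  qed
  have "Ck_on n S (\<lambda>x. frechet_derivative g (at x) v)" for v
  proof (rule Suc.IH)
    show "Ck_on n S (\<lambda>x. frechet_derivative f (at x) v)" using Suc.prems(2) by simp
  next
    fix x assume "x \<in> S"
    then show "frechet_derivative f (at x) v = frechet_derivative g (at x) v"
      using frechet_derivative_at[OF transfer] by simp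
  qed
  then show ?case using transfer by (auto simp: differentiable_def)
qed

lemma Ck_on_linear_combination:
  fixes f g :: "'e::real_normed_vector \<Rightarrow> 'k::real_normed_field"
  assumes "open S" "Ck_on n S f" "Ck_on n S g"
  shows "Ck_on n S (\<lambda>x. c * f x + g x)"
  using assms(2,3)
proof (induction n arbitrary: f g)
  case 0
  then show ?case by (auto intro!: continuous_intros)
next
  case (Suc n)
  have D: "((\<lambda>x. c * f x + g x) has_derivative
      (\<lambda>v. c * frechet_derivative f (at x) v + frechet_derivative g (at x) v)) (at x)" if "x \<in> S" for x
    using Suc.prems that
    by (auto intro!: has_derivative_add has_derivative_mult_right simp: frechet_derivative_works[symmetric])
  have "Ck_on n S (\<lambda>x. frechet_derivative (\<lambda>x. c * f x + g x) (at x) v)" for v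
  proof (rule Ck_on_cong[OF assms(1)])
    show "Ck_on n S (\<lambda>x. c * frechet_derivative f (at x) v + frechet_derivative g (at x) v)"
      using Suc by simp
  next
    fix x assume "x \<in> S"
    then show "c * frechet_derivative f (at x) v + frechet_derivative g (at x) v
        = frechet_derivative (\<lambda>x. c * f x + g x) (at x) v"
      using fun_cong[OF frechet_derivative_at[OF D], of x v] by simp
  qed
  then show ?case using D by (auto simp: differentiable_def)
qed

lemma Ck_on_const: "Ck_on n S (\<lambda>_. c)"
proof (induction n arbitrary: c)
  case (Suc n)
  then show ?case by (simp add: frechet_derivative_const)
qed simp

lemma cinf_linear_combination:
  fixes f g :: "'m::{t2_space,second_countable_topology} \<Rightarrow> 'k::real_normed_field"
  assumes "smooth_atlas A" "f \<in> cinf A" "g \<in> cinf A"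
  shows "(\<lambda>p. c * f p + g p) \<in> cinf A"
proof -
  have "smooth_on (\<phi> ` U) ((\<lambda>p. c * f p + g p) \<circ> inv_into U \<phi>)" if "(U, \<phi>) \<in> A" for U \<phi>
  proof -
    have "open (\<phi> ` U)" using assms(1) that by (auto simp: smooth_atlas_def)
    moreover have "smooth_on (\<phi> ` U) (f \<circ> inv_into U \<phi>)" "smooth_on (\<phi> ` U) (g \<circ> inv_into U \<phi>)"
      using assms(2,3) that by (auto simp: cinf_def)
    ultimately show ?thesis by (simp add: smooth_on_def comp_def Ck_on_linear_combination)
  qed
  then show ?thesis by (auto simp: cinf_def)
qed

lemma cinf_const: "(\<lambda>_. c) \<in> cinf A"
  by (auto simp: cinf_def smooth_on_def comp_def Ck_on_const)

lemma cinf_closed: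
  fixes f g :: "'m::{t2_space,second_countable_topology} \<Rightarrow> 'k::real_normed_field"
  assumes "smooth_atlas A"
  shows "0 \<in> cinf A"
    and "f \<in> cinf A \<Longrightarrow> g \<in> cinf A \<Longrightarrow> f + g \<in> cinf A"
    and "f \<in> cinf A \<Longrightarrow> g \<in> cinf A \<Longrightarrow> f - g \<in> cinf A"
    and "f \<in> cinf A \<Longrightarrow> (\<lambda>p. c * f p) \<in> cinf A"
  using cinf_const[of 0 A] cinf_linear_combination[OF assms, of f g 1]
    cinf_linear_combination[OF assms, of g f "-1"]
    cinf_linear_combination[OF assms _ cinf_const[of 0], of f c]
  by (simp_all add: zero_fun_def plus_fun_def fun_diff_def add.commute)

lemma function_vector_space:
  "vector_space (\<lambda>(c::'k::field) (f::'m \<Rightarrow> 'k) p. c * f p)"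
  by unfold_locales (auto simp: fun_eq_iff algebra_simps)

text \<open>A complement of a linear subspace, from the existence of bases.\<close>

lemma projection_onto_cinf:
  fixes A :: "('m::{t2_space,second_countable_topology}, 'e::real_normed_vector) atlas"
  assumes "smooth_atlas A"
  obtains \<pi> :: "('m \<Rightarrow> 'k::real_normed_field) \<Rightarrow> ('m \<Rightarrow> 'k)"
    where "\<And>f. \<pi> f \<in> cinf A" "\<And>f. f \<in> cinf A \<Longrightarrow> \<pi> f = f"
      "\<And>f g. \<pi> (f + g) = \<pi> f + \<pi> g" "\<And>c f. \<pi> (\<lambda>p. c * f p) = (\<lambda>p. c * \<pi> f p)"
proof -
  let ?s = "\<lambda>(c::'k) (f::'m \<Rightarrow> 'k) p. c * f p"
  interpret vector_space ?s by (rule function_vector_space)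
  interpret pair: vector_space_pair ?s ?s by unfold_locales
  have "subspace (cinf A)"
    using cinf_closed[OF assms] unfolding subspace_def by blast
  moreover have "Vector_Spaces.linear ?s ?s (\<lambda>f. f)"
    by unfold_locales (auto simp: plus_fun_def fun_eq_iff algebra_simps)
  ultimately obtain \<pi> where \<pi>: "range \<pi> \<subseteq> cinf A" "Vector_Spaces.linear ?s ?s \<pi>"
      "\<forall>f\<in>cinf A. \<pi> f = f"
    using pair.linear_exists_left_inverse_on[of "\<lambda>f. f" "cinf A"] by auto
  interpret \<pi>: Vector_Spaces.linear ?s ?s \<pi> by fact
  show ?thesis
    by (rule that[of \<pi>]) (use \<pi> in \<open>auto simp: \<pi>.add \<pi>.scale\<close>)
qed

definition scalar_const :: "'k::real_normed_field \<Rightarrow> ('m \<Rightarrow> 'k) fps" where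
  "scalar_const c = fps_const (\<lambda>_. c)"

lemma scalar_const_nth: "fps_nth (scalar_const c * F) n = (\<lambda>p. c * fps_nth F n p)"
  by (simp add: scalar_const_def fun_eq_iff)

lemma real_const_scalar: "real_const r = scalar_const (of_real r)"
  by (simp add: real_const_def scalar_const_def)

text \<open>A star product extended to all series, smooth or not. Associativity and bilinearity are total; the
  unit law is asserted for smooth series, since all products are smooth.\<close>

locale formal_star =
  fixes A :: "('m::{t2_space,second_countable_topology}, 'e::real_normed_vector) atlas"
    and st :: "('m \<Rightarrow> 'k::real_normed_field) fps \<Rightarrow> ('m \<Rightarrow> 'k) fps \<Rightarrow> ('m \<Rightarrow> 'k) fps"
  assumes atlas: "smooth_atlas A"
    and add_left: "st (F + G) H = st F H + st G H"
    and add_right: "st H (F + G) = st H F + st H G"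
    and scalar_left: "st (scalar_const c * F) H = scalar_const c * st F H"
    and scalar_right: "st H (scalar_const c * F) = scalar_const c * st H F"
    and nu_left: "st (fps_X * F) H = fps_X * st F H"
    and nu_right: "st H (fps_X * F) = fps_X * st H F"
    and assoc: "st (st F G) H = st F (st G H)"
    and commute_mod_nu: "fps_nth (st F H) 0 = fps_nth (st H F) 0"
    and smooth: "st F H \<in> cinf_fps A"
    and unit: "F \<in> cinf_fps A \<Longrightarrow> st 1 F = F" "F \<in> cinf_fps A \<Longrightarrow> st F 1 = F"

lemma star_nu:
  fixes \<mu> :: "nat \<Rightarrow> ('m \<Rightarrow> 'k) \<Rightarrow> ('m \<Rightarrow> 'k) \<Rightarrow> ('m \<Rightarrow> 'k::real_normed_field)"
  assumes "\<And>i f. \<mu> i 0 f = 0" "\<And>i f. \<mu> i f 0 = 0"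
  shows "star \<mu> (fps_X * F) H = fps_X * star \<mu> F H" "star \<mu> F (fps_X * H) = fps_X * star \<mu> F H"
proof -
  have *: "fps_nth (star \<mu> (fps_X * F) H) n = fps_nth (fps_X * star \<mu> F H) n
      \<and> fps_nth (star \<mu> F (fps_X * H)) n = fps_nth (fps_X * star \<mu> F H) n" for n
  proof (cases n)
    case 0
    then show ?thesis using assms by (simp add: star_def)
  next
    case (Suc m)
    have "(\<Sum>j\<le>n - i. \<mu> i (fps_nth (fps_X * F) j) (fps_nth H (n - i - j)))
        = (\<Sum>j\<le>m - i. \<mu> i (fps_nth F j) (fps_nth H (m - i - j)))"
      "(\<Sum>j\<le>n - i. \<mu> i (fps_nth F j) (fps_nth (fps_X * H) (n - i - j)))
        = (\<Sum>j\<le>m - i. \<mu> i (fps_nth F j) (fps_nth H (m - i - j)))" if "i \<le> m" for i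
    proof -
      have n: "n - i = Suc (m - i)" using Suc that by simp
      show "(\<Sum>j\<le>n - i. \<mu> i (fps_nth (fps_X * F) j) (fps_nth H (n - i - j)))
        = (\<Sum>j\<le>m - i. \<mu> i (fps_nth F j) (fps_nth H (m - i - j)))"
        unfolding n sum.atMost_Suc_shift using assms by simp
      show "(\<Sum>j\<le>n - i. \<mu> i (fps_nth F j) (fps_nth (fps_X * H) (n - i - j)))
        = (\<Sum>j\<le>m - i. \<mu> i (fps_nth F j) (fps_nth H (m - i - j)))"
        unfolding n sum.atMost_Suc using assms by (simp add: Suc_diff_le)
    qed
    then show ?thesis
      using assms by (simp add: star_def Suc)
  qed
  show "star \<mu> (fps_X * F) H = fps_X * star \<mu> F H" "star \<mu> F (fps_X * H) = fps_X * star \<mu> F H"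
    using * by (simp_all add: fps_eq_iff)
qed

lemma star_product_bilinear:
  fixes A :: "('m::{t2_space,second_countable_topology}, 'e::real_normed_vector) atlas"
    and \<mu> :: "nat \<Rightarrow> ('m \<Rightarrow> 'k) \<Rightarrow> ('m \<Rightarrow> 'k) \<Rightarrow> ('m \<Rightarrow> 'k::real_normed_field)"
  assumes atlas: "smooth_atlas A"
    and "star_product A \<omega> \<mu>" "f \<in> cinf A" "g \<in> cinf A" "h \<in> cinf A"
  shows "\<mu> i (f + g) h = \<mu> i f h + \<mu> i g h" "\<mu> i h (f + g) = \<mu> i h f + \<mu> i h g"
    "\<mu> i (\<lambda>p. c * f p) h = (\<lambda>p. c * \<mu> i f h p)" "\<mu> i h (\<lambda>p. c * f p) = (\<lambda>p. c * \<mu> i h f p)"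
proof -
  have "\<mu> i (\<lambda>p. f p + g p) h = (\<lambda>p. \<mu> i f h p + \<mu> i g h p) \<and>
      \<mu> i h (\<lambda>p. f p + g p) = (\<lambda>p. \<mu> i h f p + \<mu> i h g p) \<and>
      \<mu> i (\<lambda>p. c * f p) h = (\<lambda>p. c * \<mu> i f h p) \<and>
      \<mu> i h (\<lambda>p. c * f p) = (\<lambda>p. c * \<mu> i h f p)"
  proof (cases "i = 0")
    case True
    have mult: "\<mu> 0 u v = (\<lambda>p. u p * v p)" if "u \<in> cinf A" "v \<in> cinf A" for u v
      using assms(2) that by (simp add: star_product_def)
    have "(\<lambda>p. f p + g p) \<in> cinf A" "(\<lambda>p. c * f p) \<in> cinf A"
      using cinf_closed(2)[OF atlas assms(3,4)] cinf_closed(4)[OF atlas assms(3)]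
      by (simp_all add: plus_fun_def)
    with assms(3-5) show ?thesis
      unfolding True by (simp add: mult fun_eq_iff algebra_simps)
  next
    case False
    then have "bidifferential_operator A (\<mu> i)"
      using assms(2) by (simp add: star_product_def)
    then show ?thesis
      using assms(3-5) unfolding bidifferential_operator_def by blast
  qed
  then show "\<mu> i (f + g) h = \<mu> i f h + \<mu> i g h" "\<mu> i h (f + g) = \<mu> i h f + \<mu> i h g"
    "\<mu> i (\<lambda>p. c * f p) h = (\<lambda>p. c * \<mu> i f h p)" "\<mu> i h (\<lambda>p. c * f p) = (\<lambda>p. c * \<mu> i h f p)"
    by (simp_all add: plus_fun_def)
qed

text \<open>The coefficient maps of \<open>\<mu>\<close> are precomposed with a linear projection \<open>\<pi>\<close> onto the smooth functions.
  Products are smooth, so \<open>\<pi>\<close> fixes them and associativity carries over.\<close>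

lemma star_product_extends:
  fixes A :: "('m::{t2_space,second_countable_topology}, 'e::real_normed_vector) atlas"
    and \<mu> :: "nat \<Rightarrow> ('m \<Rightarrow> 'k) \<Rightarrow> ('m \<Rightarrow> 'k) \<Rightarrow> ('m \<Rightarrow> 'k::real_normed_field)"
  assumes atlas: "smooth_atlas A" and star: "star_product A \<omega> \<mu>"
  obtains st where "formal_star A st"
    "\<And>F H. F \<in> cinf_fps A \<Longrightarrow> H \<in> cinf_fps A \<Longrightarrow> st F H = star \<mu> F H"
proof -
  obtain \<pi> :: "('m \<Rightarrow> 'k) \<Rightarrow> ('m \<Rightarrow> 'k)" where \<pi>: "\<And>f. \<pi> f \<in> cinf A" "\<And>f. f \<in> cinf A \<Longrightarrow> \<pi> f = f"
      "\<And>f g. \<pi> (f + g) = \<pi> f + \<pi> g" "\<And>c f. \<pi> (\<lambda>p. c * f p) = (\<lambda>p. c * \<pi> f p)"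
    using projection_onto_cinf[OF atlas] by blast
  define m where "m i f g = \<mu> i (\<pi> f) (\<pi> g)" for i f g
  define P where "P F = Abs_fps (\<lambda>n. \<pi> (fps_nth F n))" for F :: "('m \<Rightarrow> 'k) fps"
  have P: "P F \<in> cinf_fps A" for F by (simp add: P_def cinf_fps_def \<pi>)
  have P_id: "P F = F" if "F \<in> cinf_fps A" for F
    using that by (simp add: P_def cinf_fps_def \<pi> fps_eq_iff)
  have star_P: "star m F H = star \<mu> (P F) (P H)" for F H
    by (simp add: star_def m_def P_def)
  have closed: "star \<mu> F H \<in> cinf_fps A" if "F \<in> cinf_fps A" "H \<in> cinf_fps A" for F H
    using star that by (simp add: star_product_def)
  have bilinear: "m i (f + g) h = m i f h + m i g h" "m i h (f + g) = m i h f + m i h g"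
    "m i (\<lambda>p. c * f p) h = (\<lambda>p. c * m i f h p)" "m i h (\<lambda>p. c * f p) = (\<lambda>p. c * m i h f p)"
    for i f g h c
    using star_product_bilinear[OF atlas star \<pi>(1) \<pi>(1) \<pi>(1)] by (simp_all add: m_def \<pi>)
  have zero: "m i 0 f = 0" "m i f 0 = 0" for i f
    using bilinear(3)[of i 0 0] bilinear(4)[of i _ 0 0] by (simp_all add: zero_fun_def)
  have "formal_star A st" if "st = star m" for st
    unfolding that
  proof
    fix F G H :: "('m \<Rightarrow> 'k) fps" and c
    show "star m (F + G) H = star m F H + star m G H"
      by (simp add: star_def fps_eq_iff bilinear sum.distrib)
    show "star m H (F + G) = star m H F + star m H G"
      by (simp add: star_def fps_eq_iff bilinear sum.distrib)
    have sum_fun: "(\<Sum>j\<in>J. (\<lambda>p. c * u j p)) = (\<lambda>p. c * (\<Sum>j\<in>J. u j) p)"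
      for u :: "nat \<Rightarrow> 'm \<Rightarrow> 'k" and J :: "nat set"
      by (induction J rule: infinite_finite_induct) (auto simp: fun_eq_iff distrib_left)
    show "star m (scalar_const c * F) H = scalar_const c * star m F H"
      by (simp add: star_def fps_eq_iff scalar_const_nth bilinear sum_fun)
    show "star m H (scalar_const c * F) = scalar_const c * star m H F"
      by (simp add: star_def fps_eq_iff scalar_const_nth bilinear sum_fun)
    show "star m (fps_X * F) H = fps_X * star m F H" "star m H (fps_X * F) = fps_X * star m H F"
      by (rule star_nu; rule zero)+
    show "star m (star m F G) H = star m F (star m G H)"
      unfolding star_P using star P closed by (simp add: P_id star_product_def)
    show "fps_nth (star m F H) 0 = fps_nth (star m H F) 0"
      using star \<pi> by (simp add: star_def m_def star_product_def mult.commute)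
    show "star m F H \<in> cinf_fps A"
      unfolding star_P by (intro closed P)
    have "(1 :: ('m \<Rightarrow> 'k) fps) \<in> cinf_fps A"
      using cinf_const[of 0 A] cinf_const[of 1 A]
      by (auto simp: cinf_fps_def zero_fun_def one_fun_def)
    from P_id[OF this] show "star m 1 F = F" "star m F 1 = F" if "F \<in> cinf_fps A"
      using star that by (simp_all add: star_P P_id star_product_def)
  qed (rule atlas)
  moreover have "star m F H = star \<mu> F H" if "F \<in> cinf_fps A" "H \<in> cinf_fps A" for F H
    using that by (simp add: star_P P_id)
  ultimately show ?thesis using that by blast
qed

section \<open>Operators on the ghost algebra\<close>

definition real_scale :: "real \<Rightarrow> ('m \<Rightarrow> 'k::real_normed_field) fps grassmann \<Rightarrow> ('m \<Rightarrow> 'k) fps grassmann" where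
  "real_scale r x = (\<lambda>S. real_const r * x S)"

lemma real_const_add: "real_const (r + s) = real_const r + real_const s"
  and real_const_mult: "real_const (r * s) = real_const r * real_const s"
  and real_const_one: "real_const 1 = 1"
  and real_const_zero: "real_const 0 = 0"
  by (auto simp: real_const_def fps_eq_iff fun_eq_iff)

lemma real_const_minus: "real_const (- r) = - real_const r"
  by (auto simp: real_const_def fps_eq_iff fun_eq_iff)

text \<open>The additive maps that commute with real constants, with composition as product. As a type
  of class \<^class>\<open>real_algebra_1\<close> it carries the operator identities of the first sections.\<close>

typedef (overloaded) ('m, 'k::real_normed_field) grassmann_op =
  "{T :: ('m \<Rightarrow> 'k) fps grassmann \<Rightarrow> ('m \<Rightarrow> 'k) fps grassmann.
     (\<forall>x y. T (x + y) = T x + T y) \<and> (\<forall>r x. T (real_scale r x) = real_scale r (T x))}"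
  morphisms apply_op Abs_op
  by (rule exI[of _ "\<lambda>x. x"]) simp

setup_lifting type_definition_grassmann_op

lemma apply_op_eqI: "(\<And>x S. apply_op T x S = apply_op U x S) \<Longrightarrow> T = U"
  by (metis apply_op_inject ext)

instantiation grassmann_op :: (type, real_normed_field) real_algebra_1
begin

lift_definition zero_grassmann_op :: "('a, 'b) grassmann_op" is "\<lambda>x. 0"
  by (simp add: real_scale_def fun_eq_iff)

lift_definition one_grassmann_op :: "('a, 'b) grassmann_op" is "\<lambda>x. x"
  by simp

lift_definition plus_grassmann_op :: "('a, 'b) grassmann_op \<Rightarrow> ('a, 'b) grassmann_op \<Rightarrow> ('a, 'b) grassmann_op"
  is "\<lambda>T U x. T x + U x"
  by (simp add: real_scale_def fun_eq_iff distrib_left)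

lift_definition minus_grassmann_op :: "('a, 'b) grassmann_op \<Rightarrow> ('a, 'b) grassmann_op \<Rightarrow> ('a, 'b) grassmann_op"
  is "\<lambda>T U x. T x - U x"
  by (simp add: real_scale_def fun_eq_iff right_diff_distrib)

lift_definition uminus_grassmann_op :: "('a, 'b) grassmann_op \<Rightarrow> ('a, 'b) grassmann_op"
  is "\<lambda>T x. - T x"
  by (simp add: real_scale_def fun_eq_iff)

lift_definition times_grassmann_op :: "('a, 'b) grassmann_op \<Rightarrow> ('a, 'b) grassmann_op \<Rightarrow> ('a, 'b) grassmann_op"
  is "\<lambda>T U x. T (U x)"
  by simp

lift_definition scaleR_grassmann_op :: "real \<Rightarrow> ('a, 'b) grassmann_op \<Rightarrow> ('a, 'b) grassmann_op"
  is "\<lambda>r T x. real_scale r (T x)"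
  by (simp add: real_scale_def fun_eq_iff distrib_left mult.left_commute)

instance
proof
  have "(\<lambda>S. 1) \<noteq> (0 :: ('a \<Rightarrow> 'b) fps grassmann)"
    by (simp add: fun_eq_iff)
  then show "(0 :: ('a, 'b) grassmann_op) \<noteq> 1"
    by transfer metis
qed (transfer, force simp: fun_eq_iff real_scale_def algebra_simps real_const_add real_const_mult
    real_const_one)+

end

lemma apply_op_simps:
  "apply_op 0 x S = 0" "apply_op 1 x = x"
  "apply_op (T + U) x S = apply_op T x S + apply_op U x S"
  "apply_op (T - U) x S = apply_op T x S - apply_op U x S"
  "apply_op (- T) x S = - apply_op T x S"
  "apply_op (T * U) x = apply_op T (apply_op U x)"
  "apply_op (r *\<^sub>R T) x S = real_const r * apply_op T x S"
  by (transfer; simp add: real_scale_def)+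

lemma apply_op_sum: "apply_op (\<Sum>a\<in>I. T a) x S = (\<Sum>a\<in>I. apply_op (T a) x S)"
  by (induction I rule: infinite_finite_induct) (simp_all add: apply_op_simps)

lift_definition gen_op :: "nat \<Rightarrow> ('m, 'k::real_normed_field) grassmann_op" is gen_mult
  by (simp add: gen_mult_add) (simp add: gen_mult_def real_scale_def fun_eq_iff mult.left_commute)

lift_definition deriv_op :: "nat \<Rightarrow> ('m, 'k::real_normed_field) grassmann_op" is left_deriv
  by (simp add: left_deriv_add) (simp add: left_deriv_order_sign real_scale_def fun_eq_iff mult.left_commute)

definition coefficient_map :: "(('m \<Rightarrow> 'k::real_normed_field) fps \<Rightarrow> ('m \<Rightarrow> 'k) fps) \<Rightarrow> bool" where
  "coefficient_map \<phi> \<longleftrightarrow> (\<forall>F G. \<phi> (F + G) = \<phi> F + \<phi> G) \<and> (\<forall>r F. \<phi> (real_const r * F) = real_const r * \<phi> F)"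

text \<open>Zero is a default value for \<open>\<phi>\<close> that are not additive and real homogeneous and hence define no operator.\<close>

lift_definition coefficient_op ::
    "(('m \<Rightarrow> 'k) fps \<Rightarrow> ('m \<Rightarrow> 'k) fps) \<Rightarrow> ('m, 'k::real_normed_field) grassmann_op"
  is "\<lambda>\<phi> x. if coefficient_map \<phi> then (\<lambda>S. \<phi> (x S)) else 0"
  by (auto simp: coefficient_map_def real_scale_def fun_eq_iff)

lemma apply_coefficient_op: "coefficient_map \<phi> \<Longrightarrow> apply_op (coefficient_op \<phi>) x S = \<phi> (x S)"
  by transfer simp

lemma fermions_gen_deriv:
  assumes "inj g"
  shows "fermions (\<lambda>a. gen_op (g a)) (\<lambda>a. deriv_op (g a) :: ('m, 'k::real_normed_field) grassmann_op)"
proof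
  fix a b
  show "gen_op (g a) * gen_op (g b) = - (gen_op (g b) * gen_op (g a) :: ('m, 'k) grassmann_op)"
    by (rule apply_op_eqI) (simp add: apply_op_simps gen_op.rep_eq gen_mult_anticommute[of "g a"])
  show "deriv_op (g a) * deriv_op (g b) = - (deriv_op (g b) * deriv_op (g a) :: ('m, 'k) grassmann_op)"
    by (rule apply_op_eqI) (simp add: apply_op_simps deriv_op.rep_eq left_deriv_anticommute[of "g a"])
  show "deriv_op (g a) * gen_op (g b)
      = (if a = b then 1 else 0) - (gen_op (g b) * deriv_op (g a) :: ('m, 'k) grassmann_op)"
    using assms by (intro apply_op_eqI)
      (simp add: apply_op_simps deriv_op.rep_eq gen_op.rep_eq left_deriv_gen_mult inj_eq)
qed

lemma gen_deriv_anticommute: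
  assumes "i \<noteq> j"
  shows "gen_op i * gen_op j = - (gen_op j * gen_op i :: ('m, 'k::real_normed_field) grassmann_op)"
    "deriv_op i * deriv_op j = - (deriv_op j * deriv_op i :: ('m, 'k) grassmann_op)"
    "gen_op i * deriv_op j = - (deriv_op j * gen_op i :: ('m, 'k) grassmann_op)"
    "deriv_op i * gen_op j = - (gen_op j * deriv_op i :: ('m, 'k) grassmann_op)"
proof -
  interpret fermions gen_op "deriv_op :: nat \<Rightarrow> ('m, 'k) grassmann_op"
    using fermions_gen_deriv[of "\<lambda>i. i"] by simp
  show "gen_op i * gen_op j = - (gen_op j * gen_op i :: ('m, 'k) grassmann_op)" by (rule XX)
  show "deriv_op i * deriv_op j = - (deriv_op j * deriv_op i :: ('m, 'k) grassmann_op)" by (rule PP)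
  show "gen_op i * deriv_op j = - (deriv_op j * gen_op i :: ('m, 'k) grassmann_op)"
    "deriv_op i * gen_op j = - (gen_op j * deriv_op i :: ('m, 'k) grassmann_op)"
    using PX[of j i] PX[of i j] assms by simp_all
qed

lemma order_sign_cases: "order_sign i U = (1 :: 'c::comm_ring_1) \<or> order_sign i U = (- 1 :: 'c)"
  by (cases "even (card {s\<in>U. s < i})") (simp_all add: order_sign_def)

lemma coefficient_map_zero:
  fixes \<phi> :: "('m \<Rightarrow> 'k::real_normed_field) fps \<Rightarrow> ('m \<Rightarrow> 'k) fps"
  assumes "coefficient_map \<phi>"
  shows "\<phi> 0 = 0" "\<phi> (- F) = - \<phi> F" "\<phi> (order_sign i U * F) = order_sign i U * \<phi> F"
proof -
  show z: "\<phi> 0 = 0" using assms unfolding coefficient_map_def by (metis add_cancel_right_left)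
  have "\<phi> F + \<phi> (- F) = \<phi> (F + - F)" using assms by (simp only: coefficient_map_def)
  then show m: "\<phi> (- F) = - \<phi> F" by (simp add: z eq_neg_iff_add_eq_0 add.commute)
  show "\<phi> (order_sign i U * F) = order_sign i U * \<phi> F"
    using order_sign_cases[of i U, where 'c="('m \<Rightarrow> 'k) fps"] m by auto
qed

text \<open>The elementary operators permute coefficients up to signs, and additive maps respect signs.\<close>

lemma coefficient_op_commutes:
  assumes "coefficient_map \<phi>"
  shows "coefficient_op \<phi> * gen_op i = gen_op i * coefficient_op \<phi>"
    "coefficient_op \<phi> * deriv_op i = deriv_op i * coefficient_op \<phi>"
  by (auto intro!: apply_op_eqI simp: apply_op_simps apply_coefficient_op gen_op.rep_eq deriv_op.rep_eq
      gen_mult_def left_deriv_order_sign coefficient_map_zero assms)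

lemma nu_div_shift:
  assumes "fps_nth F 0 = 0"
  shows "fps_X * nu_div F = F" "nu_div F = fps_shift 1 F"
proof -
  have *: "fps_X * fps_shift 1 F = F"
    using assms by (simp add: fps_eq_iff)
  moreover have "H = fps_shift 1 F" if "fps_X * H = F" for H
  proof (rule fps_ext)
    fix n
    have "fps_nth F (Suc n) = fps_nth (fps_X * H) (Suc n)" using that by simp
    then show "fps_nth H n = fps_nth (fps_shift 1 F) n" by simp
  qed
  ultimately show "nu_div F = fps_shift 1 F"
    unfolding nu_div_def by (intro the_equality)
  with * show "fps_X * nu_div F = F" by simp
qed

text \<open>The identities for \<open>nu_div\<close> are proved after multiplication by powers of \<open>\<nu>\<close>.\<close>

lemma nu_cancel: "fps_X * F = fps_X * G \<Longrightarrow> F = (G :: ('m \<Rightarrow> 'k::real_normed_field) fps)"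
  unfolding fps_eq_iff by (metis fps_X_mult_nth add_diff_cancel_left' nat.simps(3) plus_1_eq_Suc)

text \<open>The components \<open>J\<^sub>a\<close> of a quantum moment map, detached from the group action and the symplectic form.\<close>

locale quantum_symmetry = formal_star A st + lie_constants l f
  for A :: "('m::{t2_space,second_countable_topology}, 'e::real_normed_vector) atlas"
    and st :: "('m \<Rightarrow> 'k::real_normed_field) fps \<Rightarrow> ('m \<Rightarrow> 'k) fps \<Rightarrow> ('m \<Rightarrow> 'k) fps"
    and l f +
  fixes J :: "nat \<Rightarrow> ('m \<Rightarrow> 'k) fps"
  assumes J_smooth: "a < l \<Longrightarrow> J a \<in> cinf_fps A"
    and J_commutator: "\<lbrakk>a < l; b < l\<rbrakk> \<Longrightarrow>
      st (J a) (J b) - st (J b) (J a) = fps_X * (\<Sum>c<l. real_const (f a b c) * J c)"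
begin

lemma st_minus_left: "st (- F) G = - st F G"
  and st_minus_right: "st F (- G) = - st F G"
  and st_zero_left: "st 0 G = 0"
  and st_zero_right: "st F 0 = 0"
proof -
  have 0: "st 0 G = 0" "st F 0 = 0" for F G
    using add_left[of 0 0 G] add_right[of F 0 0] by simp_all
  show "st (- F) G = - st F G" using add_left[of F "- F" G] 0 by (simp add: eq_neg_iff_add_eq_0 add.commute)
  show "st F (- G) = - st F G" using add_right[of F G "- G"] 0 by (simp add: eq_neg_iff_add_eq_0 add.commute)
  show "st 0 G = 0" "st F 0 = 0" by (fact 0)+
qed

lemma st_diff_left: "st (F - G) H = st F H - st G H"
  and st_diff_right: "st H (F - G) = st H F - st H G"
  using add_left[of F "- G" H] add_right[of H F "- G"]
  by (simp_all add: st_minus_left st_minus_right)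

lemma st_sum_left: "st (\<Sum>a\<in>I. u a) H = (\<Sum>a\<in>I. st (u a) H)"
  and st_sum_right: "st H (\<Sum>a\<in>I. u a) = (\<Sum>a\<in>I. st H (u a))"
  by (induction I rule: infinite_finite_induct)
    (simp_all add: add_left add_right st_zero_left st_zero_right)

lemmas st_simps = add_left add_right st_diff_left st_diff_right st_sum_left st_sum_right
  nu_left nu_right scalar_left scalar_right st_minus_left st_minus_right real_const_scalar

definition commutator :: "('m \<Rightarrow> 'k) fps \<Rightarrow> ('m \<Rightarrow> 'k) fps \<Rightarrow> ('m \<Rightarrow> 'k) fps" where
  "commutator F G = st F G - st G F"

definition inner_deriv :: "nat \<Rightarrow> ('m \<Rightarrow> 'k) fps \<Rightarrow> ('m \<Rightarrow> 'k) fps" where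
  "inner_deriv a F = nu_div (commutator (J a) F)"

definition right_mult :: "nat \<Rightarrow> ('m \<Rightarrow> 'k) fps \<Rightarrow> ('m \<Rightarrow> 'k) fps" where
  "right_mult a F = st F (J a)"

lemma nu_inner_deriv: "fps_X * inner_deriv a F = commutator (J a) F"
  and inner_deriv_shift: "inner_deriv a F = fps_shift 1 (commutator (J a) F)"
proof -
  have "fps_nth (commutator (J a) F) 0 = 0"
    by (simp add: commutator_def commute_mod_nu[of "J a" F])
  then show "fps_X * inner_deriv a F = commutator (J a) F"
    "inner_deriv a F = fps_shift 1 (commutator (J a) F)"
    unfolding inner_deriv_def by (rule nu_div_shift)+
qed

lemma commutator_nu: "commutator F (fps_X * G) = fps_X * commutator F G"
  by (simp add: commutator_def nu_left nu_right right_diff_distrib)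

lemma inner_deriv_nu: "inner_deriv a (fps_X * F) = fps_X * inner_deriv a F"
  by (rule nu_cancel) (simp only: nu_inner_deriv commutator_nu)

lemma coefficient_maps: "coefficient_map (inner_deriv a)" "coefficient_map (right_mult a)"
  "coefficient_map ((*) fps_X)"
proof -
  have "inner_deriv a (F + G) = inner_deriv a F + inner_deriv a G" for F G
    by (rule nu_cancel) (simp add: distrib_left nu_inner_deriv commutator_def st_simps)
  moreover have "inner_deriv a (real_const r * F) = real_const r * inner_deriv a F" for r F
    by (rule nu_cancel)
      (simp add: mult.left_commute[of fps_X] nu_inner_deriv commutator_def st_simps right_diff_distrib)
  ultimately show "coefficient_map (inner_deriv a)" by (simp add: coefficient_map_def)
  show "coefficient_map (right_mult a)" by (simp add: coefficient_map_def right_mult_def st_simps)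
  show "coefficient_map ((*) fps_X)" by (simp add: coefficient_map_def distrib_left mult.left_commute)
qed

lemma J_commutator_left:
  assumes "a < l" "b < l"
  shows "st (J a) (st (J b) F) - st (J b) (st (J a) F) = fps_X * (\<Sum>c<l. real_const (f a b c) * st (J c) F)"
proof -
  have "st (st (J a) (J b) - st (J b) (J a)) F = fps_X * (\<Sum>c<l. real_const (f a b c) * st (J c) F)"
    unfolding J_commutator[OF assms] by (simp add: st_simps)
  then show ?thesis by (simp add: st_diff_left assoc)
qed

lemma J_commutator_right:
  assumes "a < l" "b < l"
  shows "st F (st (J a) (J b)) - st F (st (J b) (J a)) = fps_X * (\<Sum>c<l. real_const (f a b c) * st F (J c))"
  unfolding st_diff_right[symmetric] J_commutator[OF assms] by (simp add: st_simps)

text \<open>Multiplied by \<open>\<nu>\<^sup>2\<close> this is \<open>[J\<^sub>a, [J\<^sub>b, F]] - [J\<^sub>b, [J\<^sub>a, F]] = [[J\<^sub>a, J\<^sub>b], F]\<close>, and \<open>[J\<^sub>a, J\<^sub>b]\<close> supplies one factor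
  \<open>\<nu>\<close>.\<close>

lemma inner_deriv_commutator:
  assumes "a < l" "b < l"
  shows "inner_deriv a (inner_deriv b F) - inner_deriv b (inner_deriv a F) = (\<Sum>c<l. real_const (f a b c) * inner_deriv c F)"
proof (rule nu_cancel, rule nu_cancel)
  have nu2: "fps_X * (fps_X * inner_deriv a (inner_deriv b F)) = commutator (J a) (commutator (J b) F)" for a b
    by (simp only: nu_inner_deriv commutator_nu[symmetric])
  have "fps_X * (fps_X * (inner_deriv a (inner_deriv b F) - inner_deriv b (inner_deriv a F)))
      = (st (J a) (st (J b) F) - st (J b) (st (J a) F)) - (st F (st (J a) (J b)) - st F (st (J b) (J a)))"
    by (simp add: right_diff_distrib nu2) (simp add: commutator_def st_diff_left st_diff_right assoc)
  also have "\<dots> = fps_X * (\<Sum>c<l. real_const (f a b c) * commutator (J c) F)"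
    unfolding J_commutator_left[OF assms] J_commutator_right[OF assms]
    by (simp add: commutator_def right_diff_distrib sum_subtractf)
  also have "\<dots> = fps_X * (fps_X * (\<Sum>c<l. real_const (f a b c) * inner_deriv c F))"
    by (simp add: nu_inner_deriv[symmetric] sum_distrib_left mult.left_commute[of "real_const _" fps_X])
  finally show "fps_X * (fps_X * (inner_deriv a (inner_deriv b F) - inner_deriv b (inner_deriv a F)))
      = fps_X * (fps_X * (\<Sum>c<l. real_const (f a b c) * inner_deriv c F))" .
qed

lemma right_mult_commutator:
  assumes "a < l" "b < l"
  shows "right_mult a (right_mult b F) - right_mult b (right_mult a F)
    = - (fps_X * (\<Sum>c<l. real_const (f a b c) * right_mult c F))"
  unfolding right_mult_def J_commutator_right[OF assms, symmetric] by (simp add: assoc)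

lemma right_mult_nu: "right_mult a (fps_X * F) = fps_X * right_mult a F"
  by (simp add: right_mult_def nu_left)

text \<open>\<open>[J\<^sub>a, F \<star> J\<^sub>b] - [J\<^sub>a, F] \<star> J\<^sub>b = F \<star> [J\<^sub>a, J\<^sub>b]\<close> by the Leibniz rule of a commutator.\<close>

lemma inner_deriv_right_mult:
  assumes "a < l" "b < l"
  shows "inner_deriv a (right_mult b F) - right_mult b (inner_deriv a F) = (\<Sum>c<l. real_const (f a b c) * right_mult c F)"
proof (rule nu_cancel)
  have "fps_X * (inner_deriv a (right_mult b F) - right_mult b (inner_deriv a F))
      = commutator (J a) (st F (J b)) - st (commutator (J a) F) (J b)"
    by (simp add: right_diff_distrib nu_inner_deriv right_mult_def nu_left[symmetric])
  also have "\<dots> = st F (st (J a) (J b)) - st F (st (J b) (J a))"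
    by (simp add: commutator_def st_diff_left assoc)
  finally show "fps_X * (inner_deriv a (right_mult b F) - right_mult b (inner_deriv a F))
      = fps_X * (\<Sum>c<l. real_const (f a b c) * right_mult c F)"
    unfolding J_commutator_right[OF assms] right_mult_def .
qed

sublocale brst_operators l f "\<lambda>a. gen_op (ghost a)" "\<lambda>a. deriv_op (ghost a)"
  "\<lambda>a. gen_op (antighost a)" "\<lambda>a. deriv_op (antighost a)"
  "\<lambda>a. coefficient_op (inner_deriv a)" "\<lambda>a. coefficient_op (right_mult a)" "coefficient_op ((*) fps_X)"
proof -
  have inj: "inj ghost" "inj antighost" by (simp_all add: inj_def)
  interpret X: fermions "\<lambda>a. gen_op (ghost a)" "\<lambda>a. deriv_op (ghost a) :: ('m, 'k) grassmann_op"
    by (rule fermions_gen_deriv) (rule inj)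
  interpret Y: fermions "\<lambda>a. gen_op (antighost a)" "\<lambda>a. deriv_op (antighost a) :: ('m, 'k) grassmann_op"
    by (rule fermions_gen_deriv) (rule inj)
  show "brst_operators l f (\<lambda>a. gen_op (ghost a)) (\<lambda>a. deriv_op (ghost a) :: ('m, 'k) grassmann_op)
    (\<lambda>a. gen_op (antighost a)) (\<lambda>a. deriv_op (antighost a))
    (\<lambda>a. coefficient_op (inner_deriv a)) (\<lambda>a. coefficient_op (right_mult a)) (coefficient_op ((*) fps_X))"
    by unfold_locales
      ((rule gen_deriv_anticommute, simp; fail)
      | (rule coefficient_op_commutes, rule coefficient_maps)
      | (rule apply_op_eqI, simp add: apply_op_simps apply_op_sum apply_coefficient_op coefficient_maps
          inner_deriv_nu inner_deriv_commutator right_mult_commutator inner_deriv_right_mult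
          right_mult_nu; fail))+
qed

end

section \<open>The BRST operators as elements of the operator algebra\<close>

lemma wedge_generator_fin: "fin_supp x \<Longrightarrow> wedge (generator i) x = gen_mult i x"
  by (simp add: generator_gen_mult wedge_gen_mult wedge_unit_fin)

lemma ghost_less: "ghost a < 2 * l \<longleftrightarrow> a < l"
  and antighost_less: "antighost a < 2 * l \<longleftrightarrow> a < l"
  unfolding ghost_def antighost_def by linarith+

context quantum_symmetry
begin

lemma cinf_fps_closed:
  fixes F H :: "('m \<Rightarrow> 'k) fps"
  shows "(0 :: ('m \<Rightarrow> 'k) fps) \<in> cinf_fps A"
    and "F \<in> cinf_fps A \<Longrightarrow> H \<in> cinf_fps A \<Longrightarrow> F + H \<in> cinf_fps A"
    and "F \<in> cinf_fps A \<Longrightarrow> H \<in> cinf_fps A \<Longrightarrow> F - H \<in> cinf_fps A"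
    and "F \<in> cinf_fps A \<Longrightarrow> scalar_const c * F \<in> cinf_fps A"
    and "F \<in> cinf_fps A \<Longrightarrow> fps_X * F \<in> cinf_fps A"
    and "F \<in> cinf_fps A \<Longrightarrow> fps_shift n F \<in> cinf_fps A"
    and "F \<in> cinf_fps A \<Longrightarrow> order_sign i U * F \<in> cinf_fps A"
proof -
  show *: "(0 :: ('m \<Rightarrow> 'k) fps) \<in> cinf_fps A"
    using cinf_closed(1)[OF atlas] by (simp add: cinf_fps_def)
  show diff: "F - H \<in> cinf_fps A" if "F \<in> cinf_fps A" "H \<in> cinf_fps A" for F H :: "('m \<Rightarrow> 'k) fps"
    using that by (auto simp: cinf_fps_def intro!: cinf_closed(3)[OF atlas])
  show "F + H \<in> cinf_fps A" if "F \<in> cinf_fps A" "H \<in> cinf_fps A"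
    using that by (auto simp: cinf_fps_def intro!: cinf_closed(2)[OF atlas])
  show "scalar_const c * F \<in> cinf_fps A" if "F \<in> cinf_fps A"
    using that by (auto simp: cinf_fps_def scalar_const_nth intro!: cinf_closed(4)[OF atlas])
  show "fps_X * F \<in> cinf_fps A" if "F \<in> cinf_fps A"
    using that by (auto simp: cinf_fps_def intro!: cinf_closed(1)[OF atlas])
  show "fps_shift n F \<in> cinf_fps A" if "F \<in> cinf_fps A"
    using that by (simp add: cinf_fps_def)
  show "order_sign i U * F \<in> cinf_fps A" if "F \<in> cinf_fps A"
    using order_sign_cases[of i U, where 'c="('m \<Rightarrow> 'k) fps"] that diff[OF * that] by auto
qed

text \<open>The BRST operators agree with the total operators on \<open>\<A>[[\<nu>]]\<close> only, so iterating them requires that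
  this space is invariant.\<close>

definition preserves :: "('m, 'k) grassmann_op \<Rightarrow> bool" where
  "preserves T \<longleftrightarrow> (\<forall>x\<in>ghost_algebra A l. apply_op T x \<in> ghost_algebra A l)"

lemma preserves_simple:
  shows preserves_zero: "preserves 0"
    and preserves_add: "preserves T \<Longrightarrow> preserves U \<Longrightarrow> preserves (T + U)"
    and preserves_mult: "preserves T \<Longrightarrow> preserves U \<Longrightarrow> preserves (T * U)"
    and preserves_scale: "preserves T \<Longrightarrow> preserves (r *\<^sub>R T)"
  by (auto simp: preserves_def ghost_algebra_def apply_op_simps cinf_fps_closed real_const_scalar)

lemma preserves_sum: "(\<And>a. a \<in> I \<Longrightarrow> preserves (T a)) \<Longrightarrow> preserves (\<Sum>a\<in>I. T a)"
  by (induction I rule: infinite_finite_induct) (auto intro: preserves_simple)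

lemma preserves_gen:
  assumes "i < 2 * l"
  shows "preserves (gen_op i)"
proof -
  have "\<not> S - {i} \<subseteq> {..<2 * l}" if "\<not> S \<subseteq> {..<2 * l}" for S
    using assms that by auto
  then show ?thesis
    by (simp add: preserves_def ghost_algebra_def gen_op.rep_eq gen_mult_def cinf_fps_closed)
qed

lemma preserves_deriv: "preserves (deriv_op i)"
  by (auto simp: preserves_def ghost_algebra_def deriv_op.rep_eq left_deriv_order_sign cinf_fps_closed)

lemma preserves_coefficient:
  assumes "coefficient_map \<phi>" "\<And>F. F \<in> cinf_fps A \<Longrightarrow> \<phi> F \<in> cinf_fps A"
  shows "preserves (coefficient_op \<phi>)"
  using assms by (auto simp: preserves_def ghost_algebra_def apply_coefficient_op coefficient_map_zero)

lemma inner_deriv_smooth: "inner_deriv a F \<in> cinf_fps A"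
  by (simp add: inner_deriv_shift commutator_def cinf_fps_closed smooth)

lemmas preserves_rules = preserves_simple preserves_sum preserves_deriv preserves_gen
  preserves_coefficient coefficient_maps

lemma preserves_delta: "preserves delta"
  unfolding delta_expand
  by (intro preserves_rules) (simp_all add: ghost_less antighost_less inner_deriv_smooth)

lemma preserves_bd: "preserves bd"
  unfolding bd_expand
  by (intro preserves_rules) (simp_all add: antighost_less right_mult_def smooth cinf_fps_closed)

lemma ghost_algebra_fin_supp: "x \<in> ghost_algebra A l \<Longrightarrow> fin_supp x"
  by (auto simp: ghost_algebra_def fin_supp_def) (metis finite_lessThan finite_subset)

text \<open>The definition of \<open>\<delta>\<close> is the expansion of \<open>delta\<close>, once wedge products with generators are
  replaced by \<open>gen_mult\<close> and \<open>\<star>\<close> by its extension.\<close>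

lemma brst_delta_apply:
  assumes star: "\<And>F H. F \<in> cinf_fps A \<Longrightarrow> H \<in> cinf_fps A \<Longrightarrow> star \<mu> F H = st F H"
    and x: "x \<in> ghost_algebra A l"
  shows "brst_delta \<mu> l f J x = apply_op delta x"
proof
  fix S
  have fin: "fin_supp x" using x by (rule ghost_algebra_fin_supp)
  have "fin_supp (apply_op (coefficient_op \<phi>) x)" if "coefficient_map \<phi>" for \<phi> :: "('m \<Rightarrow> 'k) fps \<Rightarrow> _"
    using fin that by (simp add: fin_supp_def apply_coefficient_op coefficient_map_zero)
  note fin' = this[OF coefficient_maps(1)]
  have "(\<lambda>T. nu_div (star_commutator \<mu> (J a) (x T))) = apply_op (coefficient_op (inner_deriv a)) x"
    if "a < l" for a
    using x J_smooth[OF that] star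
    by (simp add: fun_eq_iff apply_coefficient_op coefficient_maps inner_deriv_def commutator_def
        star_commutator_def ghost_algebra_def)
  then show "brst_delta \<mu> l f J x S = apply_op delta x S"
    unfolding delta_expand brst_delta_def
    by (simp add: apply_op_simps apply_op_sum gen_op.rep_eq deriv_op.rep_eq real_const_minus
        wedge_generator_fin fin fin' fin_supp_rules cong: sum.cong_simp)
qed

lemma brst_partial_apply:
  assumes star: "\<And>F H. F \<in> cinf_fps A \<Longrightarrow> H \<in> cinf_fps A \<Longrightarrow> star \<mu> F H = st F H"
    and x: "x \<in> ghost_algebra A l"
  shows "brst_partial \<mu> l f J x = apply_op bd x"
proof
  fix S
  have fin: "fin_supp x" using x by (rule ghost_algebra_fin_supp)
  have "(\<lambda>T. star \<mu> (x T) (J a)) = apply_op (coefficient_op (right_mult a)) x"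
    if "a < l" for a
    using x J_smooth[OF that] star
    by (simp add: fun_eq_iff apply_coefficient_op coefficient_maps right_mult_def ghost_algebra_def)
  then show "brst_partial \<mu> l f J x S = apply_op bd x S"
    unfolding bd_expand brst_partial_def
    by (simp add: apply_op_simps apply_op_sum apply_coefficient_op coefficient_maps
        gen_op.rep_eq deriv_op.rep_eq mult_ac
        wedge_generator_fin fin fin_supp_rules cong: sum.cong_simp)
qed

end

section \<open>Commutators with monomials in the ghosts\<close>

lemma scalar_series_simps:
  "scalar_series (c + d) = scalar_series c + scalar_series d"
  "scalar_series (c - d) = scalar_series c - scalar_series d"
  "scalar_series (c * d) = scalar_series c * scalar_series d"
  "scalar_series (fps_const r) = scalar_const r"
  "scalar_series fps_X = fps_X"
  "scalar_series 0 = 0"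
  by (auto simp: scalar_series_def scalar_const_def fps_eq_iff fun_eq_iff fps_mult_nth sum_fun_apply
      fps_X_def)

lemma scalar_series_sum: "scalar_series (\<Sum>k\<in>I. c k) = (\<Sum>k\<in>I. scalar_series (c k))"
  by (induction I rule: infinite_finite_induct) (simp_all add: scalar_series_simps)

lemma scalar_const_simps:
  "scalar_const (c + d) = scalar_const c + scalar_const d"
  "scalar_const (c * d) = scalar_const c * scalar_const d"
  "scalar_const (- c) = - scalar_const c" "scalar_const (c - d) = scalar_const c - scalar_const d"
  "scalar_const 0 = 0" "scalar_const 1 = 1"
  by (auto simp: scalar_const_def fps_eq_iff fun_eq_iff)

lemma scalar_const_numeral: "scalar_const (numeral n) = numeral n"
  by (induction n) (simp_all only: numeral.simps scalar_const_simps)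

lemma scalar_const_neg_one_power: "scalar_const ((- 1) ^ n) = (- 1) ^ n"
  by (induction n) (simp_all add: scalar_const_simps)

lemma contraction_power_linear:
  "(contraction l ^^ n) (\<lambda>S T. \<Sum>k\<in>I. c k * t k S T) = (\<lambda>S T. \<Sum>k\<in>I. c k * (contraction l ^^ n) (t k) S T)"
  by (induction n) (simp_all add: contraction_linear)

lemma clifford_linear:
  shows clifford_linear_left:
    "clifford l (\<lambda>R. \<Sum>k\<in>I. c k * x k R) w U = (\<Sum>k\<in>I. fps_const (c k) * clifford l (x k) w U)"
    and clifford_linear_right:
    "clifford l v (\<lambda>R. \<Sum>k\<in>I. c k * x k R) U = (\<Sum>k\<in>I. fps_const (c k) * clifford l v (x k) U)"
proof -
  have tm: "tensor_mult (\<lambda>S T. \<Sum>k\<in>I. c k * t k S T) U = (\<Sum>k\<in>I. c k * tensor_mult (t k) U)"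
    for t :: "'b \<Rightarrow> 'a grassmann grassmann"
    unfolding tensor_mult_def sum_distrib_left
    by (subst sum.swap) (simp add: mult.left_commute)
  have left: "(\<lambda>S T. (\<Sum>k\<in>I. c k * x k S) * w T) = (\<lambda>S T. \<Sum>k\<in>I. c k * (x k S * w T))"
    by (simp add: sum_distrib_right mult.assoc)
  have right: "(\<lambda>S T. v S * (\<Sum>k\<in>I. c k * x k T)) = (\<lambda>S T. \<Sum>k\<in>I. c k * (v S * x k T))"
    by (simp add: sum_distrib_left mult.left_commute)
  show "clifford l (\<lambda>R. \<Sum>k\<in>I. c k * x k R) w U = (\<Sum>k\<in>I. fps_const (c k) * clifford l (x k) w U)"
    by (rule fps_ext) (simp add: clifford_def left contraction_power_linear tm fps_sum_nth
        sum_distrib_left sum_divide_distrib mult_ac)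
  show "clifford l v (\<lambda>R. \<Sum>k\<in>I. c k * x k R) U = (\<Sum>k\<in>I. fps_const (c k) * clifford l v (x k) U)"
    by (rule fps_ext) (simp add: clifford_def right contraction_power_linear tm fps_sum_nth
        sum_distrib_left sum_divide_distrib mult_ac)
qed

lemma monomial_expansion:
  fixes x :: "'c::comm_ring_1 grassmann"
  assumes "finite I" "\<And>S. S \<notin> I \<Longrightarrow> x S = 0"
  shows "x = (\<lambda>R. \<Sum>S\<in>I. x S * monomial S R)"
proof
  fix R
  have "(\<Sum>S\<in>I. x S * monomial S R) = (\<Sum>S\<in>I. if S = R then x R else 0)"
    by (rule sum.cong) (auto simp: monomial_def)
  then show "x R = (\<Sum>S\<in>I. x S * monomial S R)"
    using assms by (simp add: sum.delta)
qed

text \<open>The same operator over the scalars and over the coefficient ring. The Clifford product is defined on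
  monomials with scalar coefficients and then extended linearly; this relation transfers the
  formulas for monomials to arbitrary elements, as in \<open>natural_pair_expand\<close>.\<close>

definition natural_pair ::
    "('k::real_normed_field grassmann \<Rightarrow> 'k grassmann) \<Rightarrow>
     (('m \<Rightarrow> 'k) fps grassmann \<Rightarrow> ('m \<Rightarrow> 'k) fps grassmann) \<Rightarrow> bool" where
  "natural_pair T T' \<longleftrightarrow>
     (\<forall>x U. scalar_const (T x U) = T' (\<lambda>S. scalar_const (x S)) U) \<and>
     (\<forall>x y. T' (\<lambda>S. x S + y S) = (\<lambda>S. T' x S + T' y S)) \<and>
     (\<forall>c x. T' (\<lambda>S. c * x S) = (\<lambda>S. c * T' x S))"

lemma natural_pair_comp:
  assumes "natural_pair T T'" "natural_pair V V'"
  shows "natural_pair (\<lambda>x. T (V x)) (\<lambda>x. T' (V' x))"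
  using assms unfolding natural_pair_def by simp

lemma natural_pair_generators:
  shows natural_pair_gen_mult: "natural_pair (gen_mult i) (gen_mult i)"
    and natural_pair_left_deriv: "natural_pair (left_deriv i) (left_deriv i)"
    and natural_pair_involution: "natural_pair involution involution"
  unfolding natural_pair_def gen_mult_def left_deriv_order_sign involution_def order_sign_def
  by (auto simp: fun_eq_iff scalar_const_simps scalar_const_neg_one_power distrib_left distrib_right mult_ac)

lemma natural_pair_expand:
  fixes T :: "'k::real_normed_field grassmann \<Rightarrow> 'k grassmann"
    and T' :: "('m \<Rightarrow> 'k) fps grassmann \<Rightarrow> ('m \<Rightarrow> 'k) fps grassmann"
  assumes T: "natural_pair T T'" and I: "finite I" "\<And>S. S \<notin> I \<Longrightarrow> z S = 0"
  shows "(\<Sum>S\<in>I. scalar_const (T (monomial S) U) * z S) = T' z U"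
proof -
  have add: "T' (\<lambda>S. x S + y S) = (\<lambda>S. T' x S + T' y S)" and
    scale: "T' (\<lambda>S. c * x S) = (\<lambda>S. c * T' x S)" for x y c
    using T by (auto simp: natural_pair_def)
  have zero: "T' (\<lambda>S. 0) = (\<lambda>S. 0)" using scale[of 0 "\<lambda>S. 0"] by simp
  have sum: "T' (\<lambda>R. \<Sum>S\<in>K. z S * monomial S R) = (\<lambda>R. \<Sum>S\<in>K. z S * T' (monomial S) R)" if "finite K" for K
    using that by (induction K) (simp_all add: zero add scale)
  have mono: "T' (monomial S) U = scalar_const (T (monomial S) U)" for S
  proof -
    have "(\<lambda>R. scalar_const ((monomial S :: 'k grassmann) R)) = (monomial S :: ('m \<Rightarrow> 'k) fps grassmann)"
      by (simp add: fun_eq_iff monomial_def scalar_const_simps)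
    then show ?thesis using T by (simp add: natural_pair_def)
  qed
  have "T' z U = T' (\<lambda>R. \<Sum>S\<in>I. z S * monomial S R) U"
    using monomial_expansion[of I z] I by simp
  also have "\<dots> = (\<Sum>S\<in>I. scalar_const (T (monomial S) U) * z S)"
    by (simp add: sum I mono mult.commute)
  finally show ?thesis ..
qed

context quantum_symmetry
begin

lemma st_one: "F \<in> cinf_fps A \<Longrightarrow> st (scalar_const c) F = scalar_const c * F"
  "F \<in> cinf_fps A \<Longrightarrow> st F (scalar_const c) = scalar_const c * F"
  using scalar_left[of c 1 F] scalar_right[of F c 1] by (simp_all add: unit)

definition ghost_product where
  "ghost_product x y = (\<lambda>U. \<Sum>S\<in>Pow {..<2 * l}. \<Sum>T\<in>Pow {..<2 * l}.
     scalar_series (clifford l (monomial S) (monomial T) U) * st (x S) (y T))"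

lemma ghost_product_left:
  fixes v :: "'k grassmann"
  assumes v: "\<forall>S. \<not> S \<subseteq> {..<2 * l} \<longrightarrow> v S = 0"
  shows "ghost_product (\<lambda>S. C * scalar_const (v S)) y U
    = (\<Sum>T\<in>Pow {..<2 * l}. scalar_series (clifford l v (monomial T) U) * st C (y T))"
proof -
  have expansion: "v = (\<lambda>R. \<Sum>S\<in>Pow {..<2 * l}. v S * monomial S R)"
    by (rule monomial_expansion) (use v in auto)
  have *: "clifford l v w U = (\<Sum>S\<in>Pow {..<2 * l}. fps_const (v S) * clifford l (monomial S) w U)" for w
    using arg_cong[OF expansion, of "\<lambda>v. clifford l v w U"] unfolding clifford_linear_left .
  have scalar: "st (C * scalar_const r) F = scalar_const r * st C F" for r F
    using scalar_left[of r C F] by (simp add: mult.commute)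
  show ?thesis
    unfolding ghost_product_def * scalar_series_sum sum_distrib_right scalar
    by (subst sum.swap) (simp add: scalar_series_simps mult_ac)
qed

lemma ghost_product_right:
  fixes v :: "'k grassmann"
  assumes v: "\<forall>S. \<not> S \<subseteq> {..<2 * l} \<longrightarrow> v S = 0"
  shows "ghost_product y (\<lambda>S. C * scalar_const (v S)) U
    = (\<Sum>T\<in>Pow {..<2 * l}. scalar_series (clifford l (monomial T) v U) * st (y T) C)"
proof -
  have expansion: "v = (\<lambda>R. \<Sum>S\<in>Pow {..<2 * l}. v S * monomial S R)"
    by (rule monomial_expansion) (use v in auto)
  have *: "clifford l w v U = (\<Sum>S\<in>Pow {..<2 * l}. fps_const (v S) * clifford l w (monomial S) U)" for w
    using arg_cong[OF expansion, of "\<lambda>v. clifford l w v U"] unfolding clifford_linear_right .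
  have scalar: "st F (C * scalar_const r) = scalar_const r * st F C" for r F
    using scalar_right[of F r C] by (simp add: mult.commute)
  show ?thesis
    unfolding ghost_product_def * scalar_series_sum sum_distrib_right scalar
    by (simp add: scalar_series_simps mult_ac)
qed

lemma sum_swap_inner:
  "(\<Sum>S\<in>P. \<Sum>T\<in>Q. \<Sum>k\<in>I. h S T k) = (\<Sum>k\<in>I. \<Sum>S\<in>P. \<Sum>T\<in>Q. h S T k)"
proof -
  have "(\<Sum>S\<in>P. \<Sum>T\<in>Q. \<Sum>k\<in>I. h S T k) = (\<Sum>S\<in>P. \<Sum>k\<in>I. \<Sum>T\<in>Q. h S T k)"
    by (rule sum.cong[OF refl], rule sum.swap)
  also have "\<dots> = (\<Sum>k\<in>I. \<Sum>S\<in>P. \<Sum>T\<in>Q. h S T k)"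
    by (rule sum.swap)
  finally show ?thesis .
qed

text \<open>The graded commutator with an odd \<open>u\<close>, without splitting \<open>x\<close> into its even and odd parts.\<close>

definition twisted_commutator where
  "twisted_commutator u x = (\<lambda>U. ghost_product u x U - ghost_product (involution x) u U)"

lemma twisted_commutator_sum:
  "twisted_commutator (\<lambda>S. \<Sum>k\<in>I. u k S) x U = (\<Sum>k\<in>I. twisted_commutator (u k) x U)"
proof -
  have "ghost_product (\<lambda>S. \<Sum>k\<in>I. u k S) y U = (\<Sum>k\<in>I. ghost_product (u k) y U)"
    "ghost_product y (\<lambda>S. \<Sum>k\<in>I. u k S) U = (\<Sum>k\<in>I. ghost_product y (u k) U)" for y
    unfolding ghost_product_def st_sum_left st_sum_right sum_distrib_left
    by (rule sum_swap_inner)+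
  then show ?thesis by (simp add: twisted_commutator_def sum_subtractf)
qed

lemma twisted_commutator_add:
  "twisted_commutator (\<lambda>S. u S + v S) x U = twisted_commutator u x U + twisted_commutator v x U"
  using twisted_commutator_sum[of "\<lambda>k. if k then u else v" UNIV x U]
  by (simp add: UNIV_bool add.commute)

text \<open>Clifford products with an odd element on the right involve \<open>involution\<close> of the left
  factor, which cancels the one in \<open>twisted_commutator\<close>.\<close>

lemma involution_star: "involution (\<lambda>S. st (involution x S) C) = (\<lambda>S. st (x S) C)"
proof
  fix S
  have "st ((- 1) ^ n * F) C = (- 1) ^ n * st F C" for n F
    using scalar_left[of "(- 1) ^ n" F C] by (simp add: scalar_const_neg_one_power)
  then show "involution (\<lambda>S. st (involution x S) C) S = st (x S) C"
    by (simp add: involution_def mult.assoc[symmetric] power_add[symmetric])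
qed

lemma support_zero:
  assumes "x \<in> ghost_algebra A l" "S \<notin> Pow {..<2 * l}"
  shows "st C (x S) = 0" "st (involution x S) C = 0"
  using assms by (simp_all add: ghost_algebra_def st_zero_left st_zero_right involution_def)

text \<open>The uncontracted products combine to the star commutator with \<open>C\<close>; the single contraction comes from
  the product with the ghost on the right.\<close>

lemma twisted_commutator_ghost:
  assumes x: "x \<in> ghost_algebra A l" and a: "a < l"
  shows "twisted_commutator (\<lambda>S. C * generator (ghost a) S) x U
    = gen_mult (ghost a) (\<lambda>S. st C (x S) - st (x S) C) U
      + 2 * (fps_X * left_deriv (antighost a) (\<lambda>S. st (x S) C) U)"
proof -
  let ?I = "Pow {..<2 * l}" and ?v = "generator (ghost a) :: 'k grassmann"
  let ?z = "\<lambda>S. st (involution x S) C"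
  have gen: "(\<lambda>S. C * generator (ghost a) S) = (\<lambda>S. C * scalar_const (?v S))"
    by (simp add: fun_eq_iff generator_def monomial_def scalar_const_simps)
  have supp: "\<forall>S. \<not> S \<subseteq> {..<2 * l} \<longrightarrow> ?v S = 0"
    using a ghost_less[of a l] by (auto simp: generator_def monomial_def)
  have fin: "fin_supp (monomial T :: 'k grassmann)" if "T \<in> ?I" for T
    using that finite_subset by (auto intro!: fin_supp_monomial)
  have "ghost_product (\<lambda>S. C * generator (ghost a) S) x U
      = (\<Sum>T\<in>?I. scalar_const (gen_mult (ghost a) (monomial T) U) * st C (x T))"
    unfolding gen ghost_product_left[OF supp]
    by (rule sum.cong[OF refl]) (simp add: clifford_ghost_left fin scalar_series_simps)
  also have "\<dots> = gen_mult (ghost a) (\<lambda>S. st C (x S)) U"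
    by (rule natural_pair_expand[OF natural_pair_gen_mult]) (simp_all add: support_zero x)
  finally have left: "ghost_product (\<lambda>S. C * generator (ghost a) S) x U
      = gen_mult (ghost a) (\<lambda>S. st C (x S)) U" .
  have "ghost_product (involution x) (\<lambda>S. C * generator (ghost a) S) U
      = (\<Sum>T\<in>?I. scalar_const (gen_mult (ghost a) (involution (monomial T)) U) * ?z T)
        - 2 * (fps_X * (\<Sum>T\<in>?I. scalar_const (left_deriv (antighost a) (involution (monomial T)) U) * ?z T))"
    unfolding gen ghost_product_right[OF supp] sum_distrib_left sum_subtractf[symmetric]
    by (rule sum.cong[OF refl])
      (simp add: clifford_ghost_right fin a scalar_series_simps scalar_const_simps scalar_const_numeral
        algebra_simps)
  also have "\<dots> = gen_mult (ghost a) (\<lambda>S. st (x S) C) U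
      - 2 * (fps_X * left_deriv (antighost a) (\<lambda>S. st (x S) C) U)"
    using natural_pair_expand[OF natural_pair_comp[OF natural_pair_gen_mult natural_pair_involution], of ?I ?z]
      natural_pair_expand[OF natural_pair_comp[OF natural_pair_left_deriv natural_pair_involution], of ?I ?z]
    by (simp add: support_zero x involution_star)
  finally show ?thesis
    by (simp add: twisted_commutator_def left gen_mult_def algebra_simps)
qed

text \<open>The uncontracted products cancel because the real coefficient is central for \<open>\<star>\<close>. The \<open>\<nu>\<close>-linear
  term collects one contraction from the left and two from the right product, the
  \<open>\<nu>\<^sup>2\<close>-term comes from the right product alone.\<close>

lemma twisted_commutator_cubic:
  assumes x: "x \<in> ghost_algebra A l" and abc: "a < l" "b < l" "c < l"
  shows "twisted_commutator (\<lambda>S. real_const r * cubic a b c S) x U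
    = real_const r * (fps_X * (2 * (gen_mult (ghost a) (gen_mult (ghost b) (left_deriv (ghost c) x)) U
        + gen_mult (ghost b) (gen_mult (antighost c) (left_deriv (antighost a) x)) U
        - gen_mult (ghost a) (gen_mult (antighost c) (left_deriv (antighost b) x)) U)
        - 4 * (fps_X * gen_mult (antighost c) (left_deriv (antighost a) (left_deriv (antighost b) x)) U)))"
proof -
  let ?I = "Pow {..<2 * l}" and ?v = "cubic a b c :: 'k grassmann" and ?C = "real_const r :: ('m \<Rightarrow> 'k) fps"
  let ?z = "\<lambda>S. st (involution x S) ?C" and ?y = "\<lambda>S. st ?C (x S)"
  have "scalar_const (?v S) = (cubic a b c :: ('m \<Rightarrow> 'k) fps grassmann) S" for S
  proof -
    have unit: "(\<lambda>S. scalar_const ((monomial {} :: 'k grassmann) S))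
        = (monomial {} :: ('m \<Rightarrow> 'k) fps grassmann)"
      by (simp add: fun_eq_iff monomial_def scalar_const_simps)
    show ?thesis
      using natural_pair_comp[where 'a='k and 'b='m, OF natural_pair_gen_mult[of "ghost a"]
          natural_pair_comp[OF natural_pair_gen_mult[of "ghost b"] natural_pair_gen_mult[of "antighost c"]]]
      by (simp add: natural_pair_def cubic_def unit)
  qed
  then have cub: "(\<lambda>S. ?C * cubic a b c S) = (\<lambda>S. ?C * scalar_const (?v S))"
    by simp
  have supp: "\<forall>S. \<not> S \<subseteq> {..<2 * l} \<longrightarrow> ?v S = 0"
  proof (intro allI impI, rule ccontr)
    fix S assume that: "\<not> S \<subseteq> {..<2 * l}" and "?v S \<noteq> 0"
    then have "S - {ghost a} - {ghost b} - {antighost c} = {}"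
      by (auto simp: cubic_def gen_mult_def monomial_def split: if_splits)
    then have "S \<subseteq> {ghost a, ghost b, antighost c}" by auto
    with that abc show False by (auto simp: ghost_less antighost_less)
  qed
  have fin: "fin_supp (monomial T :: 'k grassmann)" if "T \<in> ?I" for T
    using that finite_subset by (auto intro!: fin_supp_monomial)
  have smooth_x: "x S \<in> cinf_fps A" for S using x by (simp add: ghost_algebra_def)
  have y: "?y = (\<lambda>S. ?C * x S)" and z: "(\<lambda>S. st (x S) ?C) = (\<lambda>S. ?C * x S)"
    by (simp_all add: real_const_scalar st_one smooth_x)
  have scale: "T' (\<lambda>S. ?C * x S) U = ?C * T' x U" if "natural_pair T T'" for T T'
    using that by (simp add: natural_pair_def)
  have expand_left: "(\<Sum>S\<in>?I. scalar_const (T (monomial S) U) * ?y S) = ?C * T' x U"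
    if "natural_pair T T'" for T T'
    using natural_pair_expand[OF that, of ?I ?y] scale[OF that] by (simp add: support_zero x y)
  have expand_right: "(\<Sum>S\<in>?I. scalar_const (T (involution (monomial S)) U) * ?z S) = ?C * T' x U"
    if "natural_pair T T'" for T T'
    using natural_pair_expand[OF natural_pair_comp[OF that natural_pair_involution], of ?I ?z]
      scale[OF that] by (simp add: support_zero x involution_star z)
  note np_gg = natural_pair_comp[OF natural_pair_gen_mult natural_pair_gen_mult]
    and np_gd = natural_pair_comp[OF natural_pair_gen_mult natural_pair_left_deriv]
  note np_ggg = natural_pair_comp[OF natural_pair_gen_mult np_gg]
    and np_ggd = natural_pair_comp[OF natural_pair_gen_mult np_gd]
    and np_gdd = natural_pair_comp[OF np_gd natural_pair_left_deriv]
  have "ghost_product (\<lambda>S. ?C * cubic a b c S) x U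
      = (\<Sum>T\<in>?I. scalar_const (gen_mult (ghost a) (gen_mult (ghost b) (gen_mult (antighost c) (monomial T))) U) * ?y T)
        + fps_X * (2 * (\<Sum>T\<in>?I. scalar_const (gen_mult (ghost a) (gen_mult (ghost b) (left_deriv (ghost c) (monomial T))) U) * ?y T))"
    unfolding cub ghost_product_left[OF supp] sum_distrib_left sum.distrib[symmetric]
    by (rule sum.cong[OF refl])
      (simp add: clifford_cubic_left fin abc scalar_series_simps scalar_const_simps scalar_const_numeral
        algebra_simps)
  also have "\<dots> = ?C * (gen_mult (ghost a) (gen_mult (ghost b) (gen_mult (antighost c) x)) U
      + fps_X * (2 * gen_mult (ghost a) (gen_mult (ghost b) (left_deriv (ghost c) x)) U))"
    unfolding expand_left[OF np_ggg] expand_left[OF np_ggd] by (simp add: algebra_simps)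
  finally have left: "ghost_product (\<lambda>S. ?C * cubic a b c S) x U = \<dots>" .
  let ?d = "\<lambda>a. left_deriv (antighost a)"
  have "ghost_product (involution x) (\<lambda>S. ?C * cubic a b c S) U
      = (\<Sum>T\<in>?I. scalar_const (gen_mult (ghost a) (gen_mult (ghost b) (gen_mult (antighost c) (involution (monomial T)))) U) * ?z T)
        - fps_X * (2 * ((\<Sum>T\<in>?I. scalar_const (gen_mult (ghost b) (gen_mult (antighost c) (?d a (involution (monomial T)))) U) * ?z T)
          - (\<Sum>T\<in>?I. scalar_const (gen_mult (ghost a) (gen_mult (antighost c) (?d b (involution (monomial T)))) U) * ?z T)))
        + fps_X * (fps_X * (4 * (\<Sum>T\<in>?I. scalar_const (gen_mult (antighost c) (?d a (?d b (involution (monomial T)))) U) * ?z T)))"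
    unfolding cub ghost_product_right[OF supp] sum_distrib_left sum.distrib[symmetric] sum_subtractf[symmetric]
    by (rule sum.cong[OF refl])
      (simp add: clifford_cubic_right fin abc scalar_series_simps scalar_const_simps scalar_const_numeral
        algebra_simps)
  also have "\<dots> = ?C * (gen_mult (ghost a) (gen_mult (ghost b) (gen_mult (antighost c) x)) U
      - fps_X * (2 * (gen_mult (ghost b) (gen_mult (antighost c) (?d a x)) U
          - gen_mult (ghost a) (gen_mult (antighost c) (?d b x)) U))
      + fps_X * (fps_X * (4 * gen_mult (antighost c) (?d a (?d b x)) U)))"
    unfolding expand_right[OF np_ggg] expand_right[OF np_ggd] expand_right[OF np_gdd]
    by (simp add: algebra_simps)
  finally show ?thesis
    by (simp add: twisted_commutator_def left algebra_simps)
qed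

end

section \<open>Structure constants of a Lie algebra basis\<close>

text \<open>Adding \<open>c\<close> to the coordinates of \<open>e a\<close> gives coordinates of \<open>e a\<close>, which are unique.\<close>

lemma lie_basis_independent:
  assumes basis: "lie_algebra_basis A G l e"
    and zero: "\<And>\<phi> g. (\<Sum>a<l. c a * e a \<phi> g) = 0" and a: "a < l"
  shows "c a = 0"
proof -
  define d where "d b = (if b = a then 1 else 0 :: real)" for b
  \<comment> \<open>The uniqueness hypothesis concerns coordinate functions that vanish from \<open>l\<close> on.\<close>
  define d' where "d' b = (if b < l then d b + c b else 0)" for b
  have d: "(\<forall>b\<ge>l. d b = 0) \<and> e a = (\<lambda>\<phi> g. \<Sum>b<l. d b * e b \<phi> g)"
    using a by (auto simp: d_def fun_eq_iff if_distrib[of "\<lambda>r. r * _"] cong: if_cong)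
  have d': "(\<forall>b\<ge>l. d' b = 0) \<and> e a = (\<lambda>\<phi> g. \<Sum>b<l. d' b * e b \<phi> g)"
  proof -
    have "(\<Sum>b<l. d' b * e b \<phi> g) = (\<Sum>b<l. d b * e b \<phi> g) + (\<Sum>b<l. c b * e b \<phi> g)" for \<phi> g
      by (simp add: d'_def distrib_right sum.distrib)
    then show ?thesis using d zero by (simp add: d'_def fun_eq_iff)
  qed
  have "e a \<in> lie_algebra A G" using basis a by (simp add: lie_algebra_basis_def)
  then have "\<exists>!c. (\<forall>a\<ge>l. c a = 0) \<and> e a = (\<lambda>\<phi> g. \<Sum>a<l. c a * e a \<phi> g)"
    using basis unfolding lie_algebra_basis_def by blast
  then have "d = d'" using d d' by blast
  then have "d a = d' a" by simp
  then show ?thesis using a by (simp add: d'_def)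
qed

lemma vector_field_linear:
  fixes A :: "('g::{t2_space,second_countable_topology}, 'd::real_normed_vector) atlas"
    and l :: nat
  assumes A: "smooth_atlas A" and X: "X \<in> vector_fields A"
  shows "\<phi> \<in> cinf A \<Longrightarrow> \<psi> \<in> cinf A \<Longrightarrow> X (\<lambda>q. \<phi> q - \<psi> q) g = X \<phi> g - X \<psi> g"
    and "(\<And>m. m < l \<Longrightarrow> u m \<in> cinf A) \<Longrightarrow> X (\<lambda>q. \<Sum>m<l. r m * u m q) g = (\<Sum>m<l. r m * X (u m) g)"
proof -
  have T: "vf_at X g \<in> tangent_space A g" using X by (simp add: vector_fields_def)
  have add: "X (\<lambda>q. \<phi> q + \<psi> q) g = X \<phi> g + X \<psi> g" if "\<phi> \<in> cinf A" "\<psi> \<in> cinf A" for \<phi> \<psi>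
    using T that by (simp add: tangent_space_def vf_at_def)
  have scale: "X (\<lambda>q. r * \<phi> q) g = r * X \<phi> g" if "\<phi> \<in> cinf A" for r \<phi>
    using T that by (simp add: tangent_space_def vf_at_def)
  have lin: "X (\<lambda>q. r * \<phi> q + \<psi> q) g = r * X \<phi> g + X \<psi> g" if "\<phi> \<in> cinf A" "\<psi> \<in> cinf A" for r \<phi> \<psi>
    using add[OF cinf_closed(4)[OF A that(1), of r] that(2)] scale[OF that(1)] by simp
  show "X (\<lambda>q. \<phi> q - \<psi> q) g = X \<phi> g - X \<psi> g" if "\<phi> \<in> cinf A" "\<psi> \<in> cinf A"
    using lin[OF that(2,1), of "- 1"] by simp
  show "X (\<lambda>q. \<Sum>m<l. r m * u m q) g = (\<Sum>m<l. r m * X (u m) g)" if u: "\<And>m. m < l \<Longrightarrow> u m \<in> cinf A"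
  proof -
    have "(\<lambda>q. \<Sum>m<n. r m * u m q) \<in> cinf A
        \<and> X (\<lambda>q. \<Sum>m<n. r m * u m q) g = (\<Sum>m<n. r m * X (u m) g)" if "n \<le> l" for n
      using that
    proof (induction n)
      case 0
      have "(\<lambda>_. 0 :: real) \<in> cinf A" by (rule cinf_const)
      then show ?case using scale[of "\<lambda>_. 0" 0] by simp
    next
      case (Suc n)
      then have "u n \<in> cinf A" "(\<lambda>q. \<Sum>m<n. r m * u m q) \<in> cinf A" using u by auto
      with Suc lin[of "u n" "\<lambda>q. \<Sum>m<n. r m * u m q" "r n"]
        cinf_linear_combination[OF A, of "u n" "\<lambda>q. \<Sum>m<n. r m * u m q" "r n"]
      show ?case by (simp add: add.commute)
    qed
    then show ?thesis by blast
  qed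
qed

text \<open>The brackets are commutators of operators, so antisymmetry and the Jacobi identity hold for the
  vector fields; linear independence transfers them to the coordinates. On functions that are
  not smooth all vector fields vanish.\<close>

lemma structure_constants_lie:
  fixes A :: "('g::{t2_space,second_countable_topology}, 'd::real_normed_vector) atlas"
  assumes A: "smooth_atlas A" and basis: "lie_algebra_basis A G l e"
    and f: "structure_constants l e f"
  shows "lie_constants l f"
proof
  have field: "e a \<in> vector_fields A" if "a < l" for a
    using basis that by (simp add: lie_algebra_basis_def lie_algebra_def)
  have bracket: "e a (e b \<phi>) g - e b (e a \<phi>) g = (\<Sum>c<l. f a b c * e c \<phi> g)"
    if "a < l" "b < l" for a b \<phi> g
    using f that by (simp add: structure_constants_def lie_bracket_def fun_eq_iff)
  show "f a b c = - f b a c" if "a < l" "b < l" "c < l" for a b c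
  proof -
    have "f a b c + f b a c = 0"
    proof (rule lie_basis_independent[OF basis _ \<open>c < l\<close>])
      fix \<phi> g
      show "(\<Sum>c<l. (f a b c + f b a c) * e c \<phi> g) = 0"
        using bracket[OF that(1,2), of \<phi> g] bracket[OF that(2,1), of \<phi> g]
        by (simp add: distrib_right sum.distrib)
    qed
    then show ?thesis by simp
  qed
  show "(\<Sum>m<l. f a b m * f m c d + f b c m * f m a d + f c a m * f m b d) = 0"
    if abc: "a < l" "b < l" "c < l" and "d < l" for a b c d
  proof (rule lie_basis_independent[OF basis _ \<open>d < l\<close>])
    fix \<phi> g
    have double: "(\<Sum>d<l. (\<Sum>m<l. f a b m * f m c d) * e d \<phi> g)
        = e a (e b (e c \<phi>)) g - e b (e a (e c \<phi>)) g - (e c (e a (e b \<phi>)) g - e c (e b (e a \<phi>)) g)"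
      if "\<phi> \<in> cinf A" "a < l" "b < l" "c < l" for a b c
    proof -
      have smooth: "e m \<phi> \<in> cinf A" "e n (e m \<phi>) \<in> cinf A" if "m < l" "n < l" for m n
        using field[OF that(1)] field[OF that(2)] \<open>\<phi> \<in> cinf A\<close> by (auto simp: vector_fields_def)
      have "(\<Sum>d<l. (\<Sum>m<l. f a b m * f m c d) * e d \<phi> g)
          = (\<Sum>m<l. f a b m * (\<Sum>d<l. f m c d * e d \<phi> g))"
        unfolding sum_distrib_left sum_distrib_right by (subst sum.swap) (simp add: mult.assoc)
      also have "\<dots> = (\<Sum>m<l. f a b m * (e m (e c \<phi>) g - e c (e m \<phi>) g))"
        using that by (simp add: bracket)
      also have "\<dots> = (\<Sum>m<l. f a b m * e m (e c \<phi>) g) - (\<Sum>m<l. f a b m * e c (e m \<phi>) g)"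
        by (simp add: right_diff_distrib sum_subtractf)
      also have "(\<Sum>m<l. f a b m * e m (e c \<phi>) g) = e a (e b (e c \<phi>)) g - e b (e a (e c \<phi>)) g"
        using bracket[OF that(2,3), of "e c \<phi>" g] by simp
      also have "(\<Sum>m<l. f a b m * e c (e m \<phi>) g) = e c (\<lambda>q. \<Sum>m<l. f a b m * e m \<phi> q) g"
        using vector_field_linear(2)[OF A field[OF that(4)], of l "\<lambda>m. e m \<phi>" "f a b" g] smooth(1)[OF _ that(2)]
        by simp
      also have "(\<lambda>q. \<Sum>m<l. f a b m * e m \<phi> q) = (\<lambda>q. e a (e b \<phi>) q - e b (e a \<phi>) q)"
        using bracket[OF that(2,3), of \<phi>] by simp
      also have "e c (\<lambda>q. e a (e b \<phi>) q - e b (e a \<phi>) q) g = e c (e a (e b \<phi>)) g - e c (e b (e a \<phi>)) g"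
        by (rule vector_field_linear(1)[OF A field[OF that(4)]]) (use smooth that in auto)
      finally show ?thesis .
    qed
    show "(\<Sum>d<l. (\<Sum>m<l. f a b m * f m c d + f b c m * f m a d + f c a m * f m b d) * e d \<phi> g) = 0"
    proof (cases "\<phi> \<in> cinf A")
      case True
      have "(\<Sum>d<l. (\<Sum>m<l. f a b m * f m c d + f b c m * f m a d + f c a m * f m b d) * e d \<phi> g)
         = (\<Sum>d<l. (\<Sum>m<l. f a b m * f m c d) * e d \<phi> g) + (\<Sum>d<l. (\<Sum>m<l. f b c m * f m a d) * e d \<phi> g)
           + (\<Sum>d<l. (\<Sum>m<l. f c a m * f m b d) * e d \<phi> g)"
        by (simp add: sum.distrib distrib_right)
      then show ?thesis by (simp add: double True abc)
    next
      case False
      have "e d \<phi> g = 0" if "d < l" for d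
        using field[OF that] False by (auto simp: vector_fields_def tangent_space_def vf_at_def)
      then show ?thesis by simp
    qed
  qed
qed

section \<open>The commutator with the BRST charge\<close>

lemma real_const_sum: "real_const (\<Sum>k\<in>I. r k) = (\<Sum>k\<in>I. real_const (r k))"
  by (induction I rule: infinite_finite_induct) (simp_all add: real_const_zero real_const_add)

context quantum_symmetry
begin

lemma ghost_algebra_add:
  "u \<in> ghost_algebra A l \<Longrightarrow> v \<in> ghost_algebra A l \<Longrightarrow> (\<lambda>S. u S + v S) \<in> ghost_algebra A l"
  for u v :: "('m \<Rightarrow> 'k) fps grassmann"
  by (simp add: ghost_algebra_def cinf_fps_closed)

lemma ghost_algebra_sum:
  fixes u :: "'i \<Rightarrow> ('m \<Rightarrow> 'k) fps grassmann"
  assumes "\<And>k. k \<in> I \<Longrightarrow> u k \<in> ghost_algebra A l"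
  shows "(\<lambda>S. \<Sum>k\<in>I. u k S) \<in> ghost_algebra A l"
  using assms
  by (induction I rule: infinite_finite_induct)
    (simp_all add: ghost_algebra_add, simp_all add: ghost_algebra_def cinf_fps_closed)

lemma ghost_algebra_generator:
  fixes C :: "('m \<Rightarrow> 'k) fps"
  assumes "C \<in> cinf_fps A" "a < l"
  shows "(\<lambda>S. C * generator (ghost a) S) \<in> ghost_algebra A l"
  using assms ghost_less[of a l] by (auto simp: ghost_algebra_def generator_def monomial_def cinf_fps_closed)

lemma scalar_const_smooth: "(scalar_const c :: ('m \<Rightarrow> 'k) fps) \<in> cinf_fps A"
proof -
  have "fps_nth (scalar_const c :: ('m \<Rightarrow> 'k) fps) n = (\<lambda>_. if n = 0 then c else 0)" for n
    by (simp add: scalar_const_def fun_eq_iff)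
  then show ?thesis by (simp add: cinf_fps_def cinf_const)
qed

lemma ghost_algebra_cubic:
  assumes "a < l" "b < l" "c < l"
  shows "(\<lambda>S. real_const r * cubic a b c S :: ('m \<Rightarrow> 'k) fps) \<in> ghost_algebra A l"
proof -
  have "(1 :: ('m \<Rightarrow> 'k) fps) \<in> cinf_fps A" using scalar_const_smooth[of 1] by (simp add: scalar_const_simps)
  then have "(monomial {} :: ('m \<Rightarrow> 'k) fps grassmann) \<in> ghost_algebra A l"
    by (auto simp: ghost_algebra_def monomial_def cinf_fps_closed)
  moreover have "preserves (r *\<^sub>R (gen_op (ghost a) * (gen_op (ghost b) * gen_op (antighost c))))"
    using assms by (intro preserves_rules) (simp_all add: ghost_less antighost_less)
  ultimately have "apply_op (r *\<^sub>R (gen_op (ghost a) * (gen_op (ghost b) * gen_op (antighost c))))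
      (monomial {} :: ('m \<Rightarrow> 'k) fps grassmann) \<in> ghost_algebra A l"
    by (simp add: preserves_def)
  also have "apply_op (r *\<^sub>R (gen_op (ghost a) * (gen_op (ghost b) * gen_op (antighost c)))) (monomial {})
      = (\<lambda>S. real_const r * cubic a b c S :: ('m \<Rightarrow> 'k) fps)"
    by (simp add: fun_eq_iff apply_op_simps gen_op.rep_eq cubic_def)
  finally show ?thesis .
qed

lemma ghost_product_add:
  "ghost_product (\<lambda>S. u S + v S) y U = ghost_product u y U + ghost_product v y U"
  "ghost_product y (\<lambda>S. u S + v S) U = ghost_product y u U + ghost_product y v U"
  "ghost_product (\<lambda>S. u S - v S) y U = ghost_product u y U - ghost_product v y U"
  by (simp_all add: ghost_product_def add_left add_right st_diff_left distrib_left right_diff_distrib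
      sum.distrib sum_subtractf)

lemma ghost_mult_eq:
  assumes star: "\<And>F H. F \<in> cinf_fps A \<Longrightarrow> H \<in> cinf_fps A \<Longrightarrow> star \<mu> F H = st F H"
    and "x \<in> ghost_algebra A l" "y \<in> ghost_algebra A l"
  shows "ghost_mult \<mu> l x y = ghost_product x y"
  using assms by (simp add: ghost_mult_def ghost_product_def ghost_algebra_def fun_eq_iff)

text \<open>The signs \<open>(- 1)\<^sup>j\<close> of the graded commutator assemble the parts of \<open>x\<close> into \<open>involution x\<close>.\<close>

lemma graded_commutator_odd:
  assumes star: "\<And>F H. F \<in> cinf_fps A \<Longrightarrow> H \<in> cinf_fps A \<Longrightarrow> star \<mu> F H = st F H"
    and u: "u \<in> ghost_algebra A l" and odd: "involution u = - u" and x: "x \<in> ghost_algebra A l"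
  shows "graded_commutator \<mu> l u x = twisted_commutator u x"
proof
  fix U
  have even: "u S = 0" if "card S mod 2 = 0" for S
  proof -
    have "(- 1) ^ card S * u S = - u S"
      using fun_cong[OF odd, of S] by (simp add: involution_def)
    then have "u S = - u S" using that by (simp add: even_iff_mod_2_eq_zero[symmetric])
    then have "fps_nth (u S) n p = - fps_nth (u S) n p" for n p
      by (metis fps_neg_nth uminus_apply)
    then have "fps_nth (u S) n p = 0" for n p
      by (metis eq_neg_iff_add_eq_0 mult_2 mult_eq_0_iff zero_neq_numeral)
    then show ?thesis by (simp add: fps_eq_iff fun_eq_iff)
  qed
  have u0: "parity_part 0 u = (\<lambda>S. 0)" and u1: "parity_part (Suc 0) u = u"
    using even by (auto simp: parity_part_def fun_eq_iff)
  have part: "parity_part i x \<in> ghost_algebra A l" for i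
    using x by (simp add: parity_part_def ghost_algebra_def cinf_fps_closed)
  have zero: "((\<lambda>S. 0) :: ('m \<Rightarrow> 'k) fps grassmann) \<in> ghost_algebra A l"
    by (simp add: ghost_algebra_def cinf_fps_closed)
  have zero_mult: "ghost_product (\<lambda>S. 0) y U = 0" "ghost_product y (\<lambda>S. 0) U = 0" for y
    by (simp_all add: ghost_product_def st_zero_left st_zero_right)
  have plus: "(\<lambda>S. parity_part 0 x S + parity_part (Suc 0) x S) = x"
    by (auto simp: parity_part_def fun_eq_iff)
  have minus: "(\<lambda>S. parity_part 0 x S - parity_part (Suc 0) x S) = involution x"
  proof
    fix S show "parity_part 0 x S - parity_part (Suc 0) x S = involution x S"
      by (cases "even (card S)") (simp_all add: parity_part_def involution_def odd_iff_mod_2_eq_one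
          even_iff_mod_2_eq_zero)
  qed
  have "graded_commutator \<mu> l u x U
      = (ghost_product u (parity_part 0 x) U + ghost_product u (parity_part (Suc 0) x) U)
        - (ghost_product (parity_part 0 x) u U - ghost_product (parity_part (Suc 0) x) u U)"
    by (simp add: graded_commutator_def numeral_2_eq_2 u0 u1 ghost_mult_eq[OF star] u part zero zero_mult)
  also have "\<dots> = twisted_commutator u x U"
    by (simp only: twisted_commutator_def ghost_product_add[symmetric] plus minus)
  finally show "graded_commutator \<mu> l u x U = twisted_commutator u x U" .
qed

text \<open>The charge as a sum of monomials with a single coefficient each.\<close>

definition charge_terms where
  "charge_terms S = (\<Sum>a<l. \<Sum>b<l. \<Sum>c<l. real_const (- f a b c / 4) * cubic a b c S)
     + (\<Sum>a<l. J a * generator (ghost a) S)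
     + (\<Sum>a<l. fps_X * real_const (ad_trace a / 2) * generator (ghost a) S)"

lemma brst_charge_terms: "brst_charge l f J = charge_terms"
proof
  fix S
  have cubic: "wedge (generator (ghost a)) (wedge (generator (ghost b)) (generator (antighost c))) = cubic a b c"
    for a b c
    by (simp add: wedge_generator_fin fin_supp_rules fin_supp_monomial[of "{_}", folded generator_def])
      (simp add: cubic_def generator_gen_mult)
  have quarter: "real_const (1/4) * real_const (f a b c) = real_const (f a b c / 4)" for a b c
    by (simp add: real_const_mult[symmetric])
  have half: "real_const (1/2) * (\<Sum>b<l. real_const (f a b b)) = real_const (ad_trace a / 2)" for a
    by (simp add: real_const_sum[symmetric] real_const_mult[symmetric] ad_trace_def)
  have "fps_X * real_const (1/2) * (\<Sum>a<l. \<Sum>b<l. real_const (f a b b) * generator (ghost a) S)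
      = (\<Sum>a<l. fps_X * (real_const (1/2) * (\<Sum>b<l. real_const (f a b b))) * generator (ghost a) S)"
    by (simp add: sum_distrib_left sum_distrib_right mult.assoc)
  then have linear_terms: "fps_X * real_const (1/2) * (\<Sum>a<l. \<Sum>b<l. real_const (f a b b) * generator (ghost a) S)
      = (\<Sum>a<l. fps_X * real_const (ad_trace a / 2) * generator (ghost a) S)"
    unfolding half .
  have "real_const (1/4) * (\<Sum>a<l. \<Sum>b<l. \<Sum>c<l. real_const (f a b c) * cubic a b c S)
      = (\<Sum>a<l. \<Sum>b<l. \<Sum>c<l. real_const (f a b c / 4) * cubic a b c S)"
    by (simp add: sum_distrib_left mult.assoc[symmetric] quarter)
  then show "brst_charge l f J S = charge_terms S"
    unfolding brst_charge_def charge_terms_def cubic linear_terms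
    by (simp add: real_const_minus sum_negf)
qed

lemma charge_terms_smooth: "charge_terms \<in> ghost_algebra A l"
proof -
  have smooth: "(fps_X * real_const r :: ('m \<Rightarrow> 'k) fps) \<in> cinf_fps A" for r
    unfolding real_const_scalar by (intro cinf_fps_closed scalar_const_smooth)
  show ?thesis
    unfolding charge_terms_def
    by (intro ghost_algebra_add ghost_algebra_sum ghost_algebra_cubic ghost_algebra_generator)
      (simp_all add: J_smooth smooth)
qed

lemma charge_terms_odd: "involution charge_terms = - charge_terms"
proof -
  have "involution (cubic a b c) = - cubic a b c" for a b c
    by (simp add: cubic_def grassmann_simps)
  then have cubic: "(- 1) ^ card S * cubic a b c S = - cubic a b c S" for a b c S
    by (metis involution_def uminus_apply)
  have "involution (generator (ghost a)) = - generator (ghost a)" for a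
    by (simp add: generator_gen_mult grassmann_simps)
  then have gen: "(- 1) ^ card S * generator (ghost a) S = - generator (ghost a) S" for a S
    by (metis involution_def uminus_apply)
  show ?thesis
    by (simp add: fun_eq_iff involution_def charge_terms_def distrib_left sum_distrib_left
        mult.left_commute[of "(- 1) ^ _"] cubic gen sum_negf)
qed

text \<open>The contractions of the cubic monomials that keep the antighost come in two kinds, which are equal
  after renaming indices and using antisymmetry of \<open>f\<close>; this explains the coefficient \<open>1\<close> of the adjoint
  term of \<open>\<delta>\<close> against \<open>1/2\<close> of the term with ghosts only.\<close>

lemma twisted_commutator_charge:
  assumes x: "x \<in> ghost_algebra A l"
  shows "twisted_commutator charge_terms x U = fps_X * (apply_op delta x U + 2 * apply_op bd x U)"
proof -
  define u where "u a b c = gen_mult (ghost a) (gen_mult (ghost b) (left_deriv (ghost c) x)) U" for a b c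
  define v where "v a b c = gen_mult (ghost a) (gen_mult (antighost c) (left_deriv (antighost b) x)) U" for a b c
  define w where "w a b c = gen_mult (antighost c) (left_deriv (antighost a) (left_deriv (antighost b) x)) U" for a b c
  define h where "h = (real_const (1/2) :: ('m \<Rightarrow> 'k) fps)"
  have h2: "2 * h = 1"
  proof -
    have "h + h = 1" by (simp add: h_def real_const_add[symmetric] real_const_one)
    then show ?thesis by (simp only: mult_2)
  qed
  have F: "(real_const (- r / 4) :: ('m \<Rightarrow> 'k) fps) = - (h * h * real_const r)" for r
    by (simp add: h_def real_const_mult[symmetric] real_const_minus)
  let ?F = "\<lambda>a b c. real_const (f a b c) :: ('m \<Rightarrow> 'k) fps"
  have cubic: "twisted_commutator (\<lambda>S. real_const (- f a b c / 4) * cubic a b c S) x U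
      = fps_X * (h * (?F a b c * v a b c) - h * (?F a b c * u a b c) - h * (?F a b c * v b a c)
          + fps_X * (?F a b c * w a b c))" if "a < l" "b < l" "c < l" for a b c
  proof -
    have "h * h * F * (fps_X * (2 * p - 4 * (fps_X * q)))
        = (2 * h) * (h * (fps_X * (F * p))) - (2 * h) * ((2 * h) * (fps_X * (fps_X * (F * q))))" for F p q
      by (simp add: algebra_simps)
    then have *: "h * h * F * (fps_X * (2 * p - 4 * (fps_X * q)))
        = h * (fps_X * (F * p)) - fps_X * (fps_X * (F * q))" for F p q
      by (simp only: h2 mult_1)
    show ?thesis
      unfolding twisted_commutator_cubic[OF x that]
      unfolding F u_def[symmetric] v_def[symmetric] w_def[symmetric]
        mult_minus_left *
      by (simp add: algebra_simps)
  qed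
  \<comment> \<open>This doubles the \<open>v\<close>-terms, so that the factor \<open>h = 1/2\<close> in front of them disappears.\<close>
  have swap: "(\<Sum>a<l. \<Sum>b<l. \<Sum>c<l. ?F a b c * v b a c) = - (\<Sum>a<l. \<Sum>b<l. \<Sum>c<l. ?F a b c * v a b c)"
  proof -
    have "(\<Sum>a<l. \<Sum>b<l. \<Sum>c<l. ?F a b c * v b a c) = (\<Sum>a<l. \<Sum>b<l. \<Sum>c<l. ?F b a c * v a b c)"
      by (rule sum.swap)
    also have "\<dots> = (\<Sum>a<l. \<Sum>b<l. \<Sum>c<l. - (?F a b c * v a b c))"
    proof (intro sum.cong refl)
      fix a b c assume "a \<in> {..<l}" "b \<in> {..<l}" "c \<in> {..<l}"
      then have "f b a c = - f a b c" by (auto intro: antisym)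
      then show "?F b a c * v a b c = - (?F a b c * v a b c)" by (simp add: real_const_minus)
    qed
    finally show ?thesis by (simp add: sum_negf)
  qed
  have cubic_sum: "(\<Sum>a<l. \<Sum>b<l. \<Sum>c<l. twisted_commutator (\<lambda>S. real_const (- f a b c / 4) * cubic a b c S) x U)
      = fps_X * ((\<Sum>a<l. \<Sum>b<l. \<Sum>c<l. ?F a b c * v a b c) - h * (\<Sum>a<l. \<Sum>b<l. \<Sum>c<l. ?F a b c * u a b c)
          + fps_X * (\<Sum>a<l. \<Sum>b<l. \<Sum>c<l. ?F a b c * w a b c))"
  proof -
    have "(\<Sum>a<l. \<Sum>b<l. \<Sum>c<l. twisted_commutator (\<lambda>S. real_const (- f a b c / 4) * cubic a b c S) x U)
      = (\<Sum>a<l. \<Sum>b<l. \<Sum>c<l. fps_X * (h * (?F a b c * v a b c) - h * (?F a b c * u a b c)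
          - h * (?F a b c * v b a c) + fps_X * (?F a b c * w a b c)))"
      by (intro sum.cong refl cubic) simp_all
    also have "\<dots> = fps_X * (h * (\<Sum>a<l. \<Sum>b<l. \<Sum>c<l. ?F a b c * v a b c) - h * (\<Sum>a<l. \<Sum>b<l. \<Sum>c<l. ?F a b c * u a b c)
          - h * (\<Sum>a<l. \<Sum>b<l. \<Sum>c<l. ?F a b c * v b a c) + fps_X * (\<Sum>a<l. \<Sum>b<l. \<Sum>c<l. ?F a b c * w a b c))"
      by (simp add: sum_distrib_left[symmetric] sum.distrib sum_subtractf)
    also have "\<dots> = fps_X * (2 * h * (\<Sum>a<l. \<Sum>b<l. \<Sum>c<l. ?F a b c * v a b c)
        - h * (\<Sum>a<l. \<Sum>b<l. \<Sum>c<l. ?F a b c * u a b c)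
        + fps_X * (\<Sum>a<l. \<Sum>b<l. \<Sum>c<l. ?F a b c * w a b c))"
      unfolding swap by (simp add: algebra_simps)
    finally show ?thesis by (simp only: h2 mult_1)
  qed
  have linear: "twisted_commutator (\<lambda>S. J a * generator (ghost a) S) x U
      = fps_X * (gen_mult (ghost a) (\<lambda>S. inner_deriv a (x S)) U
          + 2 * left_deriv (antighost a) (\<lambda>S. right_mult a (x S)) U)" if "a < l" for a
  proof -
    have "(\<lambda>S. st (J a) (x S) - st (x S) (J a)) = (\<lambda>S. fps_X * inner_deriv a (x S))"
      by (simp add: nu_inner_deriv commutator_def)
    moreover have "gen_mult (ghost a) (\<lambda>S. fps_X * y S) U = fps_X * gen_mult (ghost a) y U" for y
      by (simp add: gen_mult_def mult.left_commute)
    ultimately show ?thesis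
      unfolding twisted_commutator_ghost[OF x that] right_mult_def by (simp add: algebra_simps)
  qed
  have central: "twisted_commutator (\<lambda>S. fps_X * real_const (ad_trace a / 2) * generator (ghost a) S) x U
      = fps_X * (2 * (h * (fps_X * (real_const (ad_trace a) * left_deriv (antighost a) x U))))" if "a < l" for a
  proof -
    let ?C = "fps_X * real_const (ad_trace a / 2) :: ('m \<Rightarrow> 'k) fps"
    have "x S \<in> cinf_fps A" for S using x by (simp add: ghost_algebra_def)
    then have "(\<lambda>S. st ?C (x S) - st (x S) ?C) = (\<lambda>S. 0)" "(\<lambda>S. st (x S) ?C) = (\<lambda>S. ?C * x S)"
      by (simp_all add: nu_left nu_right real_const_scalar st_one mult.assoc)
    moreover have "real_const (ad_trace a / 2) = h * real_const (ad_trace a)"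
      by (simp add: h_def real_const_mult[symmetric])
    ultimately show ?thesis
      unfolding twisted_commutator_ghost[OF x that]
      by (simp add: left_deriv_order_sign gen_mult_def mult_ac)
  qed
  have delta_x: "apply_op delta x U = - (h * (\<Sum>a<l. \<Sum>b<l. \<Sum>c<l. ?F a b c * u a b c))
      + (\<Sum>a<l. \<Sum>b<l. \<Sum>c<l. ?F a b c * v a b c) + (\<Sum>a<l. gen_mult (ghost a) (\<lambda>S. inner_deriv a (x S)) U)"
  proof -
    have "apply_op (coefficient_op (inner_deriv a)) x = (\<lambda>S. inner_deriv a (x S))" for a
      by (simp add: fun_eq_iff apply_coefficient_op coefficient_maps)
    then show ?thesis
      unfolding delta_expand
      by (simp add: apply_op_simps apply_op_sum gen_op.rep_eq deriv_op.rep_eq u_def v_def h_def real_const_minus)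
  qed
  have bd_x: "apply_op bd x U = (\<Sum>a<l. left_deriv (antighost a) (\<lambda>S. right_mult a (x S)) U)
      + h * (fps_X * (\<Sum>a<l. real_const (ad_trace a) * left_deriv (antighost a) x U))
      + h * (fps_X * (\<Sum>a<l. \<Sum>b<l. \<Sum>c<l. ?F a b c * w a b c))"
  proof -
    have "apply_op (coefficient_op (right_mult a)) x = (\<lambda>S. right_mult a (x S))" for a
      by (simp add: fun_eq_iff apply_coefficient_op coefficient_maps)
    then show ?thesis
      unfolding bd_expand
      by (simp add: apply_op_simps apply_op_sum apply_coefficient_op coefficient_maps gen_op.rep_eq
          deriv_op.rep_eq w_def h_def ad_trace_def real_const_sum sum_distrib_right)
  qed
  have "twisted_commutator charge_terms x U
      = fps_X * ((\<Sum>a<l. \<Sum>b<l. \<Sum>c<l. ?F a b c * v a b c) - h * (\<Sum>a<l. \<Sum>b<l. \<Sum>c<l. ?F a b c * u a b c)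
          + fps_X * (\<Sum>a<l. \<Sum>b<l. \<Sum>c<l. ?F a b c * w a b c))
        + fps_X * ((\<Sum>a<l. gen_mult (ghost a) (\<lambda>S. inner_deriv a (x S)) U)
          + 2 * (\<Sum>a<l. left_deriv (antighost a) (\<lambda>S. right_mult a (x S)) U))
        + fps_X * (2 * (h * (fps_X * (\<Sum>a<l. real_const (ad_trace a) * left_deriv (antighost a) x U))))"
    unfolding charge_terms_def[abs_def] twisted_commutator_add twisted_commutator_sum cubic_sum
    by (simp add: linear central sum_distrib_left[symmetric] sum.distrib cong: sum.cong_simp)
  also have "\<dots> = fps_X * (apply_op delta x U + 2 * apply_op bd x U)"
  proof -
    have double: "2 * (h * z) = z" for z
      by (simp only: mult.assoc[symmetric] h2 mult_1)
    have "2 * apply_op bd x U = 2 * (\<Sum>a<l. left_deriv (antighost a) (\<lambda>S. right_mult a (x S)) U)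
        + fps_X * (\<Sum>a<l. real_const (ad_trace a) * left_deriv (antighost a) x U)
        + fps_X * (\<Sum>a<l. \<Sum>b<l. \<Sum>c<l. ?F a b c * w a b c)"
      by (simp only: bd_x distrib_left double)
    then show ?thesis unfolding delta_x double by (simp add: algebra_simps)
  qed
  finally show ?thesis .
qed

lemma brst_D_apply:
  assumes star: "\<And>F H. F \<in> cinf_fps A \<Longrightarrow> H \<in> cinf_fps A \<Longrightarrow> star \<mu> F H = st F H"
    and x: "x \<in> ghost_algebra A l"
  shows "brst_D \<mu> l f J x S = apply_op delta x S + 2 * apply_op bd x S"
proof -
  have "graded_commutator \<mu> l (brst_charge l f J) x S = twisted_commutator charge_terms x S"
    using graded_commutator_odd[OF star charge_terms_smooth charge_terms_odd x]
    by (simp add: brst_charge_terms)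
  also have "\<dots> = fps_X * (apply_op delta x S + 2 * apply_op bd x S)"
    by (rule twisted_commutator_charge[OF x])
  finally have "graded_commutator \<mu> l (brst_charge l f J) x S
      = fps_X * (apply_op delta x S + 2 * apply_op bd x S)" .
  moreover have "nu_div (fps_X * H) = H" for H :: "('m \<Rightarrow> 'k) fps"
    by (rule nu_cancel, rule nu_div_shift(1)) simp
  ultimately show ?thesis
    unfolding brst_D_def by simp
qed

end

theorem theorem4p1p2:
  fixes AM :: "('m::{t2_space,second_countable_topology}, 'e::real_normed_vector) atlas"
    and \<omega> :: "'m two_form"
    and AG :: "('g::{t2_space,second_countable_topology}, 'd::real_normed_vector) atlas"
    and G :: "'g monoid"
    and act :: "'g \<Rightarrow> 'm \<Rightarrow> 'm"
    and J :: "'m \<Rightarrow> 'g vfield \<Rightarrow> real"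
    and l :: nat
    and e :: "nat \<Rightarrow> 'g vfield"
    and f :: "nat \<Rightarrow> nat \<Rightarrow> nat \<Rightarrow> real"
    and \<mu> :: "nat \<Rightarrow> ('m \<Rightarrow> 'k::real_normed_field) \<Rightarrow> ('m \<Rightarrow> 'k) \<Rightarrow> ('m \<Rightarrow> 'k)"
    and \<J> :: "'g vfield \<Rightarrow> ('m \<Rightarrow> 'k) fps"
  assumes "symplectic_manifold AM \<omega>"
    and "lie_group AG G"
    and "connected (UNIV :: 'g set)"
    and "smooth_action AG G AM act"
    and "moment_map AG G AM \<omega> act J"
    and "lie_algebra_basis AG G l e"
    and "structure_constants l e f"
    and "star_product AM \<omega> \<mu>"
    and "quantum_moment_map AG G l e f AM \<mu> J \<J>"
  shows
    "let D = brst_D \<mu> l f (\<lambda>a. \<J> (e a));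
         \<delta> = brst_delta \<mu> l f (\<lambda>a. \<J> (e a));
         bd = brst_partial \<mu> l f (\<lambda>a. \<J> (e a))
     in \<forall>x\<in>ghost_algebra AM l.
          D x = (\<lambda>S. \<delta> x S + 2 * bd x S) \<and>
          \<delta> (\<delta> x) = (\<lambda>S. 0) \<and>
          bd (bd x) = (\<lambda>S. 0) \<and>
          (\<lambda>S. \<delta> (bd x) S + bd (\<delta> x) S) = (\<lambda>S. 0)"
proof -
  have atlas: "smooth_atlas AM" using assms(1) by (simp add: symplectic_manifold_def)
  obtain st where st: "formal_star AM st"
    and st_star: "\<And>F H. F \<in> cinf_fps AM \<Longrightarrow> H \<in> cinf_fps AM \<Longrightarrow> st F H = star \<mu> F H"
    using star_product_extends[OF atlas assms(8)] by blast
  have lie: "lie_constants l f"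
    using structure_constants_lie[OF _ assms(6,7)] assms(2) by (simp add: lie_group_def)
  have J: "\<J> (e a) \<in> cinf_fps AM" if "a < l" for a
    using assms(6,9) that by (simp add: lie_algebra_basis_def quantum_moment_map_def)
  have "quantum_symmetry AM st l f (\<lambda>a. \<J> (e a))"
  proof (intro quantum_symmetry.intro st lie quantum_symmetry_axioms.intro)
    fix a b assume ab: "a < l" "b < l"
    then show "st (\<J> (e a)) (\<J> (e b)) - st (\<J> (e b)) (\<J> (e a))
        = fps_X * (\<Sum>c<l. real_const (f a b c) * \<J> (e c))"
      using assms(9) J by (simp add: st_star quantum_moment_map_def star_commutator_def)
  qed (rule J)
  then interpret quantum_symmetry AM st l f "\<lambda>a. \<J> (e a)" .
  note star = st_star[symmetric]
  have delta: "apply_op delta x \<in> ghost_algebra AM l" and bd: "apply_op bd x \<in> ghost_algebra AM l"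
    if "x \<in> ghost_algebra AM l" for x
    using that preserves_delta preserves_bd by (auto simp: preserves_def)
  have square: "apply_op delta (apply_op delta x) S = 0" "apply_op bd (apply_op bd x) S = 0"
    "apply_op delta (apply_op bd x) S + apply_op bd (apply_op delta x) S = 0" for x S
    using arg_cong[OF delta_square, of "\<lambda>T. apply_op T x S"]
      arg_cong[OF bd_square, of "\<lambda>T. apply_op T x S"]
      arg_cong[OF delta_bd, of "\<lambda>T. apply_op T x S"]
    by (simp_all add: apply_op_simps)
  show ?thesis
    unfolding Let_def
    by (intro ballI conjI ext)
      (simp_all add: brst_D_apply[OF star] brst_delta_apply[OF star] brst_partial_apply[OF star]
        delta bd square)
qed

end
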